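(* Let $V\in L^\infty_{loc}(Q_T)$ satisfy $0\le V(x,t)\le C_1/t$ in $Q_T$ for some $C_1>0$, and let $\xi\in\mathbb{R}^n$. If $$\limsup_{t\to0}\int_t^T\int_{\mathbb{R}^n}\Big(\frac{1}{4\pi(s-t)}\Big)^{\frac n2}e^{-\frac{|\xi-y|^2}{4(s-t)}}V(y,s)\,dy\,ds=\infty,$$ then $\xi\in\mathcal{S}ing_V$, i.e. $H_V(x,\xi,t)=0$ for all $(x,t)\in\mathbb{R}^n\times(0,T]$.
   Context: Here $n\ge 1$, $T>0$, $Q_T=\mathbb{R}^n\times(0,T]$. The kernel $H_V$: for a bounded nonnegative measurable $W$ on $Q_T$, $H_W(x,y,t)$ denotes the heat kernel (fundamental solution) of $\partial_t-\Delta+W$, i.e. $(x,t)\mapsto H_W(x,y,t)$ is the solution, with $0\le H_W(x,y,t)\le (4\pi t)^{-n/2}e^{-|x-y|^2/(4t)}$, of $\partial_tw-\Delta w+Ww=0$ in $Q_T$ with $w(\cdot,0)=\delta_y$. For $\delta>0$ let $V_\delta(x,t)=V(x,t)$ if $t>\delta$ and $V_\delta(x,t)=0$ if $t\le\delta$; $V_\delta$ is bounded, $H_{V_\delta}$ decreases as $\delta\downarrow0$, and $H_V(x,y,t):=\lim_{\delta\to0}H_{V_\delta}(x,y,t)$. (The same limit is obtained from $H_{V_k}$, $V_k=\min\{k,V\}$, $k\to\infty$.) The zero set is $\mathcal{S}ing_V=\{y\in\mathbb{R}^n:\ H_V(x,y,t)=0 \text{ for all } (x,t)\in\mathbb{R}^n\times(0,T]\}$.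 *)

theory Defs
  imports "HOL-Analysis.Analysis"
begin

definition Q_dom :: "real \<Rightarrow> ('a::euclidean_space \<times> real) set" where
  "Q_dom T = UNIV \<times> {0<..T}"

definition gauss_kernel :: "'a::euclidean_space \<Rightarrow> real \<Rightarrow> real" where
  "gauss_kernel z t = (1 / (4 * pi * t)) powr (real DIM('a) / 2) * exp (- (norm z)\<^sup>2 / (4 * t))"

definition d_time :: "('a::euclidean_space \<Rightarrow> real \<Rightarrow> real) \<Rightarrow> 'a \<Rightarrow> real \<Rightarrow> real" where
  "d_time \<phi> x t = deriv (\<phi> x) t"

definition d_space :: "'a::euclidean_space \<Rightarrow> ('a \<Rightarrow> real \<Rightarrow> real) \<Rightarrow> 'a \<Rightarrow> real \<Rightarrow> real" where
  "d_space b \<phi> x t = deriv (\<lambda>r. \<phi> (x + r *\<^sub>R b) t) 0"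

definition laplace :: "('a::euclidean_space \<Rightarrow> real \<Rightarrow> real) \<Rightarrow> 'a \<Rightarrow> real \<Rightarrow> real" where
  "laplace \<phi> x t = (\<Sum>b\<in>Basis. d_space b (d_space b \<phi>) x t)"

definition C1_time :: "('a::euclidean_space \<Rightarrow> real \<Rightarrow> real) \<Rightarrow> bool" where
  "C1_time \<phi> \<longleftrightarrow> (\<forall>x t. \<phi> x differentiable (at t)) \<and>
     continuous_on UNIV (\<lambda>(x, t). d_time \<phi> x t)"

definition C1_space :: "('a::euclidean_space \<Rightarrow> real \<Rightarrow> real) \<Rightarrow> bool" where
  "C1_space \<phi> \<longleftrightarrow> (\<forall>b\<in>Basis. (\<forall>x t. (\<lambda>r. \<phi> (x + r *\<^sub>R b) t) differentiable (at 0)) \<and>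
     continuous_on UNIV (\<lambda>(x, t). d_space b \<phi> x t))"

text \<open>Test functions for the Cauchy problem: of class C^2 in space and C^1 in time, with compact
  support that stays away from time T but may meet the initial time 0.\<close>

definition test_function :: "real \<Rightarrow> ('a::euclidean_space \<Rightarrow> real \<Rightarrow> real) \<Rightarrow> bool" where
  "test_function T \<phi> \<longleftrightarrow>
     continuous_on UNIV (\<lambda>(x, t). \<phi> x t) \<and> C1_time \<phi> \<and> C1_space \<phi> \<and>
     (\<forall>b\<in>Basis. C1_space (d_space b \<phi>)) \<and>
     (\<exists>K. compact K \<and> K \<subseteq> UNIV \<times> {..<T} \<and> (\<forall>x t. (x, t) \<notin> K \<longrightarrow> \<phi> x t = 0))"

text \<open>Solutions are understood in the weak sense, since W is merely bounded and measurable; the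
  right-hand side of the integral identity is the initial datum, the Dirac mass at y. A weak
  solution is only determined almost everywhere; continuity selects the representative for
  which pointwise values make sense.\<close>

definition dirac_solution ::
  "real \<Rightarrow> ('a::euclidean_space \<Rightarrow> real \<Rightarrow> real) \<Rightarrow> 'a \<Rightarrow> ('a \<Rightarrow> real \<Rightarrow> real) \<Rightarrow> bool" where
  "dirac_solution T W y w \<longleftrightarrow>
     continuous_on (Q_dom T) (\<lambda>(x, t). w x t) \<and>
     (\<forall>x. \<forall>t\<in>{0<..T}. 0 \<le> w x t \<and> w x t \<le> gauss_kernel (x - y) t) \<and>
     (\<forall>\<phi>. test_function T \<phi> \<longrightarrow>
        (LINT (x, t) | lebesgue_on (Q_dom T).
           w x t * (- d_time \<phi> x t - laplace \<phi> x t + W x t * \<phi> x t)) = \<phi> y 0)"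

text \<open>For bounded nonnegative measurable W a solution exists and is unique on Q_dom T, so that
  the choice is immaterial for t in (0,T].\<close>

definition heat_kernel ::
  "real \<Rightarrow> ('a::euclidean_space \<Rightarrow> real \<Rightarrow> real) \<Rightarrow> 'a \<Rightarrow> 'a \<Rightarrow> real \<Rightarrow> real" where
  "heat_kernel T W x y t = (SOME w. dirac_solution T W y w) x t"

definition cut_potential ::
  "('a::euclidean_space \<Rightarrow> real \<Rightarrow> real) \<Rightarrow> real \<Rightarrow> 'a \<Rightarrow> real \<Rightarrow> real" where
  "cut_potential V \<delta> x t = (if t > \<delta> then V x t else 0)"

definition sing_heat_kernel ::
  "real \<Rightarrow> ('a::euclidean_space \<Rightarrow> real \<Rightarrow> real) \<Rightarrow> 'a \<Rightarrow> 'a \<Rightarrow> real \<Rightarrow> real" where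
  "sing_heat_kernel T V x y t = Lim (at_right 0) (\<lambda>\<delta>. heat_kernel T (cut_potential V \<delta>) x y t)"

definition Sing_set :: "real \<Rightarrow> ('a::euclidean_space \<Rightarrow> real \<Rightarrow> real) \<Rightarrow> 'a set" where
  "Sing_set T V = {y. \<forall>x. \<forall>t\<in>{0<..T}. sing_heat_kernel T V x y t = 0}"

definition Linf_loc :: "real \<Rightarrow> ('a::euclidean_space \<Rightarrow> real \<Rightarrow> real) \<Rightarrow> bool" where
  "Linf_loc T V \<longleftrightarrow>
     (\<lambda>(x, t). V x t) \<in> borel_measurable (lebesgue_on (Q_dom T)) \<and>
     (\<forall>K. compact K \<and> K \<subseteq> Q_dom T \<longrightarrow>
        (\<exists>M. AE (x, t) in lebesgue_on K. \<bar>V x t\<bar> \<le> M))"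

end

theory Submission
  imports Defs "HOL-Probability.Distributions"
begin

text \<open>
  Probabilistically, the hypothesis says that Brownian motion started at \<open>\<xi>\<close> has infinite expected
  exposure to \<open>V\<close> near time 0. An infinite mean alone does not force the exposure to be infinite
  almost surely, but \<open>V \<le> C/t\<close> bounds the exposure during every dyadic time interval, and the
  exposures during different dyadic intervals are almost uncorrelated. Hence the variance is at most
  of the order of the mean, and the surviving mass must vanish. The proof below is the analytic form
  of this second moment argument.

  Let \<open>K\<close> be the Gaussian kernel, \<open>k(x,t) = K(x - \<xi>, t)\<close>, let \<open>w\<close> be the heat kernel with pole \<open>\<xi>\<close> of a
  truncated potential \<open>W\<close>, and put \<open>q = W w\<close>, \<open>m(t) = \<integral> w(x,t) dx\<close> and \<open>I = \<integral>\<integral> W k\<close>, the last integral being over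
  the times between 0 and some \<open>T\<close>. Duhamel's formula \<open>w = k - K * q\<close> yields \<open>m(t) = 1 - \<integral>\<integral> q\<close> over the times up to \<open>t\<close>, so
  that \<open>m\<close> decreases and
  \<open>m(T) k(x,t) - w(x,t) \<le> \<integral>\<integral> (K(x - z, t - s) - k(x,t)) q(z,s) dz ds\<close>, over \<open>0 < s < t\<close>.
  Multiply by \<open>W(x,t)\<close> and integrate over \<open>x\<close> and \<open>t\<close>. The left-hand side is at least \<open>m(T) I - 1\<close>. On the
  right-hand side, the part \<open>s > t/2\<close> is at most \<open>C\<close> by \<open>short_lag_bound\<close>. In the part \<open>s \<le> t/2\<close>,
  the Cauchy-Schwarz inequality leads to a chi-square divergence, in dimension \<open>n\<close> the power \<open>-n\<close> of \<open>1 - s/t\<close> minus 1,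
  which is of the order \<open>s/t\<close> (\<open>heat_ker_decorrelation\<close>) and therefore summable over
  dyadic scales (\<open>correlation_bound\<close>). The outcome is \<open>m(T) I \<le> 1 + C + 2 L (\<epsilon> I + 1/\<epsilon>)\<close> for
  every \<open>\<epsilon> > 0\<close>, with \<open>L\<close> depending only on \<open>C\<close> and \<open>n\<close> (\<open>mass_times_potential_bound\<close>).

  For the potentials cut off at time \<open>\<delta>\<close>, the quantity \<open>I\<close> tends to infinity as \<open>\<delta>\<close> tends to 0; this is what the hypothesis
  means (\<open>gaussian_potential_integral_infinite\<close>). So the mass at every positive time tends to
  0, and so does \<open>w(x,t)\<close>, which is at most a constant times the mass at time \<open>t/2\<close>
  (\<open>heat_kernel_decay_bound\<close>).

  The heat kernel of the statement is an arbitrarily chosen weak solution. A weak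
  solution exists (\<open>dirac_solution_exists\<close>), by a monotone iteration, and every weak solution
  satisfies Duhamel's formula (\<open>dirac_solution_duhamel\<close>), by testing the equation with
  backward Gaussian kernels that are cut off in space and in time.
\<close>

section \<open>The Gaussian kernel\<close>

text \<open>
  Extended by 0 to nonpositive times, so that integrals of \<open>heat_ker (x - z) (t - s)\<close> over all times \<open>s\<close>
  confine themselves to \<open>s < t\<close>.
\<close>

definition heat_ker :: "'a::euclidean_space \<Rightarrow> real \<Rightarrow> real" where
  "heat_ker x t = (if 0 < t then gauss_kernel x t else 0)"

lemma gauss_kernel_measurable [measurable (raw)]:
  fixes f :: "'b \<Rightarrow> 'a::euclidean_space"
  assumes [measurable]: "f \<in> borel_measurable M" "g \<in> borel_measurable M"
  shows "(\<lambda>p. gauss_kernel (f p) (g p)) \<in> borel_measurable M"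
  unfolding gauss_kernel_def by measurable

lemma heat_ker_measurable [measurable (raw)]:
  fixes f :: "'b \<Rightarrow> 'a::euclidean_space"
  assumes [measurable]: "f \<in> borel_measurable M" "g \<in> borel_measurable M"
  shows "(\<lambda>p. heat_ker (f p) (g p)) \<in> borel_measurable M"
  unfolding heat_ker_def by measurable

lemma heat_ker_nonneg [simp]: "0 \<le> heat_ker x t"
  by (simp add: heat_ker_def gauss_kernel_def)

lemma heat_ker_pos: "0 < t \<Longrightarrow> 0 < heat_ker x t"
  by (simp add: heat_ker_def gauss_kernel_def)

lemma heat_ker_nonpos_time [simp]: "t \<le> 0 \<Longrightarrow> heat_ker x t = 0"
  by (simp add: heat_ker_def)

lemma heat_ker_minus: "heat_ker (x - y) t = heat_ker (y - x) t"
  by (simp add: heat_ker_def gauss_kernel_def norm_minus_commute)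

lemma heat_ker_eq:
  "0 < t \<Longrightarrow> heat_ker (x::'a::euclidean_space) t
     = (4 * pi * t) powr (- (real DIM('a) / 2)) * exp (- (norm x)\<^sup>2 / (4 * t))"
  by (simp add: heat_ker_def gauss_kernel_def powr_minus powr_divide divide_simps)

lemma heat_ker_le: "0 < t \<Longrightarrow> heat_ker (x::'a::euclidean_space) t \<le> (4 * pi * t) powr (- (real DIM('a) / 2))"
  by (simp add: heat_ker_eq mult_left_le)

text \<open>
  The product structure reduces the normalisation to that of the one-dimensional normal density.
\<close>

lemma heat_ker_prod_normal:
  assumes "0 < t"
  shows "heat_ker (x::'a::euclidean_space) t = (\<Prod>b\<in>Basis. normal_density 0 (sqrt (2 * t)) (x \<bullet> b))"
proof -
  have "(\<Prod>b\<in>Basis. normal_density 0 (sqrt (2 * t)) (x \<bullet> b))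
      = (\<Prod>b\<in>(Basis::'a set). (4 * pi * t) powr (- 1 / 2)) * (\<Prod>b\<in>Basis. exp (- (x \<bullet> b)\<^sup>2 / (4 * t)))"
    unfolding prod.distrib[symmetric] using assms
    by (intro prod.cong) (simp_all add: normal_density_def powr_minus powr_half_sqrt divide_simps mult_ac)
  also have "(\<Prod>b\<in>(Basis::'a set). (4 * pi * t) powr (- 1 / 2)) = (4 * pi * t) powr (- (real DIM('a) / 2))"
    using assms by (simp add: powr_powr flip: powr_realpow)
  also have "(\<Prod>b\<in>Basis. exp (- (x \<bullet> b)\<^sup>2 / (4 * t))) = exp (\<Sum>b\<in>Basis. - (x \<bullet> b)\<^sup>2 / (4 * t))"
    by (simp add: exp_sum)
  also have "(\<Sum>b\<in>Basis. - (x \<bullet> b)\<^sup>2 / (4 * t)) = - (norm x)\<^sup>2 / (4 * t)"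
  proof -
    have "(norm x)\<^sup>2 = (\<Sum>b\<in>Basis. (x \<bullet> b)\<^sup>2)"
      unfolding power2_norm_eq_inner by (subst euclidean_inner) (simp add: power2_eq_square)
    then show ?thesis by (simp add: sum_negf flip: sum_divide_distrib)
  qed
  finally show ?thesis using assms by (simp add: heat_ker_eq)
qed

lemma nn_integral_heat_ker:
  assumes "0 < t"
  shows "(\<integral>\<^sup>+ x. ennreal (heat_ker (x::'a::euclidean_space) t) \<partial>lborel) = 1"
proof -
  have "(\<integral>\<^sup>+ x. ennreal (heat_ker (x::'a) t) \<partial>lborel)
      = (\<integral>\<^sup>+ x. (\<Prod>b\<in>(Basis::'a set). ennreal (normal_density 0 (sqrt (2 * t)) (x \<bullet> b))) \<partial>lborel)"
    using assms by (simp add: heat_ker_prod_normal prod_ennreal)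
  also have "\<dots> = (\<Prod>b\<in>(Basis::'a set). (\<integral>\<^sup>+x. ennreal (normal_density 0 (sqrt (2 * t)) x) \<partial>lborel))"
    by (rule nn_integral_lborel_prod) auto
  also have "\<dots> = 1"
    using assms by (subst nn_integral_eq_integral) auto
  finally show ?thesis .
qed

lemma nn_integral_lborel_translate:
  fixes f :: "'a::euclidean_space \<Rightarrow> ennreal"
  assumes [measurable]: "f \<in> borel_measurable borel"
  shows "(\<integral>\<^sup>+ x. f (x + y) \<partial>lborel) = (\<integral>\<^sup>+ x. f x \<partial>lborel)"
proof -
  have "(\<integral>\<^sup>+ x. f x \<partial>lborel) = (\<integral>\<^sup>+ x. f x \<partial>distr lborel borel ((+) y))"
    by (simp add: lborel_distr_plus)
  also have "\<dots> = (\<integral>\<^sup>+ x. f (y + x) \<partial>lborel)"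
    by (rule nn_integral_distr) auto
  finally show ?thesis by (simp add: add.commute)
qed

lemma nn_integral_heat_ker_shift:
  assumes "0 < t"
  shows "(\<integral>\<^sup>+ x. ennreal (heat_ker (x - (y::'a::euclidean_space)) t) \<partial>lborel) = 1"
    and "(\<integral>\<^sup>+ x. ennreal (heat_ker (y - x) t) \<partial>lborel) = 1"
proof -
  show *: "(\<integral>\<^sup>+ x. ennreal (heat_ker (x - (y::'a)) t) \<partial>lborel) = 1"
    using nn_integral_lborel_translate[of "\<lambda>x. ennreal (heat_ker (x::'a) t)" "- y"]
    by (simp add: nn_integral_heat_ker assms)
  then show "(\<integral>\<^sup>+ x. ennreal (heat_ker (y - x) t) \<partial>lborel) = 1"
    by (subst heat_ker_minus)
qed

text \<open>
  Completing the square: as a function of \<open>z\<close>, the product of the two Gaussians is a Gaussian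
  centred at a weighted mean of \<open>x\<close> and \<open>y\<close>. The semigroup law follows by integrating over \<open>z\<close>.
\<close>

lemma heat_ker_mult_complete_square:
  fixes x y z :: "'a::euclidean_space"
  assumes "0 < s" "0 < t"
  shows "heat_ker (x - z) t * heat_ker (z - y) s
    = heat_ker (x - y) (t + s) * heat_ker (z - ((s / (s + t)) *\<^sub>R x + (t / (s + t)) *\<^sub>R y)) (t * s / (t + s))"
proof -
  define c where "c = (s / (s + t)) *\<^sub>R x + (t / (s + t)) *\<^sub>R y"
  define n where "n = - (real DIM('a) / 2)"
  have st: "s + t > 0" "t * s / (t + s) > 0" using assms by (auto simp: divide_simps)
  have "(4 * pi * t) powr n * (4 * pi * s) powr n = ((4 * pi * t) * (4 * pi * s)) powr n"
    by (rule powr_mult[symmetric])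
  also have "\<dots> = ((4 * pi * (t + s)) * (4 * pi * (t * s / (t + s)))) powr n"
  proof -
    have "(4 * pi * t) * (4 * pi * s) = (4 * pi * (t + s)) * (4 * pi * (t * s / (t + s)))"
      using st by (simp add: divide_simps add.commute)
    then show ?thesis by simp
  qed
  also have "\<dots> = (4 * pi * (t + s)) powr n * (4 * pi * (t * s / (t + s))) powr n"
    by (rule powr_mult)
  finally have 1: "(4 * pi * t) powr n * (4 * pi * s) powr n = \<dots>" .
  define u where "u = x - z"
  define v where "v = z - y"
  have zc: "z - c = (t / (s + t)) *\<^sub>R v - (s / (s + t)) *\<^sub>R u"
  proof -
    have "z = (s / (s + t)) *\<^sub>R z + (t / (s + t)) *\<^sub>R z"
      using st by (simp add: divide_simps flip: scaleR_add_left)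
    then show ?thesis unfolding c_def u_def v_def by (simp add: algebra_simps)
  qed
  have xy: "x - y = u + v" by (simp add: u_def v_def)
  have "(norm u)\<^sup>2 / (4 * t) + (norm v)\<^sup>2 / (4 * s)
      = (norm (x - y))\<^sup>2 / (4 * (t + s)) + (norm (z - c))\<^sup>2 / (4 * (t * s / (t + s)))"
    unfolding zc xy power2_norm_eq_inner using assms st
    apply (simp add: inner_add_left inner_add_right inner_diff_left inner_diff_right inner_commute[of v u])
    apply (simp add: divide_simps)
    apply (simp add: algebra_simps power2_eq_square)
    done
  then have 2: "exp (- (norm u)\<^sup>2 / (4 * t)) * exp (- (norm v)\<^sup>2 / (4 * s))
      = exp (- (norm (x - y))\<^sup>2 / (4 * (t + s))) * exp (- (norm (z - c))\<^sup>2 / (4 * (t * s / (t + s))))"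
    by (simp flip: exp_add)
  show ?thesis
    unfolding c_def[symmetric] using assms st 1 2
    by (simp add: heat_ker_eq u_def[symmetric] v_def[symmetric] n_def[symmetric] mult_ac
         del: times_divide_eq_right times_divide_eq_left)
qed

lemma heat_ker_semigroup:
  fixes x y :: "'a::euclidean_space"
  assumes "0 < s" "0 < t"
  shows "(\<integral>\<^sup>+ z. ennreal (heat_ker (x - z) t) * ennreal (heat_ker (z - y) s) \<partial>lborel)
    = ennreal (heat_ker (x - y) (t + s))"
proof -
  have "t * s / (t + s) > 0" using assms by (auto simp: divide_simps)
  then show ?thesis
    using assms
    by (simp add: heat_ker_mult_complete_square nn_integral_cmult nn_integral_heat_ker_shift ennreal_mult flip: ennreal_mult)
      (simp add: heat_ker_mult_complete_square ennreal_mult nn_integral_cmult nn_integral_heat_ker_shift)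
qed

section \<open>Decorrelation of the heat flow at distant times\<close>

lemma heat_ker_square:
  fixes y :: "'a::euclidean_space"
  assumes "0 < \<sigma>"
  shows "(heat_ker y \<sigma>)\<^sup>2 = (8 * pi * \<sigma>) powr (- (real DIM('a) / 2)) * heat_ker y (\<sigma> / 2)"
proof -
  define p where "p = - (real DIM('a) / 2)"
  have "((4 * pi * \<sigma>) powr p)\<^sup>2 = ((4 * pi * \<sigma>) * (4 * pi * \<sigma>)) powr p"
    unfolding power2_eq_square by (rule powr_mult[symmetric])
  also have "(4 * pi * \<sigma>) * (4 * pi * \<sigma>) = (8 * pi * \<sigma>) * (2 * pi * \<sigma>)" by simp
  also have "\<dots> powr p = (8 * pi * \<sigma>) powr p * (2 * pi * \<sigma>) powr p" by (rule powr_mult)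
  finally have 1: "((4 * pi * \<sigma>) powr p)\<^sup>2 = \<dots>" .
  have 2: "(exp (- (norm y)\<^sup>2 / (4 * \<sigma>)))\<^sup>2 = exp (- (norm y)\<^sup>2 / (2 * \<sigma>))"
    by (simp add: power2_eq_square flip: exp_add)
  show ?thesis
    using assms 2 1 by (simp add: heat_ker_eq power_mult_distrib p_def[symmetric] mult_ac)
qed

text \<open>
  Dividing a Gaussian by a wider one leaves a Gaussian. The normalising constants combine to the value of
  the chi-square integral below.
\<close>

lemma heat_ker_ratio:
  fixes x :: "'a::euclidean_space"
  assumes "0 < s" "s < t"
  shows "(8 * pi * (t - s)) powr (- (real DIM('a) / 2)) * heat_ker x ((t + s) / 2)
    = (t / (t - s)) ^ DIM('a) * (heat_ker x t * heat_ker x (t * (t + s) / (t - s)))"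
proof -
  define p where "p = - (real DIM('a) / 2)"
  define r where "r = t * (t + s) / (t - s)"
  have r: "0 < r" using assms by (simp add: r_def)
  have "(t / (t - s)) ^ DIM('a) = (t / (t - s)) powr real DIM('a)"
    using assms by (simp add: powr_realpow)
  also have "\<dots> = (((t - s) / t) powr 2) powr p"
  proof -
    have "(((t - s) / t) powr 2) powr p = ((t - s) / t) powr (- real DIM('a))"
      by (simp add: powr_powr p_def)
    then show ?thesis
      using assms by (simp add: powr_minus powr_divide divide_simps)
  qed
  also have "((t - s) / t) powr 2 = ((t - s) / t)\<^sup>2"
    using assms by (simp add: powr_numeral)
  finally have e: "(t / (t - s)) ^ DIM('a) = (((t - s) / t)\<^sup>2) powr p" .
  have "(t / (t - s)) ^ DIM('a) * ((4 * pi * t) powr p * (4 * pi * r) powr p)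
     = (((t - s) / t)\<^sup>2 * ((4 * pi * t) * (4 * pi * r))) powr p"
    unfolding e powr_mult ..
  also have "((t - s) / t)\<^sup>2 * ((4 * pi * t) * (4 * pi * r)) = (8 * pi * (t - s)) * (4 * pi * ((t + s) / 2))"
    using assms by (simp add: r_def divide_simps power2_eq_square)
  also have "\<dots> powr p = (8 * pi * (t - s)) powr p * (4 * pi * ((t + s) / 2)) powr p"
    by (rule powr_mult)
  finally have 1: "(t / (t - s)) ^ DIM('a) * ((4 * pi * t) powr p * (4 * pi * r) powr p) = \<dots>" .
  have "(norm x)\<^sup>2 / (4 * ((t + s) / 2)) = (norm x)\<^sup>2 / (4 * t) + (norm x)\<^sup>2 / (4 * r)"
    using assms by (simp add: r_def divide_simps) (simp add: algebra_simps)?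
  then have 2: "exp (- (norm x)\<^sup>2 / (4 * ((t + s) / 2))) = exp (- (norm x)\<^sup>2 / (4 * t)) * exp (- (norm x)\<^sup>2 / (4 * r))"
    by (simp flip: exp_add)
  have "(8 * pi * (t - s)) powr p * ((4 * pi * ((t + s) / 2)) powr p * exp (- (norm x)\<^sup>2 / (4 * ((t + s) / 2))))
    = (t / (t - s)) ^ DIM('a) * ((4 * pi * t) powr p * exp (- (norm x)\<^sup>2 / (4 * t))
        * ((4 * pi * r) powr p * exp (- (norm x)\<^sup>2 / (4 * r))))"
    (is "?lhs = ?rhs")
  proof -
    have "?lhs = ((8 * pi * (t - s)) powr p * (4 * pi * ((t + s) / 2)) powr p)
        * (exp (- (norm x)\<^sup>2 / (4 * t)) * exp (- (norm x)\<^sup>2 / (4 * r)))"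
      unfolding 2 by (simp only: mult_ac)
    also have "\<dots> = ?rhs"
      unfolding 1[symmetric] by (simp only: mult_ac)
    finally show ?thesis .
  qed
  then show ?thesis
    unfolding r_def[symmetric] using assms r by (simp only: heat_ker_eq[symmetric] p_def[symmetric])
      (simp add: heat_ker_eq p_def)
qed

text \<open>
  One plus the chi-square divergence of the joint law, at the times \<open>s\<close> and \<open>t\<close>, of the Brownian
  motion started at \<open>y\<close> from the product of its marginals. The square of the Gaussian is a multiple of a Gaussian
  with half the variance, so the integral over \<open>z\<close> is an instance of the semigroup law, and the remaining
  quotient is \<open>heat_ker_ratio\<close>.
\<close>

lemma heat_ker_chi_square_integral:
  fixes y :: "'a::euclidean_space"
  assumes "0 < s" "s < t"
  shows "(\<integral>\<^sup>+ x. \<integral>\<^sup>+ z. ennreal (heat_ker (z - y) s * (heat_ker (x - z) (t - s))\<^sup>2 / heat_ker (x - y) t)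
     \<partial>lborel \<partial>lborel) = ennreal ((t / (t - s)) ^ DIM('a))"
proof -
  define c where "c = (8 * pi * (t - s)) powr (- (real DIM('a) / 2))"
  have c: "c \<ge> 0" by (simp add: c_def)
  have inner: "(\<integral>\<^sup>+ z. ennreal (heat_ker (z - y) s * (heat_ker (x - z) (t - s))\<^sup>2 / heat_ker (x - y) t) \<partial>lborel)
      = ennreal ((t / (t - s)) ^ DIM('a)) * ennreal (heat_ker (x - y) (t * (t + s) / (t - s)))" for x
  proof -
    have kt: "0 < heat_ker (x - y) t" using assms by (simp add: heat_ker_pos)
    have "(\<integral>\<^sup>+ z. ennreal (heat_ker (z - y) s * (heat_ker (x - z) (t - s))\<^sup>2 / heat_ker (x - y) t) \<partial>lborel)
       = (\<integral>\<^sup>+ z. ennreal (c / heat_ker (x - y) t) * (ennreal (heat_ker (x - z) ((t - s) / 2)) * ennreal (heat_ker (z - y) s)) \<partial>lborel)"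
      using assms c by (intro nn_integral_cong)
         (simp add: heat_ker_square c_def flip: ennreal_mult)
    also have "\<dots> = ennreal (c / heat_ker (x - y) t) * ennreal (heat_ker (x - y) ((t - s) / 2 + s))"
      using assms by (subst nn_integral_cmult) (simp_all add: heat_ker_semigroup)
    also have "(t - s) / 2 + s = (t + s) / 2" by (simp add: field_simps)
    also have "ennreal (c / heat_ker (x - y) t) * ennreal (heat_ker (x - y) ((t + s) / 2))
       = ennreal (c * heat_ker (x - y) ((t + s) / 2) / heat_ker (x - y) t)"
      using c by (simp flip: ennreal_mult)
    also have "c * heat_ker (x - y) ((t + s) / 2) / heat_ker (x - y) t
       = (t / (t - s)) ^ DIM('a) * heat_ker (x - y) (t * (t + s) / (t - s))"
      unfolding c_def heat_ker_ratio[OF assms] using kt by simp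
    finally show ?thesis using assms by (simp add: ennreal_mult)
  qed
  show ?thesis
    unfolding inner using assms by (subst nn_integral_cmult) (simp_all add: nn_integral_heat_ker_shift)
qed

lemma power_minus_one_le:
  fixes u :: real
  assumes "1 \<le> u" "u \<le> 2"
  shows "u ^ n - 1 \<le> (2 ^ n - 1) * (u - 1)"
proof (induction n)
  case (Suc n)
  have "u ^ Suc n - 1 = u * (u ^ n - 1) + (u - 1)" by (simp add: algebra_simps)
  also have "\<dots> \<le> 2 * (u ^ n - 1) + (u - 1)"
    using assms by (intro add_right_mono mult_right_mono) auto
  also have "\<dots> \<le> 2 * ((2 ^ n - 1) * (u - 1)) + (u - 1)"
    using Suc by simp
  finally show ?case by (simp add: algebra_simps)
qed simp

text \<open>
  Positions at times that are far apart on the logarithmic scale are nearly independent: after expanding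
  the square, two of the three terms are total masses equal to one, and what is left is the
  chi-square divergence \<open>(t/(t - s))^n - 1\<close>, which is of the order \<open>s/t\<close>.
\<close>

lemma heat_ker_decorrelation:
  fixes y :: "'a::euclidean_space"
  assumes "0 < s" "2 * s \<le> t"
  shows "(\<integral>\<^sup>+ x. \<integral>\<^sup>+ z. ennreal (heat_ker (z - y) s * (heat_ker (x - z) (t - s) - heat_ker (x - y) t)\<^sup>2
      / heat_ker (x - y) t) \<partial>lborel \<partial>lborel) \<le> ennreal (2 ^ (DIM('a) + 1) * s / t)"
    (is "?L \<le> _")
proof -
  have st: "s < t" "0 < t" using assms by auto
  let ?R = "\<integral>\<^sup>+ x. \<integral>\<^sup>+ z. ennreal (heat_ker (z - y) s * (heat_ker (x - z) (t - s))\<^sup>2 / heat_ker (x - y) t)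
     \<partial>lborel \<partial>lborel"
  let ?J = "\<integral>\<^sup>+ x. \<integral>\<^sup>+ z. ennreal (heat_ker (x - z) (t - s)) * ennreal (heat_ker (z - y) s) \<partial>lborel \<partial>lborel"
  let ?P = "\<integral>\<^sup>+ x. \<integral>\<^sup>+ z. ennreal (heat_ker (x - y) t) * ennreal (heat_ker (z - y) s) \<partial>lborel \<partial>lborel"
  have J: "?J = 1" using assms st by (simp add: heat_ker_semigroup nn_integral_heat_ker_shift)
  have P: "?P = 1" using assms st
    by (simp add: nn_integral_cmult nn_integral_multc nn_integral_heat_ker_shift)
  have pt: "ennreal (heat_ker (z - y) s * (heat_ker (x - z) (t - s) - heat_ker (x - y) t)\<^sup>2 / heat_ker (x - y) t)
      + 2 * (ennreal (heat_ker (x - z) (t - s)) * ennreal (heat_ker (z - y) s))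
     = ennreal (heat_ker (z - y) s * (heat_ker (x - z) (t - s))\<^sup>2 / heat_ker (x - y) t)
      + ennreal (heat_ker (x - y) t) * ennreal (heat_ker (z - y) s)" for x z
  proof -
    have kt: "0 < heat_ker (x - y) t" using st by (simp add: heat_ker_pos)
    have two: "(2::ennreal) = ennreal 2" by simp
    have "heat_ker (z - y) s * (heat_ker (x - z) (t - s) - heat_ker (x - y) t)\<^sup>2 / heat_ker (x - y) t
        + 2 * (heat_ker (x - z) (t - s) * heat_ker (z - y) s)
       = heat_ker (z - y) s * (heat_ker (x - z) (t - s))\<^sup>2 / heat_ker (x - y) t
        + heat_ker (x - y) t * heat_ker (z - y) s"
      using kt by (simp add: field_simps power2_eq_square)
    then show ?thesis
      unfolding two by (simp flip: ennreal_mult ennreal_plus del: ennreal_numeral)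
  qed
  have "?L + 2 * ?J = ?R + ?P"
  proof -
    have "?L + 2 * ?J = (\<integral>\<^sup>+ x. \<integral>\<^sup>+ z. (ennreal (heat_ker (z - y) s * (heat_ker (x - z) (t - s) - heat_ker (x - y) t)\<^sup>2 / heat_ker (x - y) t)
      + 2 * (ennreal (heat_ker (x - z) (t - s)) * ennreal (heat_ker (z - y) s))) \<partial>lborel \<partial>lborel)"
      by (simp add: nn_integral_add nn_integral_cmult)
    also have "\<dots> = ?R + ?P"
      unfolding pt by (simp add: nn_integral_add)
    finally show ?thesis .
  qed
  then have "?L + 2 = ennreal ((t / (t - s)) ^ DIM('a)) + 1"
    unfolding J P heat_ker_chi_square_integral[OF assms(1) st(1)] by simp
  also have "\<dots> \<le> ennreal (2 ^ (DIM('a) + 1) * s / t) + 2"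
  proof -
    have u: "1 \<le> t / (t - s)" "t / (t - s) \<le> 2" using assms st by (auto simp: divide_simps)
    have "(t / (t - s)) ^ DIM('a) - 1 \<le> (2 ^ DIM('a) - 1) * (t / (t - s) - 1)"
      by (rule power_minus_one_le[OF u])
    also have "\<dots> \<le> 2 ^ DIM('a) * (2 * (s / t))"
    proof (rule mult_mono)
      have "t / (t - s) - 1 = s * (1 / (t - s))" using st by (simp add: divide_simps)
      also have "\<dots> \<le> s * (2 / t)" using assms st by (intro mult_left_mono) (auto simp: divide_simps)
      finally show "t / (t - s) - 1 \<le> 2 * (s / t)" by (simp add: mult.commute)
    qed (use u in auto)
    finally have "(t / (t - s)) ^ DIM('a) + 1 \<le> 2 ^ (DIM('a) + 1) * s / t + 2" by (simp add: algebra_simps)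
    then show ?thesis using assms st
      by (simp flip: ennreal_plus ennreal_1 ennreal_numeral add: ennreal_leI)
  qed
  finally show ?thesis by (simp add: add.commute[of _ 2] ennreal_add_left_cancel_le)
qed

section \<open>Loss of mass implied by Duhamel's formula\<close>

text \<open>
  Space-time functions are curried here; this turns their joint measurability into a rule for the
  measurability prover.
\<close>

lemma measurable_curried:
  fixes W :: "'a::euclidean_space \<Rightarrow> real \<Rightarrow> 'c::topological_space"
  assumes "(\<lambda>(x, t). W x t) \<in> borel_measurable borel"
    "f \<in> borel_measurable M" "g \<in> borel_measurable M"
  shows "(\<lambda>p. W (f p) (g p)) \<in> borel_measurable M"
proof -
  have "(\<lambda>p. (f p, g p)) \<in> borel_measurable M"
    using assms(2,3) by (rule borel_measurable_Pair)
  from measurable_compose[OF this assms(1)] show ?thesis by simp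
qed

lemma nn_integral_reorder:
  fixes f :: "real \<Rightarrow> 'a::euclidean_space \<Rightarrow> real \<Rightarrow> 'a \<Rightarrow> ennreal"
  assumes [measurable]: "(\<lambda>(t, x, s, z). f t x s z) \<in> borel_measurable (lborel \<Otimes>\<^sub>M lborel \<Otimes>\<^sub>M lborel \<Otimes>\<^sub>M lborel)"
  shows "(\<integral>\<^sup>+t. \<integral>\<^sup>+x. \<integral>\<^sup>+s. \<integral>\<^sup>+z. f t x s z \<partial>lborel \<partial>lborel \<partial>lborel \<partial>lborel)
      = (\<integral>\<^sup>+s. \<integral>\<^sup>+t. \<integral>\<^sup>+x. \<integral>\<^sup>+z. f t x s z \<partial>lborel \<partial>lborel \<partial>lborel \<partial>lborel)"
    and "(\<integral>\<^sup>+t. \<integral>\<^sup>+x. \<integral>\<^sup>+s. \<integral>\<^sup>+z. f t x s z \<partial>lborel \<partial>lborel \<partial>lborel \<partial>lborel)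
      = (\<integral>\<^sup>+s. \<integral>\<^sup>+z. \<integral>\<^sup>+t. \<integral>\<^sup>+x. f t x s z \<partial>lborel \<partial>lborel \<partial>lborel \<partial>lborel)"
proof -
  have [measurable (raw)]: "(\<lambda>p. f (a p) (b p) (c p) (d p)) \<in> borel_measurable M"
    if [measurable]: "a \<in> borel_measurable M" "b \<in> borel_measurable M" "c \<in> borel_measurable M" "d \<in> borel_measurable M"
    for a b c d and M :: "'b measure"
  proof -
    have "(\<lambda>p. (a p, b p, c p, d p)) \<in> M \<rightarrow>\<^sub>M lborel \<Otimes>\<^sub>M lborel \<Otimes>\<^sub>M lborel \<Otimes>\<^sub>M lborel"
      by measurable
    from measurable_compose[OF this assms] show ?thesis by simp
  qed
  let ?r = "\<integral>\<^sup>+s. \<integral>\<^sup>+t. \<integral>\<^sup>+x. \<integral>\<^sup>+z. f t x s z \<partial>lborel \<partial>lborel \<partial>lborel \<partial>lborel"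
  have "(\<integral>\<^sup>+x. \<integral>\<^sup>+s. \<integral>\<^sup>+z. f t x s z \<partial>lborel \<partial>lborel \<partial>lborel)
      = (\<integral>\<^sup>+s. \<integral>\<^sup>+x. \<integral>\<^sup>+z. f t x s z \<partial>lborel \<partial>lborel \<partial>lborel)" for t
    by (rule lborel_pair.Fubini'[symmetric]) measurable
  moreover have "(\<integral>\<^sup>+t. \<integral>\<^sup>+s. \<integral>\<^sup>+x. \<integral>\<^sup>+z. f t x s z \<partial>lborel \<partial>lborel \<partial>lborel \<partial>lborel) = ?r"
    by (rule lborel_pair.Fubini'[symmetric]) measurable
  ultimately show r: "(\<integral>\<^sup>+t. \<integral>\<^sup>+x. \<integral>\<^sup>+s. \<integral>\<^sup>+z. f t x s z \<partial>lborel \<partial>lborel \<partial>lborel \<partial>lborel) = ?r"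
    by simp
  have "(\<integral>\<^sup>+x. \<integral>\<^sup>+z. f t x s z \<partial>lborel \<partial>lborel) = (\<integral>\<^sup>+z. \<integral>\<^sup>+x. f t x s z \<partial>lborel \<partial>lborel)" for s t
    by (rule lborel_pair.Fubini'[symmetric]) measurable
  moreover have "(\<integral>\<^sup>+t. \<integral>\<^sup>+z. \<integral>\<^sup>+x. f t x s z \<partial>lborel \<partial>lborel \<partial>lborel)
      = (\<integral>\<^sup>+z. \<integral>\<^sup>+t. \<integral>\<^sup>+x. f t x s z \<partial>lborel \<partial>lborel \<partial>lborel)" for s
    by (rule lborel_pair.Fubini'[symmetric]) measurable
  ultimately show "(\<integral>\<^sup>+t. \<integral>\<^sup>+x. \<integral>\<^sup>+s. \<integral>\<^sup>+z. f t x s z \<partial>lborel \<partial>lborel \<partial>lborel \<partial>lborel)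
      = (\<integral>\<^sup>+s. \<integral>\<^sup>+z. \<integral>\<^sup>+t. \<integral>\<^sup>+x. f t x s z \<partial>lborel \<partial>lborel \<partial>lborel \<partial>lborel)"
    unfolding r by simp
qed

text \<open>
  The inequality between the geometric and the arithmetic mean, up to a factor 2.
\<close>

lemma ennreal_le_add_of_square_le:
  fixes x a b :: ennreal
  assumes "x\<^sup>2 \<le> a * b"
  shows "x \<le> a + b"
proof (cases "a = \<infinity> \<or> b = \<infinity>")
  case False
  then obtain a' b' where ab: "a = ennreal a'" "b = ennreal b'" "0 \<le> a'" "0 \<le> b'"
    by (metis ennreal_cases infinity_ennreal_def)
  have "x \<noteq> \<infinity>"
  proof
    assume "x = \<infinity>"
    with assms have "\<infinity> \<le> ennreal (a' * b')"
      by (simp add: ab power2_eq_square ennreal_mult)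
    then show False by (simp add: top_unique)
  qed
  then obtain x' where x: "x = ennreal x'" "0 \<le> x'" by (metis ennreal_cases infinity_ennreal_def)
  have "x'\<^sup>2 \<le> a' * b'"
    using assms ab x by (simp add: ennreal_power flip: ennreal_mult)
  also have "\<dots> \<le> (a' + b')\<^sup>2"
    using ab by (simp add: power2_eq_square algebra_simps)
  finally have "x' \<le> a' + b'" by (rule power2_le_imp_le) (use ab in auto)
  then show ?thesis using ab x by (simp add: ennreal_leI flip: ennreal_plus)
qed auto

text \<open>
  The weights of this lemma and the next one have the product \<open>1/t\<^sup>2\<close> and bounded integrals, the first
  one over \<open>s\<close> and the second one over \<open>t\<close>. They serve as weights of a Schur test in
  \<open>correlation_bound\<close>.
\<close>

lemma nn_integral_inverse_sqrt:
  assumes "0 < t"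
  shows "(\<integral>\<^sup>+s. ennreal (1 / (sqrt s * sqrt t)) * indicator {0<..<t} s \<partial>lborel) \<le> 2"
proof -
  have "((\<lambda>s. s powr (- 1 / 2)) has_integral (t powr (- 1 / 2 + 1) / (- 1 / 2 + 1))) {0..t}"
    using assms by (intro has_integral_powr_from_0) auto
  then have "((\<lambda>s. s powr (- 1 / 2)) has_integral (2 * sqrt t)) {0..t}"
    using assms by (simp add: powr_half_sqrt mult.commute)
  then have *: "(\<integral>\<^sup>+s. ennreal (indicator {0..t} s * s powr (- 1 / 2)) \<partial>lborel) = ennreal (2 * sqrt t)"
    by (intro nn_integral_has_integral_lebesgue) auto
  have "(\<integral>\<^sup>+s. ennreal (1 / (sqrt s * sqrt t)) * indicator {0<..<t} s \<partial>lborel)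
      \<le> (\<integral>\<^sup>+s. ennreal (1 / sqrt t) * ennreal (indicator {0..t} s * s powr (- 1 / 2)) \<partial>lborel)"
    using assms
    by (intro nn_integral_mono)
      (auto simp: indicator_def powr_minus powr_half_sqrt divide_simps simp flip: ennreal_mult intro!: ennreal_leI)
  also have "\<dots> = ennreal (1 / sqrt t * (2 * sqrt t))"
    using assms * by (subst nn_integral_cmult) (auto simp flip: ennreal_mult)
  also have "\<dots> = 2" using assms by simp
  finally show ?thesis .
qed

lemma nn_integral_tail_inverse_sqrt:
  assumes "0 < s"
  shows "(\<integral>\<^sup>+t. ennreal (sqrt s / (t * sqrt t)) * indicator {s..} t \<partial>lborel) \<le> 2"
proof -
  have "(\<integral>\<^sup>+t. ennreal (sqrt s / (t * sqrt t)) * indicator {s..} t \<partial>lborel)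
     = ennreal (0 - (- 2 * sqrt s / sqrt s))"
  proof (rule nn_integral_FTC_atLeast[where F = "\<lambda>t. - 2 * sqrt s / sqrt t"])
    show "((\<lambda>t. - 2 * sqrt s / sqrt t) \<longlongrightarrow> 0) at_top"
      by (intro tendsto_divide_0[OF tendsto_const] filterlim_at_top_imp_at_infinity sqrt_at_top)
    fix t assume "s \<le> t"
    with assms have "0 < t" by simp
    then show "((\<lambda>t. - 2 * sqrt s / sqrt t) has_real_derivative sqrt s / (t * sqrt t)) (at t)"
      by (auto intro!: derivative_eq_intros simp: divide_simps)
    show "0 \<le> sqrt s / (t * sqrt t)" using \<open>0 < t\<close> assms by simp
  qed simp
  also have "\<dots> = 2" using assms by simp
  finally show ?thesis by simp
qed

text \<open>
  Duhamel's formula integrated over \<open>x\<close>: the kernel has total mass one.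
\<close>

lemma duhamel_mass:
  fixes W w :: "'a::euclidean_space \<Rightarrow> real \<Rightarrow> real"
  assumes W_meas: "(\<lambda>(x, t). W x t) \<in> borel_measurable borel"
    and w_meas: "(\<lambda>(x, t). w x t) \<in> borel_measurable borel"
    and "0 < t"
    and duh: "\<And>x. ennreal (w x t) + (\<integral>\<^sup>+s. \<integral>\<^sup>+z. ennreal (heat_ker (x - z) (t - s)) * ennreal (W z s * w z s)
        \<partial>lborel \<partial>lborel) = ennreal (heat_ker (x - y) t)"
  shows "(\<integral>\<^sup>+x. ennreal (w x t) \<partial>lborel) + (\<integral>\<^sup>+s. \<integral>\<^sup>+z. ennreal (W z s * w z s) * indicator {..<t} s \<partial>lborel \<partial>lborel) = 1"
proof -
  note [measurable (raw)] = measurable_curried[OF W_meas] measurable_curried[OF w_meas]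
  have "(\<integral>\<^sup>+s. \<integral>\<^sup>+z. ennreal (W z s * w z s) * indicator {..<t} s \<partial>lborel \<partial>lborel)
      = (\<integral>\<^sup>+s. \<integral>\<^sup>+z. \<integral>\<^sup>+x. ennreal (heat_ker (x - z) (t - s)) * ennreal (W z s * w z s) \<partial>lborel \<partial>lborel \<partial>lborel)"
    by (intro nn_integral_cong) (auto simp: nn_integral_multc nn_integral_heat_ker_shift indicator_def)
  also have "\<dots> = (\<integral>\<^sup>+s. \<integral>\<^sup>+x. \<integral>\<^sup>+z. ennreal (heat_ker (x - z) (t - s)) * ennreal (W z s * w z s) \<partial>lborel \<partial>lborel \<partial>lborel)"
    by (intro nn_integral_cong lborel_pair.Fubini') measurable
  also have "\<dots> = (\<integral>\<^sup>+x. \<integral>\<^sup>+s. \<integral>\<^sup>+z. ennreal (heat_ker (x - z) (t - s)) * ennreal (W z s * w z s) \<partial>lborel \<partial>lborel \<partial>lborel)"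
    by (intro lborel_pair.Fubini') measurable
  finally have "(\<integral>\<^sup>+x. ennreal (w x t) \<partial>lborel) + (\<integral>\<^sup>+s. \<integral>\<^sup>+z. ennreal (W z s * w z s) * indicator {..<t} s \<partial>lborel \<partial>lborel)
     = (\<integral>\<^sup>+x. (ennreal (w x t) + (\<integral>\<^sup>+s. \<integral>\<^sup>+z. ennreal (heat_ker (x - z) (t - s)) * ennreal (W z s * w z s)
        \<partial>lborel \<partial>lborel)) \<partial>lborel)"
    by (subst nn_integral_add) measurable
  also have "\<dots> = 1"
    unfolding duh using \<open>0 < t\<close> by (simp add: nn_integral_heat_ker_shift)
  finally show ?thesis .
qed

text \<open>
  Cauchy-Schwarz over the pairs \<open>(x, z)\<close> with the weight \<open>K(x - y, t) K(z - y, s)\<close>. Let \<open>F\<close> and \<open>G\<close> be the two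
  integrals on the right. By \<open>W \<le> C/t\<close> and \<open>w \<le> K\<close> the first factor is at most \<open>C\<^sup>2 F G / (t s)\<close>, and
  \<open>heat_ker_decorrelation\<close> bounds the second one. So the square of the left-hand side is at most \<open>(L/t)\<^sup>2 F G\<close>,
  and the geometric mean of \<open>F\<close> and \<open>G\<close> is split with Schur weights. The parameter \<open>\<epsilon>\<close> allows the \<open>F\<close> part to be absorbed later.
\<close>

lemma correlation_bound:
  fixes W w :: "'a::euclidean_space \<Rightarrow> real \<Rightarrow> real" and y :: 'a
  assumes W_meas: "(\<lambda>(x, t). W x t) \<in> borel_measurable borel"
    and w_meas: "(\<lambda>(x, t). w x t) \<in> borel_measurable borel"
    and C: "0 \<le> C"
    and W: "\<And>x t. 0 < t \<Longrightarrow> 0 \<le> W x t \<and> W x t \<le> C / t"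
    and w: "\<And>x t. 0 \<le> w x t \<and> w x t \<le> heat_ker (x - y) t"
    and "0 < \<epsilon>" and st: "0 < s" "2 * s \<le> t"
    and L: "L = C * sqrt (2 ^ (DIM('a) + 1))"
  shows "(\<integral>\<^sup>+x. \<integral>\<^sup>+z. ennreal (W x t) * ennreal (\<bar>heat_ker (x - z) (t - s) - heat_ker (x - y) t\<bar>) * ennreal (W z s * w z s) \<partial>lborel \<partial>lborel)
    \<le> ennreal (L * \<epsilon> / (sqrt s * sqrt t)) * (\<integral>\<^sup>+x. ennreal (W x t * heat_ker (x - y) t) \<partial>lborel)
      + ennreal (L * sqrt s / (\<epsilon> * (t * sqrt t))) * (\<integral>\<^sup>+z. ennreal (W z s * w z s) \<partial>lborel)"
  (is "?H \<le> _ * ?F + _ * ?G")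
proof -
  note [measurable (raw)] = measurable_curried[OF W_meas] measurable_curried[OF w_meas]
  have t: "0 < t" using st by simp
  have k: "0 < heat_ker (z - y) s" "0 < heat_ker (x - y) t" for x z
    using st t by (auto intro: heat_ker_pos)
  define f where "f = (\<lambda>(x, z). ennreal (W x t * sqrt (heat_ker (x - y) t) * (W z s * w z s) / sqrt (heat_ker (z - y) s)))"
  define g where "g = (\<lambda>(x, z). ennreal (sqrt (heat_ker (z - y) s) * \<bar>heat_ker (x - z) (t - s) - heat_ker (x - y) t\<bar> / sqrt (heat_ker (x - y) t)))"
  have [measurable]: "f \<in> borel_measurable (lborel \<Otimes>\<^sub>M lborel)" "g \<in> borel_measurable (lborel \<Otimes>\<^sub>M lborel)"
    unfolding f_def g_def by measurable
  have fg: "f (x, z) * g (x, z) = ennreal (W x t) * ennreal (\<bar>heat_ker (x - z) (t - s) - heat_ker (x - y) t\<bar>) * ennreal (W z s * w z s)" for x z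
  proof -
    have "f (x, z) * g (x, z) = ennreal ((W x t * sqrt (heat_ker (x - y) t) * (W z s * w z s) / sqrt (heat_ker (z - y) s))
        * (sqrt (heat_ker (z - y) s) * \<bar>heat_ker (x - z) (t - s) - heat_ker (x - y) t\<bar> / sqrt (heat_ker (x - y) t)))"
      unfolding f_def g_def using W[OF t, of x] W[OF st(1), of z] w[of z s] by (simp flip: ennreal_mult)
    also have "(W x t * sqrt (heat_ker (x - y) t) * (W z s * w z s) / sqrt (heat_ker (z - y) s))
        * (sqrt (heat_ker (z - y) s) * \<bar>heat_ker (x - z) (t - s) - heat_ker (x - y) t\<bar> / sqrt (heat_ker (x - y) t))
       = W x t * \<bar>heat_ker (x - z) (t - s) - heat_ker (x - y) t\<bar> * (W z s * w z s)"
      using k(1)[of z] k(2)[of x] by (simp add: field_simps)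
    finally show ?thesis using W[OF t, of x] W[OF st(1), of z] w[of z s] by (simp add: ennreal_mult)
  qed
  have f2: "(f (x, z))\<^sup>2 \<le> ennreal (C\<^sup>2 / (t * s)) * (ennreal (W x t * heat_ker (x - y) t) * ennreal (W z s * w z s))" for x z
  proof -
    define a where "a = W x t" define b where "b = W z s"
    define u where "u = w z s" define kz where "kz = heat_ker (z - y) s" define kx where "kx = heat_ker (x - y) t"
    have a: "0 \<le> a" "a \<le> C / t" and b: "0 \<le> b" "b \<le> C / s" and u: "0 \<le> u" "u \<le> kz" and kp: "0 < kz" "0 < kx"
      using W[OF t, of x] W[OF st(1), of z] w[of z s] k by (auto simp: a_def b_def u_def kz_def kx_def)
    have "(a * sqrt kx * (b * u) / sqrt kz)\<^sup>2 = a * (a * kx) * b * (b * u) * (u / kz)"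
      using kp by (simp add: power_mult_distrib power_divide) (simp add: power2_eq_square)
    also have "\<dots> \<le> (C / t) * (a * kx) * (C / s) * (b * u) * 1"
      using a b u kp t st C by (intro mult_mono) (auto intro!: mult_nonneg_nonneg)
    also have "\<dots> = C\<^sup>2 / (t * s) * (a * kx * (b * u))" by (simp add: power2_eq_square)
    finally have "(a * sqrt kx * (b * u) / sqrt kz)\<^sup>2 \<le> C\<^sup>2 / (t * s) * (a * kx * (b * u))" .
    moreover have "f (x, z) = ennreal (a * sqrt kx * (b * u) / sqrt kz)"
      by (simp add: f_def a_def b_def u_def kz_def kx_def)
    ultimately show ?thesis
      unfolding a_def[symmetric] b_def[symmetric] u_def[symmetric] kz_def[symmetric] kx_def[symmetric]
      using a b u kp t st C by (simp add: ennreal_power ennreal_leI flip: ennreal_mult)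
  qed
  have g2: "(g (x, z))\<^sup>2 = ennreal (heat_ker (z - y) s * (heat_ker (x - z) (t - s) - heat_ker (x - y) t)\<^sup>2 / heat_ker (x - y) t)" for x z
    unfolding g_def using k(1)[of z] k(2)[of x]
    by (simp add: ennreal_power power_mult_distrib power_divide)
  have lp: "(\<integral>\<^sup>+p. h p \<partial>(lborel \<Otimes>\<^sub>M lborel)) = (\<integral>\<^sup>+x. \<integral>\<^sup>+z. h (x, z) \<partial>lborel \<partial>lborel)"
    if "h \<in> borel_measurable (lborel \<Otimes>\<^sub>M lborel)" for h :: "'a \<times> 'a \<Rightarrow> ennreal"
    by (rule lborel.nn_integral_fst[OF that, symmetric])
  have "?H\<^sup>2 = (\<integral>\<^sup>+p. f p * g p \<partial>(lborel \<Otimes>\<^sub>M lborel))\<^sup>2"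
    by (subst lp) (simp_all add: fg)
  also have "\<dots> \<le> (\<integral>\<^sup>+p. (f p)\<^sup>2 \<partial>(lborel \<Otimes>\<^sub>M lborel)) * (\<integral>\<^sup>+p. (g p)\<^sup>2 \<partial>(lborel \<Otimes>\<^sub>M lborel))"
    by (rule Cauchy_Schwarz_nn_integral) measurable
  also have "(\<integral>\<^sup>+p. (f p)\<^sup>2 \<partial>(lborel \<Otimes>\<^sub>M lborel)) \<le> ennreal (C\<^sup>2 / (t * s)) * (?F * ?G)"
  proof -
    have "(\<integral>\<^sup>+p. (f p)\<^sup>2 \<partial>(lborel \<Otimes>\<^sub>M lborel)) = (\<integral>\<^sup>+x. \<integral>\<^sup>+z. (f (x, z))\<^sup>2 \<partial>lborel \<partial>lborel)"
      by (rule lp) measurable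
    also have "\<dots> \<le> (\<integral>\<^sup>+x. \<integral>\<^sup>+z. ennreal (C\<^sup>2 / (t * s)) * (ennreal (W x t * heat_ker (x - y) t) * ennreal (W z s * w z s)) \<partial>lborel \<partial>lborel)"
      by (intro nn_integral_mono f2)
    also have "\<dots> = ennreal (C\<^sup>2 / (t * s)) * (?F * ?G)"
      by (simp add: nn_integral_cmult nn_integral_multc)
    finally show ?thesis .
  qed
  also have "(\<integral>\<^sup>+p. (g p)\<^sup>2 \<partial>(lborel \<Otimes>\<^sub>M lborel)) \<le> ennreal (2 ^ (DIM('a) + 1) * s / t)"
  proof -
    have "(\<integral>\<^sup>+p. (g p)\<^sup>2 \<partial>(lborel \<Otimes>\<^sub>M lborel)) = (\<integral>\<^sup>+x. \<integral>\<^sup>+z. (g (x, z))\<^sup>2 \<partial>lborel \<partial>lborel)"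
      by (rule lp) measurable
    also have "\<dots> \<le> ennreal (2 ^ (DIM('a) + 1) * s / t)"
      unfolding g2 by (rule heat_ker_decorrelation[OF st])
    finally show ?thesis .
  qed
  finally have "?H\<^sup>2 \<le> ennreal (C\<^sup>2 / (t * s)) * (?F * ?G) * ennreal (2 ^ (DIM('a) + 1) * s / t)"
    by (simp add: mult_left_mono mult_right_mono)
  also have "\<dots> = (ennreal (C\<^sup>2 / (t * s)) * ennreal (2 ^ (DIM('a) + 1) * s / t)) * (?F * ?G)"
    by (simp add: mult_ac)
  also have "ennreal (C\<^sup>2 / (t * s)) * ennreal (2 ^ (DIM('a) + 1) * s / t)
     = ennreal (L * \<epsilon> / (sqrt s * sqrt t)) * ennreal (L * sqrt s / (\<epsilon> * (t * sqrt t)))"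
  proof -
    have "C\<^sup>2 / (t * s) * (2 ^ (DIM('a) + 1) * s / t) = L * L / (t * t)"
      using st t unfolding L by (simp add: power2_eq_square)
    also have "\<dots> = L * \<epsilon> / (sqrt s * sqrt t) * (L * sqrt s / (\<epsilon> * (t * sqrt t)))"
      using st t \<open>0 < \<epsilon>\<close> by simp
    finally show ?thesis using st t \<open>0 < \<epsilon>\<close> C L by (simp flip: ennreal_mult)
  qed
  finally show ?thesis
    by (intro ennreal_le_add_of_square_le) (simp add: mult_ac)
qed

text \<open>
  For comparable times there is no decorrelation to exploit, but the bound \<open>C/t\<close> makes the contribution
  of a dyadic time interval bounded.
\<close>

lemma short_lag_bound:
  fixes W :: "'a::euclidean_space \<Rightarrow> real \<Rightarrow> real"
  assumes W_meas: "(\<lambda>(x, t). W x t) \<in> borel_measurable borel"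
    and C: "0 \<le> C"
    and W: "\<And>x t. 0 < t \<Longrightarrow> 0 \<le> W x t \<and> W x t \<le> C / t"
    and s: "0 < s"
  shows "(\<integral>\<^sup>+t. \<integral>\<^sup>+x. ennreal (W x t) * ennreal (heat_ker (x - z) (t - s)) * indicator {s<..<2 * s} t \<partial>lborel \<partial>lborel) \<le> ennreal C"
proof -
  note [measurable (raw)] = measurable_curried[OF W_meas]
  have "(\<integral>\<^sup>+x. ennreal (W x t) * ennreal (heat_ker (x - z) (t - s)) * indicator {s<..<2 * s} t \<partial>lborel)
      \<le> ennreal (C / s) * indicator {s<..<2 * s} t" for t
  proof (cases "t \<in> {s<..<2 * s}")
    case True
    then have t: "0 < t" "s < t" using s by auto
    have le: "W x t \<le> C / s" for x
    proof -
      have "W x t \<le> C / t" using W t by auto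
      also have "\<dots> \<le> C / s" using C s t by (intro divide_left_mono) auto
      finally show ?thesis .
    qed
    have "(\<integral>\<^sup>+x. ennreal (W x t) * ennreal (heat_ker (x - z) (t - s)) * indicator {s<..<2 * s} t \<partial>lborel)
       \<le> (\<integral>\<^sup>+x. ennreal (C / s) * ennreal (heat_ker (x - z) (t - s)) \<partial>lborel)"
      using True le by (intro nn_integral_mono) (auto intro!: mult_right_mono ennreal_leI)
    also have "\<dots> = ennreal (C / s)"
      using t by (simp add: nn_integral_cmult nn_integral_heat_ker_shift)
    finally show ?thesis using True by simp
  qed simp
  then have "(\<integral>\<^sup>+t. \<integral>\<^sup>+x. ennreal (W x t) * ennreal (heat_ker (x - z) (t - s)) * indicator {s<..<2 * s} t \<partial>lborel \<partial>lborel)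
     \<le> (\<integral>\<^sup>+t. ennreal (C / s) * indicator {s<..<2 * s} t \<partial>lborel)"
    by (intro nn_integral_mono)
  also have "\<dots> = ennreal C"
    using s C by (simp add: nn_integral_cmult_indicator flip: ennreal_mult)
  finally show ?thesis .
qed

text \<open>
  Intervals whose end points are integration variables.
\<close>

lemma measurable_mem_interval [measurable (raw)]:
  fixes f g h :: "'b \<Rightarrow> real"
  assumes [measurable]: "f \<in> borel_measurable M" "g \<in> borel_measurable M" "h \<in> borel_measurable M"
  shows "Measurable.pred M (\<lambda>x. f x \<in> {..<g x})"
    and "Measurable.pred M (\<lambda>x. f x \<in> {g x..})"
    and "Measurable.pred M (\<lambda>x. f x \<in> {h x<..<g x})"
    and "Measurable.pred M (\<lambda>x. f x \<in> {h x<..g x})"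
  by simp_all

text \<open>
  The core estimate. The mass that survives until \<open>T\<close> is \<open>m = 1 - a\<close>, where \<open>a\<close> is the mass absorbed by
  then. Replacing in Duhamel's formula the kernel \<open>K(x - z, t - s)\<close> by \<open>K(x - y, t)\<close> would give \<open>w \<ge> m K\<close>, and
  integrating this against \<open>W\<close> would give \<open>m I \<le> a \<le> 1\<close>. The error of the replacement is controlled by
  \<open>short_lag_bound\<close> for \<open>t < 2 s\<close> and by \<open>correlation_bound\<close> for \<open>2 s \<le> t\<close>.
\<close>

lemma mass_times_potential_bound:
  fixes W w :: "'a::euclidean_space \<Rightarrow> real \<Rightarrow> real" and y :: 'a
  assumes W_meas: "(\<lambda>(x, t). W x t) \<in> borel_measurable borel"
    and w_meas: "(\<lambda>(x, t). w x t) \<in> borel_measurable borel"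
    and C: "0 \<le> C" and "0 < T" and "0 < \<epsilon>"
    and W: "\<And>x t. 0 < t \<Longrightarrow> 0 \<le> W x t \<and> W x t \<le> C / t"
    and W_late: "\<And>x t. T \<le> t \<Longrightarrow> W x t = 0"
    and W_neg: "\<And>x t. t \<le> 0 \<Longrightarrow> W x t = 0"
    and w: "\<And>x t. 0 \<le> w x t \<and> w x t \<le> heat_ker (x - y) t"
    and duh: "\<And>x t. 0 < t \<Longrightarrow> t \<le> T \<Longrightarrow> ennreal (w x t) + (\<integral>\<^sup>+s. \<integral>\<^sup>+z. ennreal (heat_ker (x - z) (t - s)) * ennreal (W z s * w z s)
        \<partial>lborel \<partial>lborel) = ennreal (heat_ker (x - y) t)"
    and L: "L = C * sqrt (2 ^ (DIM('a) + 1))"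
    and I: "I = (\<integral>\<^sup>+t. \<integral>\<^sup>+x. ennreal (W x t * heat_ker (x - y) t) \<partial>lborel \<partial>lborel)"
    and I_fin: "I < \<infinity>"
  shows "(\<integral>\<^sup>+x. ennreal (w x T) \<partial>lborel) * I \<le> ennreal (1 + C + 2 * L / \<epsilon>) + ennreal (2 * L * \<epsilon>) * I"
proof -
  note [measurable (raw)] = measurable_curried[OF W_meas] measurable_curried[OF w_meas]
  define m where "m = (\<integral>\<^sup>+x. ennreal (w x T) \<partial>lborel)"
  define q where "q = (\<lambda>z s. ennreal (W z s * w z s))"
  have q[measurable (raw)]: "(\<lambda>p. q (f p) (g p)) \<in> borel_measurable M"
    if [measurable]: "f \<in> borel_measurable M" "g \<in> borel_measurable M" for f g and M :: "'b measure"
    unfolding q_def by measurable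
  have q_neg: "q z s = 0" if "s \<le> 0" for z s using W_neg[OF that] by (simp add: q_def)
  define F where "F = (\<lambda>t. \<integral>\<^sup>+x. ennreal (W x t * heat_ker (x - y) t) \<partial>lborel)"
  define G where "G = (\<lambda>s. \<integral>\<^sup>+z. q z s \<partial>lborel)"
  define a where "a = (\<integral>\<^sup>+s. G s \<partial>lborel)"
  have [measurable]: "F \<in> borel_measurable borel" "G \<in> borel_measurable borel"
    unfolding F_def G_def by measurable
  have L0: "0 \<le> L" using C by (simp add: L)
  have W0: "0 \<le> W x t" for x t using W[of t x] W_neg[of t x] by (cases "0 < t") auto
  have I_F: "I = (\<integral>\<^sup>+t. F t \<partial>lborel)" by (simp add: I F_def)
  have mass: "m + a = 1"
  proof -
    have "a = (\<integral>\<^sup>+s. \<integral>\<^sup>+z. ennreal (W z s * w z s) * indicator {..<T} s \<partial>lborel \<partial>lborel)"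
      unfolding a_def G_def q_def
      by (intro nn_integral_cong) (auto simp: indicator_def W_late not_less)
    then show ?thesis
      using duhamel_mass[OF W_meas w_meas \<open>0 < T\<close> duh[OF \<open>0 < T\<close> order_refl]] by (simp add: m_def)
  qed
  then have a_le: "a \<le> 1" by (metis add.commute le_iff_add)
  let ?fX = "\<lambda>t x s z. ennreal (W x t) * ennreal (heat_ker (x - y) t) * q z s * indicator {..<t} s"
  let ?fY = "\<lambda>t x s z. ennreal (W x t) * ennreal (heat_ker (x - z) (t - s)) * q z s"
  let ?fN = "\<lambda>t x s z. ennreal (W x t) * ennreal (heat_ker (x - z) (t - s)) * indicator {s<..<2 * s} t * q z s"
  let ?fD = "\<lambda>t x s z. ennreal (W x t) * ennreal (\<bar>heat_ker (x - z) (t - s) - heat_ker (x - y) t\<bar>) * q z s * indicator {0<..t / 2} s"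
  let ?X = "\<integral>\<^sup>+t. \<integral>\<^sup>+x. \<integral>\<^sup>+s. \<integral>\<^sup>+z. ?fX t x s z \<partial>lborel \<partial>lborel \<partial>lborel \<partial>lborel"
  let ?Y = "\<integral>\<^sup>+t. \<integral>\<^sup>+x. \<integral>\<^sup>+s. \<integral>\<^sup>+z. ?fY t x s z \<partial>lborel \<partial>lborel \<partial>lborel \<partial>lborel"
  let ?N = "\<integral>\<^sup>+t. \<integral>\<^sup>+x. \<integral>\<^sup>+s. \<integral>\<^sup>+z. ?fN t x s z \<partial>lborel \<partial>lborel \<partial>lborel \<partial>lborel"
  let ?D = "\<integral>\<^sup>+t. \<integral>\<^sup>+x. \<integral>\<^sup>+s. \<integral>\<^sup>+z. ?fD t x s z \<partial>lborel \<partial>lborel \<partial>lborel \<partial>lborel"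
  \<comment> \<open>The mass absorbed before \<open>t\<close> and \<open>m\<close> add up to at most 1; this sum times \<open>heat_ker (x - y) t\<close> is compared with Duhamel's formula for \<open>heat_ker (x - y) t\<close>.\<close>
  have 1: "m * I + ?X \<le> a + ?Y"
  proof -
    have pt: "m * ennreal (W x t * heat_ker (x - y) t)
         + (\<integral>\<^sup>+s. \<integral>\<^sup>+z. ?fX t x s z \<partial>lborel \<partial>lborel)
       \<le> q x t + (\<integral>\<^sup>+s. \<integral>\<^sup>+z. ?fY t x s z \<partial>lborel \<partial>lborel)" for x t
    proof (cases "0 < t \<and> t < T")
      case True
      have "(\<integral>\<^sup>+s. \<integral>\<^sup>+z. q z s * indicator {..<t} s \<partial>lborel \<partial>lborel) \<le> a"
        unfolding a_def G_def by (intro nn_integral_mono) (simp add: indicator_def)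
      then have le1: "m + (\<integral>\<^sup>+s. \<integral>\<^sup>+z. q z s * indicator {..<t} s \<partial>lborel \<partial>lborel) \<le> 1"
        unfolding mass[symmetric] by (rule add_left_mono)
      have "m * ennreal (W x t * heat_ker (x - y) t)
         + (\<integral>\<^sup>+s. \<integral>\<^sup>+z. ?fX t x s z \<partial>lborel \<partial>lborel)
        = ennreal (W x t) * ennreal (heat_ker (x - y) t) * (m + (\<integral>\<^sup>+s. \<integral>\<^sup>+z. q z s * indicator {..<t} s \<partial>lborel \<partial>lborel))"
        using W0[of x t] by (simp add: nn_integral_cmult mult.assoc distrib_left ennreal_mult) (simp add: mult_ac)
      also have "\<dots> \<le> ennreal (W x t) * ennreal (heat_ker (x - y) t) * 1"
        by (intro mult_left_mono le1) simp
      also have "\<dots> = ennreal (W x t) * (ennreal (w x t) + (\<integral>\<^sup>+s. \<integral>\<^sup>+z. ennreal (heat_ker (x - z) (t - s)) * q z s \<partial>lborel \<partial>lborel))"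
        unfolding q_def using duh[of t x] True by simp
      also have "\<dots> = q x t + (\<integral>\<^sup>+s. \<integral>\<^sup>+z. ?fY t x s z \<partial>lborel \<partial>lborel)"
        using W0[of x t] w[of x t] by (simp add: nn_integral_cmult mult.assoc distrib_left) (simp add: q_def ennreal_mult)
      finally show ?thesis .
    next
      case False
      then have "W x t = 0" using W_late W_neg by auto
      then show ?thesis by simp
    qed
    let ?x = "\<lambda>x t. \<integral>\<^sup>+s. \<integral>\<^sup>+z. ?fX t x s z \<partial>lborel \<partial>lborel"
    have "m * I + ?X = (\<integral>\<^sup>+t. m * F t \<partial>lborel) + ?X"
      unfolding I_F by (simp add: nn_integral_cmult)
    also have "\<dots> = (\<integral>\<^sup>+t. (m * F t + (\<integral>\<^sup>+x. ?x x t \<partial>lborel)) \<partial>lborel)"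
      by (rule nn_integral_add[symmetric]) measurable
    also have "\<dots> = (\<integral>\<^sup>+t. \<integral>\<^sup>+x. (m * ennreal (W x t * heat_ker (x - y) t) + ?x x t) \<partial>lborel \<partial>lborel)"
      unfolding F_def by (simp add: nn_integral_add nn_integral_cmult)
    also have "\<dots> \<le> (\<integral>\<^sup>+t. \<integral>\<^sup>+x. (q x t + (\<integral>\<^sup>+s. \<integral>\<^sup>+z. ?fY t x s z \<partial>lborel \<partial>lborel)) \<partial>lborel \<partial>lborel)"
      by (intro nn_integral_mono pt)
    also have "\<dots> = a + ?Y"
      unfolding a_def G_def by (simp add: nn_integral_add)
    finally show ?thesis .
  qed
  \<comment> \<open>The potential is split by the size of the lag \<open>t - s\<close> relative to \<open>s\<close>.\<close>
  have 2: "?Y \<le> ?X + (?N + ?D)"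
  proof -
    have pt: "?fY t x s z
       \<le> ?fX t x s z
         + (?fN t x s z
           + ?fD t x s z)" for x t z s
    proof (cases "0 < s \<and> s < t")
      case st: True
      show ?thesis
      proof (cases "t < 2 * s")
        case True
        with st show ?thesis by (simp add: add_increasing add_increasing2)
      next
        case False
        with st have i: "s \<in> {..<t}" "s \<in> {0<..t / 2}" by auto
        have "ennreal (heat_ker (x - z) (t - s)) \<le> ennreal (heat_ker (x - y) t) + ennreal (\<bar>heat_ker (x - z) (t - s) - heat_ker (x - y) t\<bar>)"
          by (simp flip: ennreal_plus add: ennreal_leI)
        then have "?fY t x s z
          \<le> ennreal (W x t) * (ennreal (heat_ker (x - y) t) + ennreal (\<bar>heat_ker (x - z) (t - s) - heat_ker (x - y) t\<bar>)) * q z s"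
          by (intro mult_right_mono mult_left_mono) auto
        then show ?thesis using i by (simp add: distrib_left distrib_right add_increasing2)
      qed
    next
      case False
      then have "q z s = 0 \<or> heat_ker (x - z) (t - s) = 0" using q_neg by (cases "0 < s") auto
      then show ?thesis by auto
    qed
    have "?Y \<le> (\<integral>\<^sup>+t. \<integral>\<^sup>+x. \<integral>\<^sup>+s. \<integral>\<^sup>+z. (?fX t x s z
         + (?fN t x s z
           + ?fD t x s z)) \<partial>lborel \<partial>lborel \<partial>lborel \<partial>lborel)"
      by (intro nn_integral_mono pt)
    also have "\<dots> = ?X + (?N + ?D)" by (simp add: nn_integral_add)
    finally show ?thesis .
  qed
  \<comment> \<open>Finiteness allows \<open>?X\<close> to be cancelled.\<close>
  have X_fin: "?X < \<infinity>"
  proof -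
    have "?X \<le> (\<integral>\<^sup>+t. \<integral>\<^sup>+x. \<integral>\<^sup>+s. \<integral>\<^sup>+z. ennreal (W x t * heat_ker (x - y) t) * q z s \<partial>lborel \<partial>lborel \<partial>lborel \<partial>lborel)"
      using W0 by (intro nn_integral_mono) (auto simp: indicator_def ennreal_mult)
    also have "\<dots> = I * a"
      unfolding I a_def G_def by (simp add: nn_integral_cmult nn_integral_multc)
    also have "\<dots> < \<infinity>" using I_fin a_le
      by (metis ennreal_mult_less_top ennreal_one_less_top infinity_ennreal_def order_le_less_trans)
    finally show ?thesis .
  qed
  have "?X + m * I \<le> ?X + (a + (?N + ?D))"
  proof -
    have "?X + m * I \<le> a + ?Y" using 1 by (simp add: add.commute)
    also have "\<dots> \<le> a + (?X + (?N + ?D))" by (intro add_left_mono 2)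
    finally show ?thesis by (simp add: add.left_commute)
  qed
  then have 3: "m * I \<le> a + (?N + ?D)" using X_fin
    by (auto simp: ennreal_add_left_cancel_le)
  have N: "?N \<le> ennreal C"
  proof -
    have "?N = (\<integral>\<^sup>+s. \<integral>\<^sup>+z. \<integral>\<^sup>+t. \<integral>\<^sup>+x. ?fN t x s z \<partial>lborel \<partial>lborel \<partial>lborel \<partial>lborel)"
      by (rule nn_integral_reorder(2)) measurable
    also have "\<dots> \<le> (\<integral>\<^sup>+s. \<integral>\<^sup>+z. ennreal C * q z s \<partial>lborel \<partial>lborel)"
    proof (intro nn_integral_mono)
      fix s z
      show "(\<integral>\<^sup>+t. \<integral>\<^sup>+x. ?fN t x s z \<partial>lborel \<partial>lborel)
         \<le> ennreal C * q z s"
      proof (cases "0 < s")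
        case True
        from mult_right_mono[OF short_lag_bound[OF W_meas C W True, of z], of "q z s"]
        show ?thesis by (simp add: nn_integral_multc)
      qed (simp add: q_neg)
    qed
    also have "\<dots> = ennreal C * a" by (simp add: nn_integral_cmult a_def G_def)
    also have "\<dots> \<le> ennreal C * 1" by (intro mult_left_mono a_le) simp
    finally show ?thesis by simp
  qed
  have D: "?D \<le> ennreal (2 * L * \<epsilon>) * I + ennreal (2 * L / \<epsilon>)"
  proof -
    let ?\<alpha> = "\<lambda>s t. ennreal (1 / (sqrt s * sqrt t)) * indicator {0<..<t} s"
    let ?\<beta> = "\<lambda>s t. ennreal (sqrt s / (t * sqrt t)) * indicator {s..} t"
    have "?D = (\<integral>\<^sup>+s. \<integral>\<^sup>+t. \<integral>\<^sup>+x. \<integral>\<^sup>+z. ?fD t x s z \<partial>lborel \<partial>lborel \<partial>lborel \<partial>lborel)"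
      by (rule nn_integral_reorder(1)) measurable
    also have "\<dots> \<le> (\<integral>\<^sup>+s. \<integral>\<^sup>+t. ennreal (L * \<epsilon>) * (?\<alpha> s t * F t) + ennreal (L / \<epsilon>) * (G s * ?\<beta> s t) \<partial>lborel \<partial>lborel)"
    proof (intro nn_integral_mono)
      fix s t
      show "(\<integral>\<^sup>+x. \<integral>\<^sup>+z. ?fD t x s z \<partial>lborel \<partial>lborel)
        \<le> ennreal (L * \<epsilon>) * (?\<alpha> s t * F t) + ennreal (L / \<epsilon>) * (G s * ?\<beta> s t)"
      proof (cases "s \<in> {0<..t / 2}")
        case True
        then have st: "0 < s" "2 * s \<le> t" "s < t" "0 < t" by auto
        have e1: "ennreal (L * \<epsilon> / (sqrt s * sqrt t)) = ennreal (L * \<epsilon>) * ?\<alpha> s t"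
          using st L0 \<open>0 < \<epsilon>\<close> by (simp flip: ennreal_mult)
        have e2: "ennreal (L * sqrt s / (\<epsilon> * (t * sqrt t))) = ennreal (L / \<epsilon>) * ?\<beta> s t"
          using st L0 \<open>0 < \<epsilon>\<close> by (simp flip: ennreal_mult)
        from correlation_bound[OF W_meas w_meas C W w \<open>0 < \<epsilon>\<close> st(1,2) L]
        have "(\<integral>\<^sup>+x. \<integral>\<^sup>+z. ennreal (W x t) * ennreal (\<bar>heat_ker (x - z) (t - s) - heat_ker (x - y) t\<bar>) * q z s \<partial>lborel \<partial>lborel)
          \<le> ennreal (L * \<epsilon> / (sqrt s * sqrt t)) * F t + ennreal (L * sqrt s / (\<epsilon> * (t * sqrt t))) * G s"
          by (simp add: F_def G_def q_def)
        then show ?thesis unfolding e1 e2 using True by (simp add: mult_ac)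
      qed simp
    qed
    also have "\<dots> = (\<integral>\<^sup>+s. \<integral>\<^sup>+t. ennreal (L * \<epsilon>) * (?\<alpha> s t * F t) \<partial>lborel \<partial>lborel)
        + (\<integral>\<^sup>+s. \<integral>\<^sup>+t. ennreal (L / \<epsilon>) * (G s * ?\<beta> s t) \<partial>lborel \<partial>lborel)"
      by (simp add: nn_integral_add)
    also have "(\<integral>\<^sup>+s. \<integral>\<^sup>+t. ennreal (L * \<epsilon>) * (?\<alpha> s t * F t) \<partial>lborel \<partial>lborel)
        = (\<integral>\<^sup>+t. \<integral>\<^sup>+s. ennreal (L * \<epsilon>) * (?\<alpha> s t * F t) \<partial>lborel \<partial>lborel)"
      by (rule lborel_pair.Fubini'[symmetric]) measurable
    also have "\<dots> = (\<integral>\<^sup>+t. ennreal (L * \<epsilon>) * ((\<integral>\<^sup>+s. ?\<alpha> s t \<partial>lborel) * F t) \<partial>lborel)"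
      by (simp add: nn_integral_cmult nn_integral_multc)
    also have "\<dots> \<le> (\<integral>\<^sup>+t. ennreal (L * \<epsilon>) * (2 * F t) \<partial>lborel)"
    proof (rule nn_integral_mono, rule mult_left_mono)
      fix t
      have "(\<integral>\<^sup>+s. ?\<alpha> s t \<partial>lborel) \<le> 2"
      proof (cases "0 < t")
        case False
        then have "{0<..<t} = {}" by auto
        then show ?thesis by simp
      qed (rule nn_integral_inverse_sqrt)
      then show "(\<integral>\<^sup>+s. ?\<alpha> s t \<partial>lborel) * F t \<le> 2 * F t"
        by (rule mult_right_mono) simp
    qed simp_all
    also have "\<dots> = ennreal (2 * L * \<epsilon>) * I"
    proof -
      have "ennreal (2 * L * \<epsilon>) = ennreal (L * \<epsilon>) * 2"
        using L0 \<open>0 < \<epsilon>\<close> by (simp add: ennreal_mult mult_ac)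
      then show ?thesis unfolding I_F by (simp add: nn_integral_cmult mult.assoc)
    qed
    also have "(\<integral>\<^sup>+s. \<integral>\<^sup>+t. ennreal (L / \<epsilon>) * (G s * ?\<beta> s t) \<partial>lborel \<partial>lborel)
       = (\<integral>\<^sup>+s. ennreal (L / \<epsilon>) * (G s * (\<integral>\<^sup>+t. ?\<beta> s t \<partial>lborel)) \<partial>lborel)"
      by (simp add: nn_integral_cmult)
    also have "\<dots> \<le> (\<integral>\<^sup>+s. ennreal (L / \<epsilon>) * (G s * 2) \<partial>lborel)"
    proof (rule nn_integral_mono, rule mult_left_mono)
      fix s
      show "G s * (\<integral>\<^sup>+t. ?\<beta> s t \<partial>lborel) \<le> G s * 2"
      proof (cases "0 < s")
        case True
        then show ?thesis by (intro mult_left_mono nn_integral_tail_inverse_sqrt) simp_all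
      next
        case False
        then have "G s = 0" by (simp add: G_def q_neg)
        then show ?thesis by simp
      qed
    qed simp_all
    also have "\<dots> = ennreal (L / \<epsilon>) * (a * 2)"
      by (simp add: nn_integral_cmult nn_integral_multc a_def)
    also have "\<dots> \<le> ennreal (L / \<epsilon>) * (1 * 2)"
      by (intro mult_left_mono mult_right_mono a_le) simp_all
    also have "\<dots> = ennreal (2 * L / \<epsilon>)"
    proof -
      have "ennreal (L / \<epsilon> * 2) = ennreal (L / \<epsilon>) * ennreal 2"
        using L0 \<open>0 < \<epsilon>\<close> by (intro ennreal_mult) auto
      then show ?thesis by (simp add: mult.commute)
    qed
    finally show ?thesis by (simp add: add_mono)
  qed
  have "m * I \<le> 1 + (ennreal C + (ennreal (2 * L * \<epsilon>) * I + ennreal (2 * L / \<epsilon>)))"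
    by (rule order_trans[OF 3]) (intro add_mono a_le N D)
  also have "\<dots> = ennreal (1 + C + 2 * L / \<epsilon>) + ennreal (2 * L * \<epsilon>) * I"
    using C L0 \<open>0 < \<epsilon>\<close> by (simp add: ennreal_plus add_ac)
  finally show ?thesis unfolding m_def .
qed

section \<open>Heat potentials\<close>

lemma tendsto_heat_ker:
  fixes f :: "'b \<Rightarrow> 'a::euclidean_space"
  assumes f: "(f \<longlongrightarrow> x) F" and g: "(g \<longlongrightarrow> t) F" and t: "0 < t"
  shows "((\<lambda>p. heat_ker (f p) (g p)) \<longlongrightarrow> heat_ker x t) F"
proof -
  have "((\<lambda>p. (1 / (4 * pi * g p)) powr (real DIM('a) / 2) * exp (- (norm (f p))\<^sup>2 / (4 * g p)))
      \<longlongrightarrow> (1 / (4 * pi * t)) powr (real DIM('a) / 2) * exp (- (norm x)\<^sup>2 / (4 * t))) F"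
    using t by (intro tendsto_intros f g) auto
  moreover have "eventually (\<lambda>p. 0 < g p) F"
    using order_tendstoD(1)[OF g t] .
  ultimately show ?thesis
    using t by (auto simp: heat_ker_def gauss_kernel_def elim!: Lim_transform_eventually elim: eventually_mono)
qed

text \<open>
  The heat kernel of the constant potential \<open>M\<close>.
\<close>

definition damped_ker :: "real \<Rightarrow> 'a::euclidean_space \<Rightarrow> real \<Rightarrow> real" where
  "damped_ker M x t = exp (- M * t) * heat_ker x t"

lemma damped_ker_zero [simp]: "damped_ker 0 = heat_ker"
  by (auto simp: damped_ker_def fun_eq_iff)

lemma damped_ker_nonneg [simp]: "0 \<le> damped_ker M x t"
  by (simp add: damped_ker_def)

lemma damped_ker_measurable [measurable (raw)]:
  fixes f :: "'b \<Rightarrow> 'a::euclidean_space"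
  assumes [measurable]: "f \<in> borel_measurable M" "g \<in> borel_measurable M"
  shows "(\<lambda>p. damped_ker m (f p) (g p)) \<in> borel_measurable M"
  unfolding damped_ker_def by measurable

lemma damped_ker_le: "0 \<le> M \<Longrightarrow> damped_ker M x t \<le> heat_ker x t"
  by (cases "0 < t") (auto simp: damped_ker_def intro!: mult_left_le_one_le)

lemma tendsto_damped_ker:
  fixes f :: "'b \<Rightarrow> 'a::euclidean_space"
  assumes f: "(f \<longlongrightarrow> x) F" and g: "(g \<longlongrightarrow> t) F" and t: "0 < t"
  shows "((\<lambda>p. damped_ker M (f p) (g p)) \<longlongrightarrow> damped_ker M x t) F"
  unfolding damped_ker_def by (intro tendsto_intros tendsto_heat_ker f g t)

text \<open>
  The Duhamel integral of the source \<open>q\<close> for the constant potential \<open>M\<close>. It is extended real valued, so that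
  Tonelli's theorem applies without integrability conditions.
\<close>

definition heat_potential :: "real \<Rightarrow> ('a::euclidean_space \<Rightarrow> real \<Rightarrow> ennreal) \<Rightarrow> 'a \<Rightarrow> real \<Rightarrow> ennreal" where
  "heat_potential M q x t = (\<integral>\<^sup>+s. \<integral>\<^sup>+z. ennreal (damped_ker M (x - z) (t - s)) * q z s \<partial>lborel \<partial>lborel)"

lemma heat_ker_le_of_time_ge:
  assumes "0 < a" "a \<le> t"
  shows "heat_ker (x::'a::euclidean_space) t \<le> (4 * pi * a) powr (- (real DIM('a) / 2))"
proof -
  have "heat_ker x t \<le> (4 * pi * t) powr (- (real DIM('a) / 2))"
    using assms by (intro heat_ker_le) simp
  also have "\<dots> \<le> (4 * pi * a) powr (- (real DIM('a) / 2))"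
    using assms by (intro powr_mono2') auto
  finally show ?thesis .
qed

text \<open>
  By the semigroup law, Duhamel's formula at time \<open>r\<close> transported to time \<open>t\<close> is the formula at time \<open>t\<close> without
  the absorption between the times \<open>r\<close> and \<open>t\<close>; absorption only lowers \<open>w\<close>.
\<close>

lemma duhamel_pointwise_le:
  fixes q :: "'a::euclidean_space \<Rightarrow> real \<Rightarrow> ennreal" and w :: "'a \<Rightarrow> real \<Rightarrow> real"
  assumes qm: "(\<lambda>(z, s). q z s) \<in> borel_measurable borel"
    and wm: "(\<lambda>(x, t). w x t) \<in> borel_measurable borel"
    and r: "0 < r" "r < t"
    and duh_t: "ennreal (w x t) + heat_potential 0 q x t = ennreal (heat_ker (x - y) t)"
    and duh_r: "\<And>z. ennreal (w z r) + heat_potential 0 q z r = ennreal (heat_ker (z - y) r)"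
  shows "ennreal (w x t) \<le> (\<integral>\<^sup>+z. ennreal (heat_ker (x - z) (t - r)) * ennreal (w z r) \<partial>lborel)"
    (is "_ \<le> ?J")
proof -
  note [measurable (raw)] = measurable_curried[OF qm] measurable_curried[OF wm]
  have [measurable]: "(\<lambda>z. heat_potential 0 q z r) \<in> borel_measurable borel"
    unfolding heat_potential_def by measurable
  have "(\<integral>\<^sup>+v. ennreal (heat_ker (x - v) (t - r)) * heat_potential 0 q v r \<partial>lborel)
     = (\<integral>\<^sup>+v. \<integral>\<^sup>+s. \<integral>\<^sup>+z. ennreal (heat_ker (x - v) (t - r)) * ennreal (heat_ker (v - z) (r - s)) * q z s \<partial>lborel \<partial>lborel \<partial>lborel)"
    by (simp add: heat_potential_def nn_integral_cmult mult.assoc)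
  also have "\<dots> = (\<integral>\<^sup>+s. \<integral>\<^sup>+v. \<integral>\<^sup>+z. ennreal (heat_ker (x - v) (t - r)) * ennreal (heat_ker (v - z) (r - s)) * q z s \<partial>lborel \<partial>lborel \<partial>lborel)"
    by (rule lborel_pair.Fubini'[symmetric]) measurable
  also have "\<dots> = (\<integral>\<^sup>+s. \<integral>\<^sup>+z. \<integral>\<^sup>+v. ennreal (heat_ker (x - v) (t - r)) * ennreal (heat_ker (v - z) (r - s)) * q z s \<partial>lborel \<partial>lborel \<partial>lborel)"
    by (intro nn_integral_cong lborel_pair.Fubini'[symmetric]) measurable
  also have "\<dots> \<le> heat_potential 0 q x t"
    unfolding heat_potential_def damped_ker_zero
  proof (intro nn_integral_mono)
    fix s z
    show "(\<integral>\<^sup>+v. ennreal (heat_ker (x - v) (t - r)) * ennreal (heat_ker (v - z) (r - s)) * q z s \<partial>lborel)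
      \<le> ennreal (heat_ker (x - z) (t - s)) * q z s"
    proof (cases "s < r")
      case True
      then show ?thesis using r by (simp add: nn_integral_multc heat_ker_semigroup)
    qed simp
  qed
  finally have le: "(\<integral>\<^sup>+v. ennreal (heat_ker (x - v) (t - r)) * heat_potential 0 q v r \<partial>lborel) \<le> heat_potential 0 q x t" .
  have "heat_potential 0 q x t + ennreal (w x t) = (\<integral>\<^sup>+z. ennreal (heat_ker (x - z) (t - r)) * ennreal (heat_ker (z - y) r) \<partial>lborel)"
    using r duh_t by (simp add: heat_ker_semigroup add.commute)
  also have "\<dots> = ?J + (\<integral>\<^sup>+v. ennreal (heat_ker (x - v) (t - r)) * heat_potential 0 q v r \<partial>lborel)"
    unfolding duh_r[symmetric] by (simp add: distrib_left nn_integral_add)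
  also have "\<dots> \<le> heat_potential 0 q x t + ?J" using le by (simp add: add.commute add_left_mono)
  finally have "heat_potential 0 q x t + ennreal (w x t) \<le> heat_potential 0 q x t + ?J" .
  moreover have "heat_potential 0 q x t \<noteq> \<infinity>"
    using duh_t by (cases "heat_potential 0 q x t = \<infinity>") auto
  ultimately show ?thesis by (simp add: ennreal_add_left_cancel_le)
qed

text \<open>
  Joint continuity of heat potentials. Dominated convergence is applied first in \<open>z\<close> and then in \<open>s\<close>. The
  singular time \<open>s = t\<close> is a null set, and near it the Gaussian bound on \<open>q\<close> together with the semigroup law bounds
  the integrals over \<open>z\<close> uniformly.
\<close>

lemma heat_potential_tendsto:
  fixes q :: "'a::euclidean_space \<Rightarrow> real \<Rightarrow> ennreal"
  assumes qm: "(\<lambda>(z, s). q z s) \<in> borel_measurable borel"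
    and q: "\<And>z s. q z s \<le> ennreal (C * heat_ker (z - y) s)"
    and C: "0 \<le> C" and M: "0 \<le> M" and t: "0 < t"
    and X: "X \<longlonglongrightarrow> x" and R: "R \<longlonglongrightarrow> t"
  shows "(\<lambda>k. heat_potential M q (X k) (R k)) \<longlonglongrightarrow> heat_potential M q x t"
proof -
  note [measurable (raw)] = measurable_curried[OF qm]
  have q0: "q z s = 0" if "s \<le> 0" for z s using q[of z s] that by simp
  define u where "u = (\<lambda>k s. \<integral>\<^sup>+z. ennreal (damped_ker M (X k - z) (R k - s)) * q z s \<partial>lborel)"
  define v where "v = (\<lambda>s. \<integral>\<^sup>+z. ennreal (damped_ker M (x - z) (t - s)) * q z s \<partial>lborel)"
  have [measurable]: "u k \<in> borel_measurable lborel" "v \<in> borel_measurable lborel" for k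
    unfolding u_def v_def by measurable
  define B where "B = (4 * pi * (t / 2)) powr (- (real DIM('a) / 2))"
  have "eventually (\<lambda>k. R k \<in> {t / 2<..<2 * t}) sequentially"
    using t by (intro topological_tendstoD[OF R]) auto
  then obtain N where N: "\<And>k. N \<le> k \<Longrightarrow> R k \<in> {t / 2<..<2 * t}"
    by (auto simp: eventually_sequentially)
  have bound: "u k s \<le> ennreal (C * B) * indicator {0..2 * t} s" if "N \<le> k" for k s
  proof (cases "0 < s \<and> s < R k")
    case True
    have "u k s \<le> (\<integral>\<^sup>+z. ennreal C * (ennreal (heat_ker (X k - z) (R k - s)) * ennreal (heat_ker (z - y) s)) \<partial>lborel)"
      unfolding u_def
    proof (intro nn_integral_mono)
      fix z
      have "ennreal (damped_ker M (X k - z) (R k - s)) * q z s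
        \<le> ennreal (heat_ker (X k - z) (R k - s)) * ennreal (C * heat_ker (z - y) s)"
        by (intro mult_mono q ennreal_leI damped_ker_le M) auto
      then show "ennreal (damped_ker M (X k - z) (R k - s)) * q z s
        \<le> ennreal C * (ennreal (heat_ker (X k - z) (R k - s)) * ennreal (heat_ker (z - y) s))"
        using C by (simp add: ennreal_mult mult_ac)
    qed
    also have "\<dots> = ennreal C * ennreal (heat_ker (X k - y) (R k))"
      using True by (simp add: nn_integral_cmult heat_ker_semigroup)
    also have "\<dots> \<le> ennreal C * ennreal B"
      unfolding B_def using N[OF that] t by (intro mult_left_mono ennreal_leI heat_ker_le_of_time_ge) auto
    finally show ?thesis using True N[OF that] C by (auto simp: ennreal_mult B_def)
  next
    case False
    then have "u k s = 0" by (cases "0 < s") (auto simp: u_def q0 damped_ker_def)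
    then show ?thesis by simp
  qed
  have lim: "(\<lambda>k. u k s) \<longlonglongrightarrow> v s" if "s \<noteq> t" for s
  proof -
    consider "s \<le> 0" | "0 < s" "s < t" | "t < s" using \<open>s \<noteq> t\<close> by linarith
    then show ?thesis
    proof cases
      case 1
      then show ?thesis by (simp add: u_def v_def q0)
    next
      case 3
      have "eventually (\<lambda>k. R k < s) sequentially" using order_tendstoD(2)[OF R 3] .
      then have "eventually (\<lambda>k. u k s = v s) sequentially"
        by eventually_elim (use 3 in \<open>simp add: u_def v_def damped_ker_def\<close>)
      then show ?thesis by (rule tendsto_eventually)
    next
      case 2
      have R': "(\<lambda>k. R k - s) \<longlonglongrightarrow> t - s" by (intro tendsto_intros R)
      have "eventually (\<lambda>k. (t - s) / 2 < R k - s) sequentially"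
        by (rule order_tendstoD(1)[OF R']) (use 2 in simp)
      then obtain n where n: "\<And>k. n \<le> k \<Longrightarrow> (t - s) / 2 < R k - s" by (auto simp: eventually_sequentially)
      define A where "A = (4 * pi * ((t - s) / 2)) powr (- (real DIM('a) / 2))"
      have "(\<lambda>k. u (k + n) s) \<longlonglongrightarrow> v s"
        unfolding u_def v_def
      proof (rule nn_integral_dominated_convergence[where w = "\<lambda>z. ennreal (A * C) * ennreal (heat_ker (z - y) s)"])
        show "(\<integral>\<^sup>+ z. ennreal (A * C) * ennreal (heat_ker (z - y) s) \<partial>lborel) < \<infinity>"
          using 2 by (simp add: nn_integral_cmult nn_integral_heat_ker_shift)
        show "AE z in lborel. ennreal (damped_ker M (X (k + n) - z) (R (k + n) - s)) * q z s
            \<le> ennreal (A * C) * ennreal (heat_ker (z - y) s)" for k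
        proof (intro AE_I2)
          fix z
          have "damped_ker M (X (k + n) - z) (R (k + n) - s) \<le> A"
            unfolding A_def using 2 n[of "k + n"]
            by (intro order_trans[OF damped_ker_le[OF M] heat_ker_le_of_time_ge]) auto
          then have "ennreal (damped_ker M (X (k + n) - z) (R (k + n) - s)) * q z s
              \<le> ennreal A * ennreal (C * heat_ker (z - y) s)"
            by (intro mult_mono q ennreal_leI) auto
          then show "ennreal (damped_ker M (X (k + n) - z) (R (k + n) - s)) * q z s
            \<le> ennreal (A * C) * ennreal (heat_ker (z - y) s)"
            using C by (simp add: ennreal_mult A_def mult_ac)
        qed
        show "AE z in lborel. (\<lambda>k. ennreal (damped_ker M (X (k + n) - z) (R (k + n) - s)) * q z s)
            \<longlonglongrightarrow> ennreal (damped_ker M (x - z) (t - s)) * q z s"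
        proof (intro AE_I2)
          fix z
          have "q z s \<noteq> \<infinity>" using q[of z s] by (auto simp: top_unique)
          moreover have "(\<lambda>k. damped_ker M (X k - z) (R k - s)) \<longlonglongrightarrow> damped_ker M (x - z) (t - s)"
            by (intro tendsto_damped_ker tendsto_intros X R) (use 2 in simp)
          ultimately have "(\<lambda>k. ennreal (damped_ker M (X k - z) (R k - s)) * q z s)
            \<longlonglongrightarrow> ennreal (damped_ker M (x - z) (t - s)) * q z s"
            by (intro tendsto_mult_ennreal tendsto_ennrealI tendsto_const) auto
          then show "(\<lambda>k. ennreal (damped_ker M (X (k + n) - z) (R (k + n) - s)) * q z s)
            \<longlonglongrightarrow> ennreal (damped_ker M (x - z) (t - s)) * q z s"
            by (rule LIMSEQ_ignore_initial_segment)
        qed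
      qed measurable
      then show ?thesis by (rule LIMSEQ_offset)
    qed
  qed
  have "(\<lambda>k. \<integral>\<^sup>+s. u (k + N) s \<partial>lborel) \<longlonglongrightarrow> (\<integral>\<^sup>+s. v s \<partial>lborel)"
  proof (rule nn_integral_dominated_convergence[where w = "\<lambda>s. ennreal (C * B) * indicator {0..2 * t} s"])
    show "(\<integral>\<^sup>+ s. ennreal (C * B) * indicator {0..2 * t} s \<partial>lborel) < \<infinity>"
      using t by (simp add: nn_integral_cmult_indicator ennreal_mult_less_top)
    show "AE s in lborel. u (k + N) s \<le> ennreal (C * B) * indicator {0..2 * t} s" for k
      by (simp add: bound)
    have "AE s in lborel. s \<noteq> t" by (rule AE_lborel_singleton)
    then show "AE s in lborel. (\<lambda>k. u (k + N) s) \<longlonglongrightarrow> v s"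
      by eventually_elim (intro LIMSEQ_ignore_initial_segment lim)
  qed measurable
  then have "(\<lambda>k. \<integral>\<^sup>+s. u k s \<partial>lborel) \<longlonglongrightarrow> (\<integral>\<^sup>+s. v s \<partial>lborel)"
    by (rule LIMSEQ_offset)
  then show ?thesis by (simp add: heat_potential_def u_def v_def)
qed

lemma heat_ker_scale:
  assumes "0 < c" "0 < t"
  shows "heat_ker (c *\<^sub>R (u::'a::euclidean_space)) (c\<^sup>2 * t) * c ^ DIM('a) = heat_ker u t"
proof -
  have "(4 * pi * (c\<^sup>2 * t)) powr (- (real DIM('a) / 2)) = (c\<^sup>2 * (4 * pi * t)) powr (- (real DIM('a) / 2))"
    by (simp add: mult_ac)
  also have "\<dots> = (c\<^sup>2) powr (- (real DIM('a) / 2)) * (4 * pi * t) powr (- (real DIM('a) / 2))"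
    by (rule powr_mult)
  also have "(c\<^sup>2) powr (- (real DIM('a) / 2)) = inverse (c ^ DIM('a))"
  proof -
    have "(c powr 2) powr (- (real DIM('a) / 2)) = c powr (- real DIM('a))" by (simp add: powr_powr)
    also have "c powr 2 = c\<^sup>2" using assms by (simp add: powr_numeral)
    finally show ?thesis using assms by (simp add: powr_minus powr_realpow)
  qed
  finally have "(4 * pi * (c\<^sup>2 * t)) powr (- (real DIM('a) / 2)) * c ^ DIM('a) = (4 * pi * t) powr (- (real DIM('a) / 2))"
    using assms by (simp add: field_simps)
  then show ?thesis using assms
    by (simp add: heat_ker_eq power_mult_distrib mult_ac)
qed

lemma integrable_heat_ker: "0 < t \<Longrightarrow> integrable lborel (\<lambda>u::'a::euclidean_space. heat_ker u t)"
  by (intro integrableI_nonneg) (auto simp: nn_integral_heat_ker)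

text \<open>
  Parabolic scaling reduces the claim to dominated convergence against one fixed Gaussian. The functions
  \<open>F k\<close> may vary because in one application the time argument moves together with the width of the kernel.
\<close>

lemma heat_ker_approximate_identity:
  fixes F :: "nat \<Rightarrow> 'a::euclidean_space \<Rightarrow> real"
  assumes [measurable]: "\<And>k. F k \<in> borel_measurable borel"
    and bound: "\<And>k z. \<bar>F k z\<bar> \<le> B"
    and e: "\<And>k. 0 < e k"
    and lim: "\<And>u. (\<lambda>k. F k (x + sqrt (e k) *\<^sub>R u)) \<longlonglongrightarrow> l"
  shows "(\<lambda>k. LINT z|lborel. heat_ker (z - x) (e k) * F k z) \<longlonglongrightarrow> l"
proof -
  have eq: "(LINT z|lborel. heat_ker (z - x) (e k) * F k z)
     = (LINT u|lborel. heat_ker u 1 * F k (x + sqrt (e k) *\<^sub>R u))" for k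
  proof -
    define c where "c = sqrt (e k)"
    have c: "0 < c" "c\<^sup>2 = e k" using e[of k] by (auto simp: c_def)
    have "(LINT z|lborel. heat_ker (z - x) (e k) * F k z)
      = (LINT z|density (distr lborel borel (\<lambda>u. x + c *\<^sub>R u)) (\<lambda>_. \<bar>c\<bar> ^ DIM('a)). heat_ker (z - x) (e k) * F k z)"
      using c by (subst lborel_affine[of c x]) auto
    also have "\<dots> = (LINT u|lborel. c ^ DIM('a) * (heat_ker (c *\<^sub>R u) (e k) * F k (x + c *\<^sub>R u)))"
      using c by (subst integral_density) (auto simp: integral_distr)
    also have "\<dots> = (LINT u|lborel. heat_ker u 1 * F k (x + c *\<^sub>R u))"
      using heat_ker_scale[OF c(1), of 1] c(2) by (intro Bochner_Integration.integral_cong) (auto simp: mult_ac)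
    finally show ?thesis by (simp add: c_def)
  qed
  have "(\<lambda>k. LINT u|lborel. heat_ker u 1 * F k (x + sqrt (e k) *\<^sub>R u)) \<longlonglongrightarrow> (LINT u|lborel. heat_ker (u::'a) 1 * l)"
  proof (rule integral_dominated_convergence[where w = "\<lambda>u. heat_ker u 1 * B"])
    show "AE u in lborel. (\<lambda>k. heat_ker u 1 * F k (x + sqrt (e k) *\<^sub>R u)) \<longlonglongrightarrow> heat_ker u 1 * l"
      by (intro AE_I2 tendsto_intros lim)
    show "AE u in lborel. norm (heat_ker u 1 * F k (x + sqrt (e k) *\<^sub>R u)) \<le> heat_ker u 1 * B" for k
      by (auto simp: abs_mult intro!: mult_left_mono bound)
  qed (auto intro!: integrable_heat_ker)
  also have "(LINT u|lborel. heat_ker (u::'a) 1 * l) = l"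
    by (simp add: integral_eq_nn_integral nn_integral_heat_ker)
  finally show ?thesis unfolding eq .
qed

section \<open>Backward kernels with cut-offs as test functions\<close>

text \<open>
  Class \<open>C\<^sup>2\<close> in space and \<open>C\<^sup>1\<close> in time, with explicit derivatives as witnesses, so that products can be
  differentiated before \<open>d_time\<close> and \<open>d_space\<close> are evaluated. Mixed second derivatives are included because
  \<open>test_function\<close> requires every first derivative to be differentiable in all directions.
\<close>

definition C21_derivs ::
  "('a::euclidean_space \<Rightarrow> real \<Rightarrow> real) \<Rightarrow> ('a \<Rightarrow> real \<Rightarrow> real) \<Rightarrow> ('a \<Rightarrow> 'a \<Rightarrow> real \<Rightarrow> real)
    \<Rightarrow> ('a \<Rightarrow> 'a \<Rightarrow> 'a \<Rightarrow> real \<Rightarrow> real) \<Rightarrow> bool" where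
  "C21_derivs \<phi> \<phi>\<^sub>t \<phi>\<^sub>1 \<phi>\<^sub>2 \<longleftrightarrow>
    continuous_on UNIV (\<lambda>p. \<phi> (fst p) (snd p)) \<and> continuous_on UNIV (\<lambda>p. \<phi>\<^sub>t (fst p) (snd p)) \<and>
    (\<forall>b\<in>Basis. continuous_on UNIV (\<lambda>p. \<phi>\<^sub>1 b (fst p) (snd p))) \<and>
    (\<forall>b\<in>Basis. \<forall>c\<in>Basis. continuous_on UNIV (\<lambda>p. \<phi>\<^sub>2 b c (fst p) (snd p))) \<and>
    (\<forall>x t. (\<phi> x has_real_derivative \<phi>\<^sub>t x t) (at t)) \<and>
    (\<forall>b\<in>Basis. \<forall>x t. ((\<lambda>r. \<phi> (x + r *\<^sub>R b) t) has_real_derivative \<phi>\<^sub>1 b x t) (at 0)) \<and>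
    (\<forall>b\<in>Basis. \<forall>c\<in>Basis. \<forall>x t. ((\<lambda>r. \<phi>\<^sub>1 b (x + r *\<^sub>R c) t) has_real_derivative \<phi>\<^sub>2 b c x t) (at 0))"

lemma C21_derivsD:
  assumes "C21_derivs \<phi> \<phi>\<^sub>t \<phi>\<^sub>1 \<phi>\<^sub>2"
  shows "continuous_on UNIV (\<lambda>p. \<phi> (fst p) (snd p))"
    and "continuous_on UNIV (\<lambda>p. \<phi>\<^sub>t (fst p) (snd p))"
    and "b \<in> Basis \<Longrightarrow> continuous_on UNIV (\<lambda>p. \<phi>\<^sub>1 b (fst p) (snd p))"
    and "b \<in> Basis \<Longrightarrow> c \<in> Basis \<Longrightarrow> continuous_on UNIV (\<lambda>p. \<phi>\<^sub>2 b c (fst p) (snd p))"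
    and "(\<phi> x has_real_derivative \<phi>\<^sub>t x t) (at t)"
    and "b \<in> Basis \<Longrightarrow> ((\<lambda>r. \<phi> (x + r *\<^sub>R b) t) has_real_derivative \<phi>\<^sub>1 b x t) (at 0)"
    and "b \<in> Basis \<Longrightarrow> c \<in> Basis \<Longrightarrow> ((\<lambda>r. \<phi>\<^sub>1 b (x + r *\<^sub>R c) t) has_real_derivative \<phi>\<^sub>2 b c x t) (at 0)"
  using assms unfolding C21_derivs_def by blast+

lemma C21_derivs_deriv:
  assumes C: "C21_derivs \<phi> \<phi>\<^sub>t \<phi>\<^sub>1 \<phi>\<^sub>2"
  shows "d_time \<phi> x t = \<phi>\<^sub>t x t" "b \<in> Basis \<Longrightarrow> d_space b \<phi> = \<phi>\<^sub>1 b"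
    "b \<in> Basis \<Longrightarrow> c \<in> Basis \<Longrightarrow> d_space c (\<phi>\<^sub>1 b) = \<phi>\<^sub>2 b c"
    "laplace \<phi> x t = (\<Sum>b\<in>Basis. \<phi>\<^sub>2 b b x t)"
proof -
  show "d_time \<phi> x t = \<phi>\<^sub>t x t"
    unfolding d_time_def by (rule DERIV_imp_deriv[OF C21_derivsD(5)[OF C]])
  show 1: "d_space b \<phi> = \<phi>\<^sub>1 b" if "b \<in> Basis" for b
    unfolding d_space_def fun_eq_iff using DERIV_imp_deriv[OF C21_derivsD(6)[OF C that]] by blast
  show 2: "d_space c (\<phi>\<^sub>1 b) = \<phi>\<^sub>2 b c" if "b \<in> Basis" "c \<in> Basis" for b c
    unfolding d_space_def fun_eq_iff using DERIV_imp_deriv[OF C21_derivsD(7)[OF C that]] by blast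
  show "laplace \<phi> x t = (\<Sum>b\<in>Basis. \<phi>\<^sub>2 b b x t)"
    unfolding laplace_def by (intro sum.cong refl) (simp add: 1 2)
qed

lemma has_real_derivative_imp_differentiable:
  "(f has_real_derivative D) F \<Longrightarrow> f differentiable F"
  unfolding has_field_derivative_def differentiable_def by blast

lemma C21_derivs_test_function:
  assumes C: "C21_derivs \<phi> \<phi>\<^sub>t \<phi>\<^sub>1 \<phi>\<^sub>2"
    and K: "compact K" "K \<subseteq> UNIV \<times> {..<T}" "\<And>x t. (x, t) \<notin> K \<Longrightarrow> \<phi> x t = 0"
  shows "test_function T \<phi>"
proof -
  note d = C21_derivs_deriv[OF C] and D = C21_derivsD[OF C]
  have "C1_time \<phi>"
    unfolding C1_time_def d(1) split_beta using D(2) has_real_derivative_imp_differentiable[OF D(5)] by blast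
  moreover have "C1_space \<phi>"
    unfolding C1_space_def split_beta using D(3) has_real_derivative_imp_differentiable[OF D(6)] by (simp add: d(2))
  moreover have "C1_space (d_space b \<phi>)" if b: "b \<in> Basis" for b
    unfolding C1_space_def d(2)[OF b] split_beta
    using D(4)[OF b] has_real_derivative_imp_differentiable[OF D(7)[OF b]] by (simp add: d(3)[OF b])
  ultimately show ?thesis
    unfolding test_function_def split_beta using D(1) K by blast
qed

lemma C21_derivs_mult:
  assumes f: "C21_derivs f f\<^sub>t f\<^sub>1 f\<^sub>2" and g: "C21_derivs g g\<^sub>t g\<^sub>1 g\<^sub>2"
  shows "C21_derivs (\<lambda>x t. f x t * g x t) (\<lambda>x t. f\<^sub>t x t * g x t + f x t * g\<^sub>t x t)
    (\<lambda>b x t. f\<^sub>1 b x t * g x t + f x t * g\<^sub>1 b x t)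
    (\<lambda>b c x t. f\<^sub>2 b c x t * g x t + f\<^sub>1 b x t * g\<^sub>1 c x t + (f\<^sub>1 c x t * g\<^sub>1 b x t + f x t * g\<^sub>2 b c x t))"
proof -
  have d1: "((\<lambda>r. f (x + r *\<^sub>R b) t) has_real_derivative f\<^sub>1 b x t) (at 0)"
    "((\<lambda>r. g (x + r *\<^sub>R b) t) has_real_derivative g\<^sub>1 b x t) (at 0)" if "b \<in> Basis" for b x t
    using C21_derivsD(6)[OF f that] C21_derivsD(6)[OF g that] by auto
  have d2: "((\<lambda>r. f\<^sub>1 b (x + r *\<^sub>R c) t) has_real_derivative f\<^sub>2 b c x t) (at 0)"
    "((\<lambda>r. g\<^sub>1 b (x + r *\<^sub>R c) t) has_real_derivative g\<^sub>2 b c x t) (at 0)" if "b \<in> Basis" "c \<in> Basis" for b c x t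
    using C21_derivsD(7)[OF f that] C21_derivsD(7)[OF g that] by auto
  have dt: "(f x has_real_derivative f\<^sub>t x t) (at t)" "(g x has_real_derivative g\<^sub>t x t) (at t)" for x t
    using C21_derivsD(5)[OF f] C21_derivsD(5)[OF g] by auto
  have "((\<lambda>t. f x t * g x t) has_real_derivative f\<^sub>t x t * g x t + f x t * g\<^sub>t x t) (at t)" for x t
    using DERIV_mult[OF dt[of x t]] by (simp add: algebra_simps)
  moreover have "((\<lambda>r. f (x + r *\<^sub>R b) t * g (x + r *\<^sub>R b) t) has_real_derivative f\<^sub>1 b x t * g x t + f x t * g\<^sub>1 b x t) (at 0)"
    if "b \<in> Basis" for b x t
    using DERIV_mult[OF d1[OF that, of x t]] by (simp add: algebra_simps)
  moreover have "((\<lambda>r. f\<^sub>1 b (x + r *\<^sub>R c) t * g (x + r *\<^sub>R c) t + f (x + r *\<^sub>R c) t * g\<^sub>1 b (x + r *\<^sub>R c) t) has_real_derivative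
      f\<^sub>2 b c x t * g x t + f\<^sub>1 b x t * g\<^sub>1 c x t + (f\<^sub>1 c x t * g\<^sub>1 b x t + f x t * g\<^sub>2 b c x t)) (at 0)"
    if "b \<in> Basis" "c \<in> Basis" for b c x t
    using DERIV_add[OF DERIV_mult[OF d2(1)[OF that, of x t] d1(2)[OF that(2), of x t]]
       DERIV_mult[OF d1(1)[OF that(2), of x t] d2(2)[OF that, of x t]]]
    by (simp add: algebra_simps)
  ultimately show ?thesis
    unfolding C21_derivs_def
    by (intro conjI ballI allI continuous_intros C21_derivsD(1-4)[OF f] C21_derivsD(1-4)[OF g]) blast+
qed

text \<open>
  Powers of positive parts are the building blocks of the cut-offs: they are as smooth as needed and have
  closed derivatives.
\<close>

lemma DERIV_pos_part_power:
  fixes u :: real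
  shows "((\<lambda>u. (max 0 u) ^ Suc (Suc k)) has_real_derivative real (Suc (Suc k)) * (max 0 u) ^ Suc k) (at u)"
proof -
  consider "u < 0" | "u = 0" | "0 < u" by linarith
  then show ?thesis
  proof cases
    case 1
    have "((\<lambda>u. 0) has_real_derivative 0) (at u)" by simp
    then have "((\<lambda>u. (max 0 u) ^ Suc (Suc k)) has_real_derivative 0) (at u)"
      by (rule has_field_derivative_transform_within_open[where S = "{..<0}"]) (use 1 in auto)
    then show ?thesis using 1 by simp
  next
    case 3
    have "((\<lambda>u. u ^ Suc (Suc k)) has_real_derivative real (Suc (Suc k)) * u ^ Suc k) (at u)"
      by (rule derivative_eq_intros refl)+ simp
    then have "((\<lambda>u. (max 0 u) ^ Suc (Suc k)) has_real_derivative real (Suc (Suc k)) * u ^ Suc k) (at u)"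
      by (rule has_field_derivative_transform_within_open[where S = "{0<..}"]) (use 3 in auto)
    then show ?thesis using 3 by simp
  next
    case 2
    have "((\<lambda>h::real. (max 0 h) ^ Suc (Suc k) / h) \<longlongrightarrow> 0) (at 0)"
    proof (rule tendsto_0_le[where K = 1 and f = "\<lambda>h::real. \<bar>h\<bar> ^ Suc k"])
      show "eventually (\<lambda>h::real. norm ((max 0 h) ^ Suc (Suc k) / h) \<le> norm (\<bar>h\<bar> ^ Suc k) * 1) (at 0)"
        by (rule always_eventually) (auto simp: max_def abs_mult intro!: mult_nonpos_nonneg)
      show "((\<lambda>h::real. \<bar>h\<bar> ^ Suc k) \<longlongrightarrow> 0) (at 0)"
        by (auto intro!: tendsto_eq_intros)
    qed
    then show ?thesis using 2 by (simp add: DERIV_def)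
  qed
qed

text \<open>
  A quadratic spline of class \<open>C\<^sup>1\<close> that rises from 0 to 1 on the unit interval; its derivative is a hat function.
\<close>

definition step_fun :: "real \<Rightarrow> real" where
  "step_fun u = 2 * ((max 0 u)\<^sup>2 - 2 * (max 0 (u - 1 / 2))\<^sup>2 + (max 0 (u - 1))\<^sup>2)"

definition hat_fun :: "real \<Rightarrow> real" where
  "hat_fun u = 4 * (max 0 u - 2 * max 0 (u - 1 / 2) + max 0 (u - 1))"

lemma DERIV_step_fun: "(step_fun has_real_derivative hat_fun u) (at u)"
proof -
  have sq: "((\<lambda>u. (max 0 (u - a))\<^sup>2) has_real_derivative 2 * max 0 (u - a)) (at u)" for a :: real
  proof -
    have "((\<lambda>u. u - a) has_real_derivative 1) (at u)" by (auto intro!: derivative_eq_intros)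
    from DERIV_chain2[where f = "\<lambda>u. (max 0 u) ^ Suc (Suc 0)", OF DERIV_pos_part_power[of 0 "u - a"] this]
    show ?thesis by (simp add: numeral_2_eq_2)
  qed
  have "((\<lambda>u. 2 * ((max 0 (u - 0))\<^sup>2 - 2 * (max 0 (u - 1 / 2))\<^sup>2 + (max 0 (u - 1))\<^sup>2)) has_real_derivative
     2 * (2 * max 0 (u - 0) - 2 * (2 * max 0 (u - 1 / 2)) + 2 * max 0 (u - 1))) (at u)"
    by (intro DERIV_cmult DERIV_add DERIV_diff sq)
  then show ?thesis by (simp add: step_fun_def[abs_def] hat_fun_def algebra_simps)
qed

lemma step_fun_simps: "u \<le> 0 \<Longrightarrow> step_fun u = 0" "1 \<le> u \<Longrightarrow> step_fun u = 1"
    "u \<le> 0 \<Longrightarrow> hat_fun u = 0" "1 \<le> u \<Longrightarrow> hat_fun u = 0"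
proof -
  show "u \<le> 0 \<Longrightarrow> step_fun u = 0" "u \<le> 0 \<Longrightarrow> hat_fun u = 0"
    by (simp_all add: step_fun_def hat_fun_def)
  show "1 \<le> u \<Longrightarrow> hat_fun u = 0" by (simp add: hat_fun_def)
  show "1 \<le> u \<Longrightarrow> step_fun u = 1"
    by (simp add: step_fun_def power2_eq_square) (simp add: algebra_simps)
qed

lemma hat_fun_bounds: "0 \<le> hat_fun u" "hat_fun u \<le> 2"
  unfolding hat_fun_def max_def by (simp_all split: if_split)

lemma continuous_hat_fun [continuous_intros]:
  assumes f: "continuous_on S f"
  shows "continuous_on S (\<lambda>x. hat_fun (f x))"
  unfolding hat_fun_def by (intro continuous_intros f)

lemma continuous_step_fun [continuous_intros]:
  assumes f: "continuous_on S f"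
  shows "continuous_on S (\<lambda>x. step_fun (f x))"
  unfolding step_fun_def by (intro continuous_intros f)

lemma step_fun_bounds: "0 \<le> step_fun u" "step_fun u \<le> 1"
proof -
  have mono: "step_fun u \<le> step_fun v" if "u \<le> v" for u v
    by (rule DERIV_nonneg_imp_nondecreasing[OF that]) (use DERIV_step_fun hat_fun_bounds(1) in blast)
  show "0 \<le> step_fun u" using mono[of "min u 0" u] by (simp add: step_fun_simps)
  show "step_fun u \<le> 1" using mono[of u "max u 1"] by (simp add: step_fun_simps)
qed

lemma hat_fun_integral: "has_bochner_integral lborel hat_fun 1"
proof -
  have "has_bochner_integral lborel (\<lambda>u. hat_fun u * indicator {0..1} u) (step_fun 1 - step_fun 0)"
  proof (rule has_bochner_integral_FTC_Icc_real)
    have "continuous_on UNIV hat_fun" using continuous_hat_fun[OF continuous_on_id] by simp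
    then show "isCont hat_fun u" for u by (simp add: continuous_on_eq_continuous_at)
  qed (simp_all add: DERIV_step_fun)
  moreover have "(\<lambda>u. hat_fun u * indicator {0..1} u) = hat_fun"
  proof
    show "hat_fun u * indicator {0..1} u = hat_fun u" for u
      using step_fun_simps(3,4)[of u] by (cases "u \<in> {0..1}") auto
  qed
  ultimately show ?thesis by (simp add: step_fun_simps)
qed

lemma DERIV_heat_ker_time:
  fixes v :: "'a::euclidean_space"
  assumes "0 < s"
  shows "((\<lambda>s. heat_ker v s) has_real_derivative
     heat_ker v s * ((norm v)\<^sup>2 / (4 * s\<^sup>2) - real DIM('a) / (2 * s))) (at s)"
proof -
  define p where "p = - (real DIM('a) / 2)"
  have "((\<lambda>s. (4 * pi * s) powr p * exp (- (norm v)\<^sup>2 / (4 * s))) has_real_derivative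
     p * (4 * pi * s) powr (p - 1) * (4 * pi) * exp (- (norm v)\<^sup>2 / (4 * s))
      + (4 * pi * s) powr p * (exp (- (norm v)\<^sup>2 / (4 * s)) * ((norm v)\<^sup>2 / (4 * s\<^sup>2)))) (at s)"
    using assms by (auto intro!: derivative_eq_intros simp: power2_eq_square divide_simps)
  also have "p * (4 * pi * s) powr (p - 1) * (4 * pi) * exp (- (norm v)\<^sup>2 / (4 * s))
      + (4 * pi * s) powr p * (exp (- (norm v)\<^sup>2 / (4 * s)) * ((norm v)\<^sup>2 / (4 * s\<^sup>2)))
     = heat_ker v s * ((norm v)\<^sup>2 / (4 * s\<^sup>2) - real DIM('a) / (2 * s))"
  proof -
    have "(4 * pi * s) powr (p - 1) = (4 * pi * s) powr p / (4 * pi * s)"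
      using assms by (simp add: powr_diff)
    then have "p * (4 * pi * s) powr (p - 1) * (4 * pi) = (4 * pi * s) powr p * (p / s)"
      using assms by simp
    moreover have "p / s = - (real DIM('a) / (2 * s))" by (simp add: p_def)
    ultimately show ?thesis
      using assms by (simp add: heat_ker_eq p_def[symmetric] algebra_simps)
  qed
  finally show ?thesis
    by (rule has_field_derivative_transform_within_open[where S = "{0<..}"])
       (use assms in \<open>auto simp: heat_ker_eq p_def\<close>)
qed

lemma norm_add_scaleR_square:
  "(norm (v + r *\<^sub>R b))\<^sup>2 = v \<bullet> v + 2 * r * (v \<bullet> b) + r\<^sup>2 * (b \<bullet> b)"
  unfolding power2_norm_eq_inner inner_add_left inner_add_right inner_commute[of "r *\<^sub>R b" v]
  by (simp add: power2_eq_square)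

lemma DERIV_heat_ker_space:
  fixes v b :: "'a::euclidean_space"
  assumes "0 < s"
  shows "((\<lambda>r. heat_ker (v + r *\<^sub>R b) s) has_real_derivative - heat_ker v s * (v \<bullet> b) / (2 * s)) (at 0)"
proof -
  define p where "p = - (real DIM('a) / 2)"
  have "((\<lambda>r. (4 * pi * s) powr p * exp (- (v \<bullet> v + 2 * r * (v \<bullet> b) + r\<^sup>2 * (b \<bullet> b)) / (4 * s))) has_real_derivative
     (4 * pi * s) powr p * (exp (- (v \<bullet> v) / (4 * s)) * (- (2 * (v \<bullet> b)) / (4 * s)))) (at 0)"
    using assms by (auto intro!: derivative_eq_intros)
  then show ?thesis using assms
    by (simp add: heat_ker_eq p_def[symmetric] norm_add_scaleR_square) (simp add: power2_norm_eq_inner mult.assoc)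
qed

lemma continuous_on_heat_ker [continuous_intros]:
  fixes f :: "'b::topological_space \<Rightarrow> 'a::euclidean_space"
  assumes "continuous_on S f" "continuous_on S g" "\<And>p. p \<in> S \<Longrightarrow> 0 < g p"
  shows "continuous_on S (\<lambda>p. heat_ker (f p) (g p))"
  using assms unfolding continuous_on_def by (auto intro!: tendsto_heat_ker)

text \<open>
  The backward kernel \<open>heat_ker (x - z) (t + \<epsilon> - s)\<close> satisfies the adjoint heat equation but is singular at
  \<open>s = t + \<epsilon>\<close>. As \<open>\<theta>\<close> vanishes from \<open>t\<close> on, replacing \<open>t + \<epsilon> - s\<close> by its maximum with \<open>\<epsilon>/2\<close> does not
  change the product and makes all formulas regular. The pure second derivatives sum up to the term that
  cancels the time derivative of the kernel.
\<close>

lemma C21_derivs_cutoff_heat_ker: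
  fixes x :: "'a::euclidean_space"
  assumes e: "0 < \<epsilon>"
    and chi: "\<And>s. (\<theta> has_real_derivative \<theta>' s) (at s)" "continuous_on UNIV \<theta>'"
    and chi0: "\<And>s. t \<le> s \<Longrightarrow> \<theta> s = 0"
    and sigma: "\<sigma> = (\<lambda>s. max (t + \<epsilon> - s) (\<epsilon> / 2))"
  shows "C21_derivs (\<lambda>z s. \<theta> s * heat_ker (x - z) (\<sigma> s))
    (\<lambda>z s. \<theta>' s * heat_ker (x - z) (\<sigma> s) - \<theta> s * (heat_ker (x - z) (\<sigma> s)
       * ((norm (x - z))\<^sup>2 / (4 * (\<sigma> s)\<^sup>2) - real DIM('a) / (2 * \<sigma> s))))
    (\<lambda>b z s. \<theta> s * (heat_ker (x - z) (\<sigma> s) * ((x - z) \<bullet> b) / (2 * \<sigma> s)))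
    (\<lambda>b c z s. \<theta> s * (heat_ker (x - z) (\<sigma> s) * (((x - z) \<bullet> b) * ((x - z) \<bullet> c) / (4 * (\<sigma> s)\<^sup>2) - (b \<bullet> c) / (2 * \<sigma> s))))"
proof -
  have sp: "0 < \<sigma> s" for s using e by (simp add: sigma)
  have sn: "\<sigma> s \<noteq> 0" for s using sp[of s] by simp
  have chic: "continuous_on UNIV \<theta>" using chi(1) by (auto intro: DERIV_continuous_on)
  have chi0': "\<theta>' s = 0" if "t < s" for s
  proof -
    have "((\<lambda>u. 0) has_real_derivative \<theta>' s) (at s)"
      by (rule has_field_derivative_transform_within_open[OF chi(1), where S = "{t<..}"]) (use that chi0 in auto)
    then show ?thesis using DERIV_unique[OF _ DERIV_const] by blast
  qed
  have sc: "continuous_on UNIV (\<lambda>p::'a \<times> real. \<sigma> (snd p))" unfolding sigma by (intro continuous_intros)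
  have cc: "continuous_on UNIV (\<lambda>p::'a \<times> real. \<theta> (snd p))" "continuous_on UNIV (\<lambda>p::'a \<times> real. \<theta>' (snd p))"
    by (rule continuous_on_compose2[OF chic]; auto intro: continuous_intros)
      (rule continuous_on_compose2[OF chi(2)]; auto intro: continuous_intros)
  have d1: "((\<lambda>r. heat_ker (x - (z + r *\<^sub>R b)) (\<sigma> s)) has_real_derivative heat_ker (x - z) (\<sigma> s) * ((x - z) \<bullet> b) / (2 * \<sigma> s)) (at 0)"
    for z b s
    using DERIV_heat_ker_space[OF sp[of s], of "x - z" "- b"] by (simp add: algebra_simps)
  have d2: "((\<lambda>r. (x - (z + r *\<^sub>R c)) \<bullet> b) has_real_derivative - (b \<bullet> c)) (at 0)" for z b c
    by (simp add: inner_diff_left inner_add_left inner_commute[of c b])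
       (auto intro!: derivative_eq_intros)
  have d12: "((\<lambda>r. \<theta> s * (heat_ker (x - (z + r *\<^sub>R c)) (\<sigma> s) * ((x - (z + r *\<^sub>R c)) \<bullet> b) / (2 * \<sigma> s))) has_real_derivative
      \<theta> s * (heat_ker (x - z) (\<sigma> s) * (((x - z) \<bullet> b) * ((x - z) \<bullet> c) / (4 * (\<sigma> s)\<^sup>2) - (b \<bullet> c) / (2 * \<sigma> s)))) (at 0)" for z b c s
  proof -
    have "((\<lambda>r. \<theta> s * (heat_ker (x - (z + r *\<^sub>R c)) (\<sigma> s) * ((x - (z + r *\<^sub>R c)) \<bullet> b) / (2 * \<sigma> s))) has_real_derivative
      \<theta> s * ((heat_ker (x - z) (\<sigma> s) * ((x - z) \<bullet> c) / (2 * \<sigma> s) * ((x - z) \<bullet> b) + - (b \<bullet> c) * heat_ker (x - z) (\<sigma> s)) / (2 * \<sigma> s))) (at 0)"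
      using DERIV_cmult[OF DERIV_cdivide[OF DERIV_mult[OF d1[of z c s] d2[of z c b]]]] by simp
    moreover have e: "(heat_ker (x - z) (\<sigma> s) * ((x - z) \<bullet> c) / (2 * \<sigma> s) * ((x - z) \<bullet> b) + - (b \<bullet> c) * heat_ker (x - z) (\<sigma> s)) / (2 * \<sigma> s)
      = heat_ker (x - z) (\<sigma> s) * (((x - z) \<bullet> b) * ((x - z) \<bullet> c) / (4 * (\<sigma> s)\<^sup>2) - (b \<bullet> c) / (2 * \<sigma> s))"
      using sp[of s] by (simp add: power2_eq_square divide_simps) (simp add: algebra_simps)?
    ultimately show ?thesis unfolding e by blast
  qed
  have dt: "((\<lambda>s. \<theta> s * heat_ker (x - z) (\<sigma> s)) has_real_derivative
     \<theta>' s * heat_ker (x - z) (\<sigma> s) - \<theta> s * (heat_ker (x - z) (\<sigma> s)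
       * ((norm (x - z))\<^sup>2 / (4 * (\<sigma> s)\<^sup>2) - real DIM('a) / (2 * \<sigma> s)))) (at s)" for z s
  proof (cases "t < s")
    case True
    have "((\<lambda>s. \<theta> s * heat_ker (x - z) (\<sigma> s)) has_real_derivative 0) (at s)"
      by (rule has_field_derivative_transform_within_open[where S = "{t<..}", OF DERIV_const[of 0]])
         (use True chi0 in auto)
    then show ?thesis using True chi0 chi0' by simp
  next
    case False
    then have s: "0 < t + \<epsilon> - s" "\<sigma> s = t + \<epsilon> - s" using e by (auto simp: sigma)
    have "((\<lambda>s. heat_ker (x - z) (t + \<epsilon> - s)) has_real_derivative
       (heat_ker (x - z) (t + \<epsilon> - s) * ((norm (x - z))\<^sup>2 / (4 * (t + \<epsilon> - s)\<^sup>2) - real DIM('a) / (2 * (t + \<epsilon> - s)))) * (- 1)) (at s)"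
      by (rule DERIV_chain2[where f = "heat_ker (x - z)" and g = "\<lambda>s. t + \<epsilon> - s", OF DERIV_heat_ker_time[OF s(1)]]) (auto intro!: derivative_eq_intros)
    from DERIV_mult[OF chi(1)[of s] this]
    have "((\<lambda>s. \<theta> s * heat_ker (x - z) (t + \<epsilon> - s)) has_real_derivative
      \<theta>' s * heat_ker (x - z) (\<sigma> s) - \<theta> s * (heat_ker (x - z) (\<sigma> s)
       * ((norm (x - z))\<^sup>2 / (4 * (\<sigma> s)\<^sup>2) - real DIM('a) / (2 * \<sigma> s)))) (at s)"
      unfolding s(2) by (simp add: algebra_simps)
    then show ?thesis
      by (rule has_field_derivative_transform_within_open[where S = "{..<t + \<epsilon> / 2}"])
         (use False e in \<open>auto simp: sigma max_def\<close>)
  qed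
  show ?thesis
    unfolding C21_derivs_def
  proof (intro conjI ballI allI)
    fix z s and b c :: 'a
    show "((\<lambda>r. \<theta> s * heat_ker (x - (z + r *\<^sub>R b)) (\<sigma> s)) has_real_derivative
        \<theta> s * (heat_ker (x - z) (\<sigma> s) * ((x - z) \<bullet> b) / (2 * \<sigma> s))) (at 0)"
      by (rule DERIV_cmult[OF d1])
  qed (intro dt d12 continuous_intros sc cc sp ballI; simp add: sn)+
qed

text \<open>
  The cube of a positive part is of class \<open>C\<^sup>2\<close>. The cut-off tends to 1 as \<open>R\<close> grows, and its derivatives tend to 0.
\<close>

lemma C21_derivs_space_cutoff:
  fixes y :: "'a::euclidean_space"
  assumes v: "v = (\<lambda>z. max 0 (1 - (norm (z - y))\<^sup>2 / R\<^sup>2))"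
  shows "C21_derivs (\<lambda>z s. (v z) ^ 3) (\<lambda>z s. 0)
    (\<lambda>b z s. - 6 * (v z)\<^sup>2 * ((z - y) \<bullet> b) / R\<^sup>2)
    (\<lambda>b c z s. 24 * v z * ((z - y) \<bullet> b) * ((z - y) \<bullet> c) / R\<^sup>2 / R\<^sup>2 - 6 * (v z)\<^sup>2 * (b \<bullet> c) / R\<^sup>2)"
proof -
  have c: "continuous_on UNIV (\<lambda>p::'a \<times> real. v (fst p))"
    unfolding v divide_inverse by (intro continuous_intros)
  have g: "((\<lambda>r. 1 - (norm (z + r *\<^sub>R b - y))\<^sup>2 / R\<^sup>2) has_real_derivative - 2 * ((z - y) \<bullet> b) / R\<^sup>2) (at 0)" for z b
  proof -
    have "(norm (z + r *\<^sub>R b - y))\<^sup>2 = (z - y) \<bullet> (z - y) + 2 * r * ((z - y) \<bullet> b) + r\<^sup>2 * (b \<bullet> b)" for r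
    proof -
      have "z + r *\<^sub>R b - y = (z - y) + r *\<^sub>R b" by simp
      then show ?thesis by (simp only: norm_add_scaleR_square)
    qed
    moreover have "((\<lambda>r. (z - y) \<bullet> (z - y) + 2 * r * ((z - y) \<bullet> b) + r\<^sup>2 * (b \<bullet> b)) has_real_derivative 2 * ((z - y) \<bullet> b)) (at 0)"
      by (auto intro!: derivative_eq_intros)
    from DERIV_diff[OF DERIV_const[of 1] DERIV_cdivide[OF this, of "R\<^sup>2"]]
    have "((\<lambda>r. 1 - ((z - y) \<bullet> (z - y) + 2 * r * ((z - y) \<bullet> b) + r\<^sup>2 * (b \<bullet> b)) / R\<^sup>2) has_real_derivative - 2 * ((z - y) \<bullet> b) / R\<^sup>2) (at 0)"
      by simp
    ultimately show ?thesis by (simp only:)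
  qed
  have d3: "((\<lambda>r. (v (z + r *\<^sub>R b)) ^ 3) has_real_derivative - 6 * (v z)\<^sup>2 * ((z - y) \<bullet> b) / R\<^sup>2) (at 0)" for z b
    using DERIV_chain2[where f = "\<lambda>u. (max 0 u) ^ Suc (Suc 1)", OF DERIV_pos_part_power[of 1] g[of z b]] by (simp add: v eval_nat_numeral mult.assoc)
  have d2: "((\<lambda>r. (v (z + r *\<^sub>R b))\<^sup>2) has_real_derivative - 4 * v z * ((z - y) \<bullet> b) / R\<^sup>2) (at 0)" for z b
    using DERIV_chain2[where f = "\<lambda>u. (max 0 u) ^ Suc (Suc 0)", OF DERIV_pos_part_power[of 0] g[of z b]] by (simp add: v eval_nat_numeral mult.assoc)
  have l: "((\<lambda>r. (z + r *\<^sub>R c - y) \<bullet> b) has_real_derivative b \<bullet> c) (at 0)" for z b c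
    by (simp add: inner_diff_left inner_add_left inner_commute[of c b])
       (auto intro!: derivative_eq_intros)
  have d22: "((\<lambda>r. - 6 * (v (z + r *\<^sub>R c))\<^sup>2 * ((z + r *\<^sub>R c - y) \<bullet> b) / R\<^sup>2) has_real_derivative
      24 * v z * ((z - y) \<bullet> b) * ((z - y) \<bullet> c) / R\<^sup>2 / R\<^sup>2 - 6 * (v z)\<^sup>2 * (b \<bullet> c) / R\<^sup>2) (at 0)" for z b c
  proof -
    have "((\<lambda>r. - 6 * ((v (z + r *\<^sub>R c))\<^sup>2 * ((z + r *\<^sub>R c - y) \<bullet> b)) / R\<^sup>2) has_real_derivative
      - 6 * (- 4 * v z * ((z - y) \<bullet> c) / R\<^sup>2 * ((z - y) \<bullet> b) + (b \<bullet> c) * (v z)\<^sup>2) / R\<^sup>2) (at 0)"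
      using DERIV_mult[OF d2[of z c] l[of z c b]] by (intro DERIV_cdivide DERIV_cmult) simp
    then show ?thesis by (simp add: algebra_simps diff_divide_distrib add_divide_distrib)
  qed
  show ?thesis
    unfolding C21_derivs_def divide_inverse
    by (intro conjI ballI allI d3[unfolded divide_inverse] d22[unfolded divide_inverse] continuous_intros c) simp
qed

section \<open>Duhamel's formula for weak solutions\<close>

lemma borel_measurable_fst [measurable (raw)]:
  fixes f :: "'c \<Rightarrow> 'a::topological_space \<times> 'b::topological_space"
  assumes "f \<in> borel_measurable M"
  shows "(\<lambda>p. fst (f p)) \<in> borel_measurable M"
  by (rule measurable_compose[OF assms borel_measurable_continuous_onI]) (intro continuous_intros)

lemma borel_measurable_snd [measurable (raw)]:
  fixes f :: "'c \<Rightarrow> 'a::topological_space \<times> 'b::topological_space"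
  assumes "f \<in> borel_measurable M"
  shows "(\<lambda>p. snd (f p)) \<in> borel_measurable M"
  by (rule measurable_compose[OF assms borel_measurable_continuous_onI]) (intro continuous_intros)

lemma Q_dom_borel [measurable]: "Q_dom T \<in> sets borel"
  unfolding Q_dom_def by (simp add: borel_prod[symmetric])

text \<open>
  Passes from the Lebesgue measure of the weak formulation to the Borel measure on space-time, which is a product
  measure.
\<close>

lemma integral_lebesgue_on_Q_dom:
  fixes g :: "'a::euclidean_space \<times> real \<Rightarrow> real"
  assumes "(\<lambda>p. indicator (Q_dom T) p * g p) \<in> borel_measurable borel"
  shows "integral\<^sup>L (lebesgue_on (Q_dom T)) g = (LINT p|lborel. indicator (Q_dom T) p * g p)"
proof -
  have "integral\<^sup>L (lebesgue_on (Q_dom T)) g = (LINT p|lebesgue. indicator (Q_dom T) p *\<^sub>R g p)"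
    by (rule integral_restrict_space) simp
  also have "\<dots> = (LINT p|lborel. indicator (Q_dom T) p *\<^sub>R g p)"
    using assms by (intro integral_completion) simp
  finally show ?thesis by simp
qed

lemma nn_integral_space_time:
  fixes f :: "'a::euclidean_space \<times> real \<Rightarrow> ennreal"
  assumes "f \<in> borel_measurable borel"
  shows "(\<integral>\<^sup>+p. f p \<partial>lborel) = (\<integral>\<^sup>+s. \<integral>\<^sup>+z. f (z, s) \<partial>lborel \<partial>lborel)"
proof -
  have "f \<in> borel_measurable (lborel \<Otimes>\<^sub>M lborel)" using assms by (simp add: lborel_prod)
  from lborel_pair.nn_integral_snd[OF this] show ?thesis by (simp add: lborel_prod)
qed

text \<open>
  A weak solution is controlled on \<open>Q_dom T\<close> only; extended by 0 it is a Borel function on all of space-time.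
\<close>

definition on_Q :: "real \<Rightarrow> ('a::euclidean_space \<Rightarrow> real \<Rightarrow> real) \<Rightarrow> 'a \<Rightarrow> real \<Rightarrow> real" where
  "on_Q T w x t = (if 0 < t \<and> t \<le> T then w x t else 0)"

lemma on_Q_measurable:
  assumes "continuous_on (Q_dom T) (\<lambda>(x, t). w x t)"
  shows "(\<lambda>(x, t). on_Q T w x t) \<in> borel_measurable borel"
proof -
  have "(\<lambda>p. indicator (Q_dom T) p *\<^sub>R (\<lambda>(x, t). w x t) p) \<in> borel_measurable borel"
    by (rule borel_measurable_continuous_on_indicator[OF _ assms]) simp
  also have "(\<lambda>p. indicator (Q_dom T) p *\<^sub>R (\<lambda>(x, t). w x t) p) = (\<lambda>(x, t). on_Q T w x t)"
    by (auto simp: fun_eq_iff on_Q_def Q_dom_def indicator_def)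
  finally show ?thesis .
qed

lemma integrable_heat_ker_until:
  fixes y :: "'a::euclidean_space"
  shows "integrable lborel (\<lambda>p. heat_ker (fst p - y) (snd p - s) * indicator {..T} (snd p))"
proof (rule integrableI_nonneg)
  have "(\<integral>\<^sup>+p. ennreal (heat_ker (fst p - y) (snd p - s) * indicator {..T} (snd p)) \<partial>lborel)
    = (\<integral>\<^sup>+t. \<integral>\<^sup>+z. ennreal (heat_ker (z - y) (t - s) * indicator {..T} t) \<partial>lborel \<partial>lborel)"
    by (subst nn_integral_space_time) simp_all
  also have "\<dots> \<le> (\<integral>\<^sup>+t. indicator {s..T} t \<partial>lborel)"
  proof (rule nn_integral_mono)
    fix t
    show "(\<integral>\<^sup>+z. ennreal (heat_ker (z - y) (t - s) * indicator {..T} t) \<partial>lborel) \<le> indicator {s..T} t"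
      by (cases "s < t") (auto simp: indicator_def nn_integral_heat_ker_shift)
  qed
  also have "\<dots> < \<infinity>" by (cases "s \<le> T") auto
  finally show "(\<integral>\<^sup>+p. ennreal (heat_ker (fst p - y) (snd p - s) * indicator {..T} (snd p)) \<partial>lborel) < \<infinity>" .
  show "(\<lambda>p. heat_ker (fst p - y) (snd p - s) * indicator {..T} (snd p)) \<in> borel_measurable lborel"
    by measurable
qed auto

text \<open>
  The backward kernel itself has no compact support. It is tested with a spatial cut-off of radius \<open>R\<close>, and
  \<open>R\<close> tends to infinity. The terms with derivatives of the cut-off are bounded and tend to 0, and the Gaussian bound
  on \<open>w\<close> provides the integrable majorant. The integrand of the limit is nonnegative, as \<open>\<theta>\<close> decreases on
  positive times, so the limit can be stated with nonnegative integrals.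
\<close>

lemma weak_identity_without_space_cutoff:
  fixes w W :: "'a::euclidean_space \<Rightarrow> real \<Rightarrow> real"
  assumes Wm: "(\<lambda>(x, t). W x t) \<in> borel_measurable borel"
    and W: "\<And>x t. 0 \<le> W x t \<and> W x t \<le> M"
    and sol: "dirac_solution T W y w"
    and t: "0 < t" "t < T" and e: "0 < \<epsilon>"
    and theta: "\<And>s. (\<theta> has_real_derivative \<theta>' s) (at s)" "continuous_on UNIV \<theta>'"
    and theta0: "\<And>s. t \<le> s \<Longrightarrow> \<theta> s = 0" "\<And>s. s \<le> - 1 \<Longrightarrow> \<theta> s = 0"
    and theta_bd: "\<And>s. 0 \<le> \<theta> s" "\<And>s. \<theta> s \<le> 1" "\<And>s. \<bar>\<theta>' s\<bar> \<le> B"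
    and theta_dec: "\<And>s. 0 < s \<Longrightarrow> \<theta>' s \<le> 0"
    and sigma: "\<sigma> = (\<lambda>s. max (t + \<epsilon> - s) (\<epsilon> / 2))"
  shows "(\<integral>\<^sup>+s. \<integral>\<^sup>+z. ennreal (on_Q T w z s * heat_ker (x - z) (\<sigma> s)) * ennreal (- \<theta>' s + W z s * \<theta> s) \<partial>lborel \<partial>lborel)
     = ennreal (\<theta> 0 * heat_ker (x - y) (t + \<epsilon>))"
proof -
  define u where "u = on_Q T w"
  have cont: "continuous_on (Q_dom T) (\<lambda>(x, t). w x t)"
    and w: "\<And>x t. 0 < t \<Longrightarrow> t \<le> T \<Longrightarrow> 0 \<le> w x t \<and> w x t \<le> gauss_kernel (x - y) t"
    and weak: "\<And>\<phi>. test_function T \<phi> \<Longrightarrow> (LINT (x, t) | lebesgue_on (Q_dom T).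
           w x t * (- d_time \<phi> x t - laplace \<phi> x t + W x t * \<phi> x t)) = \<phi> y 0"
    using sol unfolding dirac_solution_def by auto
  have um: "(\<lambda>(x, t). u x t) \<in> borel_measurable borel"
    unfolding u_def by (rule on_Q_measurable[OF cont])
  note [measurable (raw)] = measurable_curried[OF Wm] measurable_curried[OF um]
  have u0: "0 \<le> u z s" for z s using w[of s z] by (simp add: u_def on_Q_def)
  have u_le: "u z s \<le> heat_ker (z - y) s * indicator {..T} s" for z s
    using w[of s z] by (auto simp: u_def on_Q_def heat_ker_def indicator_def)
  have u_early: "u z s = 0" if "s \<le> 0" for z s using that by (simp add: u_def on_Q_def)
  have M0: "0 \<le> M" using W[of 0 0] by linarith
  have B0: "0 \<le> B" using theta_bd(3)[of 0] by linarith
  have sp: "\<epsilon> / 2 \<le> \<sigma> s" "0 < \<sigma> s" for s using e by (auto simp: sigma)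
  define \<kappa> where "\<kappa> = (4 * pi * (\<epsilon> / 2)) powr (- (real DIM('a) / 2))"
  have \<kappa>: "heat_ker (x - z) (\<sigma> s) \<le> \<kappa>" for z s
    unfolding \<kappa>_def using sp[of s] e by (intro heat_ker_le_of_time_ge) auto
  have \<kappa>0: "0 \<le> \<kappa>" by (simp add: \<kappa>_def)
  have [measurable]: "\<theta> \<in> borel_measurable borel" "\<theta>' \<in> borel_measurable borel"
    using theta by (auto intro!: borel_measurable_continuous_onI DERIV_continuous_on)
  have [measurable]: "\<sigma> \<in> borel_measurable borel" unfolding sigma by measurable
  define A where "A = (\<lambda>z s. \<theta> s * heat_ker (x - z) (\<sigma> s))"
  define A1 where "A1 = (\<lambda>b z s. \<theta> s * (heat_ker (x - z) (\<sigma> s) * ((x - z) \<bullet> b) / (2 * \<sigma> s)))"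
  define v where "v = (\<lambda>R z. max 0 (1 - (norm (z - y))\<^sup>2 / R\<^sup>2))"
  define e1 where "e1 = (\<lambda>R b z. - 6 * (v R z)\<^sup>2 * ((z - y) \<bullet> b) / R\<^sup>2)"
  define e2 where "e2 = (\<lambda>R b z. 24 * v R z * ((z - y) \<bullet> b) * ((z - y) \<bullet> b) / R\<^sup>2 / R\<^sup>2 - 6 * (v R z)\<^sup>2 * (b \<bullet> b) / R\<^sup>2)"
  define f where "f = (\<lambda>R z s. u z s * (- \<theta>' s * heat_ker (x - z) (\<sigma> s) * (v R z) ^ 3
      - (\<Sum>b\<in>Basis. 2 * (A1 b z s * e1 R b z) + A z s * e2 R b z) + W z s * A z s * (v R z) ^ 3))"
  define g where "g = (\<lambda>z s. u z s * (- \<theta>' s * heat_ker (x - z) (\<sigma> s) + W z s * A z s))"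
  have A0: "0 \<le> A z s" "A z s \<le> \<kappa>" for z s
    using theta_bd(1,2)[of s] \<kappa>[of z s] mult_mono[of "\<theta> s" 1 "heat_ker (x - z) (\<sigma> s)" \<kappa>]
    by (auto simp: A_def)
  have v01: "0 \<le> v R z" "v R z \<le> 1" for R z by (auto simp: v_def)
  have id: "(LINT p|lborel. f R (fst p) (snd p)) = \<theta> 0 * heat_ker (x - y) (t + \<epsilon>)" if R: "0 < R" for R
  proof -
    define \<phi> where "\<phi> = (\<lambda>z s. A z s * (v R z) ^ 3)"
    define At where "At = (\<lambda>z s. \<theta>' s * heat_ker (x - z) (\<sigma> s) - \<theta> s * (heat_ker (x - z) (\<sigma> s)
       * ((norm (x - z))\<^sup>2 / (4 * (\<sigma> s)\<^sup>2) - real DIM('a) / (2 * \<sigma> s))))"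
    define A2 where "A2 = (\<lambda>b c z s. \<theta> s * (heat_ker (x - z) (\<sigma> s) * (((x - z) \<bullet> b) * ((x - z) \<bullet> c) / (4 * (\<sigma> s)\<^sup>2) - (b \<bullet> c) / (2 * \<sigma> s))))"
    have CA: "C21_derivs A At A1 A2"
      unfolding A_def At_def A1_def A2_def
      by (rule C21_derivs_cutoff_heat_ker[OF e theta theta0(1) sigma])
    note C\<phi> = C21_derivs_mult[OF CA C21_derivs_space_cutoff[OF v_def[THEN fun_cong, of R]], folded \<phi>_def]
    have tf: "test_function T \<phi>"
    proof (rule C21_derivs_test_function[OF C\<phi>])
      show "compact (cball y R \<times> {- 1..t})" by (intro compact_Times) auto
      show "cball y R \<times> {- 1..t} \<subseteq> UNIV \<times> {..<T}" using t by auto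
      fix z s assume "(z, s) \<notin> cball y R \<times> {- 1..t}"
      then consider "R < norm (z - y)" | "s < - 1" | "t < s"
        by (auto simp: dist_norm norm_minus_commute not_le)
      then show "\<phi> z s = 0"
      proof cases
        case 1
        then have "R\<^sup>2 \<le> (norm (z - y))\<^sup>2" using R by (intro power_mono) auto
        then have "v R z = 0" using R by (simp add: v_def divide_simps)
        then show ?thesis by (simp add: \<phi>_def)
      qed (use theta0 in \<open>auto simp: \<phi>_def A_def\<close>)
    qed
    have eq: "- d_time \<phi> z s - laplace \<phi> z s + W z s * \<phi> z s
      = - \<theta>' s * heat_ker (x - z) (\<sigma> s) * (v R z) ^ 3
      - (\<Sum>b\<in>Basis. 2 * (A1 b z s * e1 R b z) + A z s * e2 R b z) + W z s * A z s * (v R z) ^ 3" for z s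
    proof -
      have "(\<Sum>b\<in>Basis. A2 b b z s) = \<theta> s * heat_ker (x - z) (\<sigma> s) * (\<Sum>b\<in>Basis. ((x - z) \<bullet> b) * ((x - z) \<bullet> b) / (4 * (\<sigma> s)\<^sup>2) - (b \<bullet> b) / (2 * \<sigma> s))"
        unfolding A2_def sum_distrib_left by (simp add: mult_ac)
      also have "(\<Sum>b\<in>Basis. ((x - z) \<bullet> b) * ((x - z) \<bullet> b) / (4 * (\<sigma> s)\<^sup>2) - (b \<bullet> b) / (2 * \<sigma> s))
         = (norm (x - z))\<^sup>2 / (4 * (\<sigma> s)\<^sup>2) - real DIM('a) / (2 * \<sigma> s)"
        unfolding sum_subtractf sum_divide_distrib[symmetric] power2_norm_eq_inner euclidean_inner[of "x - z" "x - z"] by simp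
      finally have "At z s + (\<Sum>b\<in>Basis. A2 b b z s) = \<theta>' s * heat_ker (x - z) (\<sigma> s)"
        by (simp add: At_def mult_ac)
      moreover have "laplace \<phi> z s = (\<Sum>b\<in>Basis. A2 b b z s) * (v R z) ^ 3 + (\<Sum>b\<in>Basis. 2 * (A1 b z s * e1 R b z) + A z s * e2 R b z)"
        unfolding C21_derivs_deriv(4)[OF C\<phi>] sum_distrib_right sum.distrib[symmetric]
        by (intro sum.cong refl) (simp add: e1_def e2_def algebra_simps)
      moreover have "d_time \<phi> z s = At z s * (v R z) ^ 3"
        unfolding C21_derivs_deriv(1)[OF C\<phi>] by simp
      moreover have "At z s * (v R z) ^ 3 + (\<Sum>b\<in>Basis. A2 b b z s) * (v R z) ^ 3 = \<theta>' s * heat_ker (x - z) (\<sigma> s) * (v R z) ^ 3"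
        unfolding distrib_right[symmetric] calculation(1) ..
      ultimately show ?thesis by (simp add: \<phi>_def)
    qed
    have fm: "(\<lambda>p. f R (fst p) (snd p)) \<in> borel_measurable borel"
      unfolding f_def A_def A1_def e1_def e2_def v_def by measurable
    have ind: "(\<lambda>p. indicator (Q_dom T) p * (case p of (z, s) \<Rightarrow> w z s * (- d_time \<phi> z s - laplace \<phi> z s + W z s * \<phi> z s)))
        = (\<lambda>p. f R (fst p) (snd p))"
      unfolding eq by (auto simp: fun_eq_iff f_def u_def on_Q_def Q_dom_def indicator_def)
    have "(LINT p|lborel. f R (fst p) (snd p)) = \<phi> y 0"
      unfolding weak[OF tf, symmetric]
      by (subst integral_lebesgue_on_Q_dom) (simp_all add: ind fm)
    also have "\<phi> y 0 = \<theta> 0 * heat_ker (x - y) (t + \<epsilon>)"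
      using t e by (simp add: \<phi>_def A_def v_def sigma max_def)
    finally show ?thesis .
  qed
  define D where "D = B * \<kappa> + real DIM('a) * (2 * (\<kappa> / \<epsilon> * 6 * (norm (x - y) + 1)) + \<kappa> * 30) + M * \<kappa>"
  have f_bd: "\<bar>f R z s\<bar> \<le> D * (heat_ker (z - y) s * indicator {..T} s)" if R: "1 \<le> R" for R z s
  proof -
    have c1: "\<bar>A1 b z s * e1 R b z\<bar> \<le> \<kappa> / \<epsilon> * 6 * (norm (x - y) + 1)"
      and c2: "\<bar>e2 R b z\<bar> \<le> 30" if b: "b \<in> Basis" for b
    proof -
      have "\<bar>A1 b z s * e1 R b z\<bar> \<le> \<kappa> / \<epsilon> * 6 * (norm (x - y) + 1) \<and> \<bar>e2 R b z\<bar> \<le> 30"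
      proof (cases "norm (z - y) \<le> R")
        case False
        then have "R\<^sup>2 \<le> (norm (z - y))\<^sup>2" using R by (intro power_mono) auto
        then have "v R z = 0" using R by (simp add: v_def divide_simps)
        then show ?thesis using e \<kappa>0 by (simp add: e1_def e2_def)
      next
        case True
        have zy: "\<bar>(z - y) \<bullet> b\<bar> \<le> R" using Basis_le_norm[OF b, of "z - y"] True by linarith
        have xz: "\<bar>(x - z) \<bullet> b\<bar> \<le> (norm (x - y) + 1) * R"
        proof -
          have "\<bar>(x - z) \<bullet> b\<bar> \<le> norm (x - z)" by (rule Basis_le_norm[OF b])
          also have "\<dots> \<le> norm (x - y) + norm (z - y)"
            using norm_triangle_ineq4[of "x - y" "z - y"] by simp
          also have "\<dots> \<le> norm (x - y) * R + R"
            using True R mult_left_mono[of 1 R "norm (x - y)"] by simp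
          finally show ?thesis by (simp add: algebra_simps)
        qed
        have v2: "(v R z)\<^sup>2 \<le> 1" using v01[of R z] by (simp add: power_le_one)
        have "\<bar>A1 b z s\<bar> = A z s * \<bar>(x - z) \<bullet> b\<bar> * (1 / (2 * \<sigma> s))"
          using theta_bd(1)[of s] sp[of s] by (simp add: A1_def A_def abs_mult)
        also have "\<dots> \<le> \<kappa> * ((norm (x - y) + 1) * R) * (1 / \<epsilon>)"
          using A0[of z s] xz sp[of s] e R \<kappa>0 by (intro mult_mono) (auto simp: divide_simps)
        finally have a1: "\<bar>A1 b z s\<bar> \<le> \<kappa> * ((norm (x - y) + 1) * R) * (1 / \<epsilon>)" .
        have "\<bar>e1 R b z\<bar> = 6 * (v R z)\<^sup>2 * \<bar>(z - y) \<bullet> b\<bar> * (1 / R\<^sup>2)"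
          by (simp add: e1_def abs_mult)
        also have "\<dots> \<le> 6 * 1 * R * (1 / R\<^sup>2)"
          using v2 zy R by (intro mult_mono) auto
        finally have a2: "\<bar>e1 R b z\<bar> \<le> 6 / R" using R by (simp add: power2_eq_square)
        have "\<bar>A1 b z s * e1 R b z\<bar> \<le> (\<kappa> * ((norm (x - y) + 1) * R) * (1 / \<epsilon>)) * (6 / R)"
          unfolding abs_mult using a1 a2 \<kappa>0 e R by (intro mult_mono) auto
        also have "\<dots> = \<kappa> / \<epsilon> * 6 * (norm (x - y) + 1)" using R by simp
        finally have 1: "\<bar>A1 b z s * e1 R b z\<bar> \<le> \<kappa> / \<epsilon> * 6 * (norm (x - y) + 1)" .
        have "\<bar>24 * v R z * ((z - y) \<bullet> b) * ((z - y) \<bullet> b) / R\<^sup>2 / R\<^sup>2\<bar>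
            = 24 * v R z * \<bar>(z - y) \<bullet> b\<bar> * \<bar>(z - y) \<bullet> b\<bar> * (1 / (R\<^sup>2 * R\<^sup>2))"
          using v01[of R z] by (simp add: abs_mult)
        also have "\<dots> \<le> 24 * 1 * R * R * (1 / (R\<^sup>2 * R\<^sup>2))"
          using v01[of R z] zy R by (intro mult_mono mult_right_mono) auto
        also have "\<dots> = 24 / R\<^sup>2" using R by (simp add: power2_eq_square)
        also have "\<dots> \<le> 24" using R by (simp add: divide_le_eq)
        finally have b1: "\<bar>24 * v R z * ((z - y) \<bullet> b) * ((z - y) \<bullet> b) / R\<^sup>2 / R\<^sup>2\<bar> \<le> 24" .
        have "\<bar>6 * (v R z)\<^sup>2 * (b \<bullet> b) / R\<^sup>2\<bar> = 6 * (v R z)\<^sup>2 / R\<^sup>2" using b by simp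
        also have "\<dots> \<le> 6 * 1 / 1" using v2 R by (intro frac_le) auto
        finally have b2: "\<bar>6 * (v R z)\<^sup>2 * (b \<bullet> b) / R\<^sup>2\<bar> \<le> 6" by simp
        have "\<bar>e2 R b z\<bar> \<le> 30" unfolding e2_def using b1 b2 by linarith
        with 1 show ?thesis ..
      qed
      then show "\<bar>A1 b z s * e1 R b z\<bar> \<le> \<kappa> / \<epsilon> * 6 * (norm (x - y) + 1)" "\<bar>e2 R b z\<bar> \<le> 30" by auto
    qed
    have "\<bar>- \<theta>' s * heat_ker (x - z) (\<sigma> s) * (v R z) ^ 3\<bar> = \<bar>\<theta>' s\<bar> * heat_ker (x - z) (\<sigma> s) * (v R z) ^ 3"
      using v01[of R z] by (simp add: abs_mult)
    also have "\<dots> \<le> B * \<kappa> * 1"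
      using theta_bd(3)[of s] \<kappa>[of z s] v01[of R z] B0 \<kappa>0 by (intro mult_mono power_le_one) auto
    finally have t1: "\<bar>- \<theta>' s * heat_ker (x - z) (\<sigma> s) * (v R z) ^ 3\<bar> \<le> B * \<kappa>" by simp
    have "\<bar>\<Sum>b\<in>Basis. 2 * (A1 b z s * e1 R b z) + A z s * e2 R b z\<bar>
       \<le> (\<Sum>b\<in>(Basis::'a set). 2 * (\<kappa> / \<epsilon> * 6 * (norm (x - y) + 1)) + \<kappa> * 30)"
    proof (rule order_trans[OF sum_abs sum_mono])
      fix b :: 'a assume b: "b \<in> Basis"
      have "\<bar>A z s * e2 R b z\<bar> \<le> \<kappa> * 30"
        unfolding abs_mult using A0[of z s] c2[OF b] \<kappa>0 by (intro mult_mono) auto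
      then show "\<bar>2 * (A1 b z s * e1 R b z) + A z s * e2 R b z\<bar> \<le> 2 * (\<kappa> / \<epsilon> * 6 * (norm (x - y) + 1)) + \<kappa> * 30"
        using c1[OF b] by linarith
    qed
    then have t2: "\<bar>\<Sum>b\<in>Basis. 2 * (A1 b z s * e1 R b z) + A z s * e2 R b z\<bar>
       \<le> real DIM('a) * (2 * (\<kappa> / \<epsilon> * 6 * (norm (x - y) + 1)) + \<kappa> * 30)" by simp
    have "\<bar>W z s * A z s * (v R z) ^ 3\<bar> = W z s * A z s * (v R z) ^ 3"
      using v01[of R z] A0[of z s] W[of z s] by (simp add: abs_mult)
    also have "\<dots> \<le> M * \<kappa> * 1"
      using W[of z s] A0[of z s] v01[of R z] \<kappa>0 M0 by (intro mult_mono power_le_one) auto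
    finally have t3: "\<bar>W z s * A z s * (v R z) ^ 3\<bar> \<le> M * \<kappa>" by simp
    have "\<bar>- \<theta>' s * heat_ker (x - z) (\<sigma> s) * (v R z) ^ 3
      - (\<Sum>b\<in>Basis. 2 * (A1 b z s * e1 R b z) + A z s * e2 R b z) + W z s * A z s * (v R z) ^ 3\<bar> \<le> D"
      unfolding D_def using t1 t2 t3 by linarith
    then have "\<bar>f R z s\<bar> \<le> heat_ker (z - y) s * indicator {..T} s * D"
      unfolding f_def abs_mult using u0[of z s] u_le[of z s] by (intro mult_mono) auto
    then show ?thesis by (simp add: mult_ac)
  qed
  have lim: "(\<lambda>k. f (real (Suc k)) z s) \<longlonglongrightarrow> g z s" for z s
  proof -
    have r: "(\<lambda>k. 1 / (real (Suc k))\<^sup>2) \<longlonglongrightarrow> 0"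
      using tendsto_power[OF LIMSEQ_inverse_real_of_nat, of 2] by (simp add: power_inverse divide_inverse)
    have "(\<lambda>k. max 0 (1 - (norm (z - y))\<^sup>2 * (1 / (real (Suc k))\<^sup>2))) \<longlonglongrightarrow> max 0 (1 - (norm (z - y))\<^sup>2 * 0)"
      by (intro tendsto_intros r)
    then have v: "(\<lambda>k. v (real (Suc k)) z) \<longlonglongrightarrow> 1" by (simp add: v_def)
    have "(\<lambda>k. - 6 * (v (real (Suc k)) z)\<^sup>2 * ((z - y) \<bullet> b) * (1 / (real (Suc k))\<^sup>2)) \<longlonglongrightarrow> - 6 * 1\<^sup>2 * ((z - y) \<bullet> b) * 0" for b
      by (intro tendsto_intros r v)
    then have e1: "(\<lambda>k. e1 (real (Suc k)) b z) \<longlonglongrightarrow> 0" for b by (simp add: e1_def)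
    have "(\<lambda>k. 24 * v (real (Suc k)) z * ((z - y) \<bullet> b) * ((z - y) \<bullet> b) * (1 / (real (Suc k))\<^sup>2) * (1 / (real (Suc k))\<^sup>2)
        - 6 * (v (real (Suc k)) z)\<^sup>2 * (b \<bullet> b) * (1 / (real (Suc k))\<^sup>2))
      \<longlonglongrightarrow> 24 * 1 * ((z - y) \<bullet> b) * ((z - y) \<bullet> b) * 0 * 0 - 6 * 1\<^sup>2 * (b \<bullet> b) * 0" for b
      by (intro tendsto_intros r v)
    then have e2: "(\<lambda>k. e2 (real (Suc k)) b z) \<longlonglongrightarrow> 0" for b by (simp add: e2_def)
    have "(\<lambda>k. f (real (Suc k)) z s) \<longlonglongrightarrow> u z s * (- \<theta>' s * heat_ker (x - z) (\<sigma> s) * 1 ^ 3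
      - (\<Sum>b\<in>(Basis::'a set). 2 * (A1 b z s * 0) + A z s * 0) + W z s * A z s * 1 ^ 3)"
      unfolding f_def by (intro tendsto_intros v e1 e2)
    then show ?thesis by (simp add: g_def)
  qed
  have dct: "integrable lborel (\<lambda>p. g (fst p) (snd p))"
    "(\<lambda>k. LINT p|lborel. f (real (Suc k)) (fst p) (snd p)) \<longlonglongrightarrow> (LINT p|lborel. g (fst p) (snd p))"
  proof -
    have gm: "(\<lambda>p. g (fst p) (snd p)) \<in> borel_measurable lborel"
      unfolding g_def A_def by measurable
    have fm: "(\<lambda>p. f (real (Suc k)) (fst p) (snd p)) \<in> borel_measurable lborel" for k
      unfolding f_def A_def A1_def e1_def e2_def v_def by measurable
    have int: "integrable lborel (\<lambda>p. D * (heat_ker (fst p - y) (snd p) * indicator {..T} (snd p)))"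
      using integrable_heat_ker_until[of y 0 T] by (intro integrable_mult_right) simp
    have l: "AE p in lborel. (\<lambda>k. f (real (Suc k)) (fst p) (snd p)) \<longlonglongrightarrow> g (fst p) (snd p)"
      by (intro AE_I2 lim)
    have b: "AE p in lborel. norm (f (real (Suc k)) (fst p) (snd p)) \<le> D * (heat_ker (fst p - y) (snd p) * indicator {..T} (snd p))" for k
      using f_bd[of "real (Suc k)"] by simp
    show "integrable lborel (\<lambda>p. g (fst p) (snd p))"
      by (rule integrable_dominated_convergence[OF gm fm int l b])
    show "(\<lambda>k. LINT p|lborel. f (real (Suc k)) (fst p) (snd p)) \<longlonglongrightarrow> (LINT p|lborel. g (fst p) (snd p))"
      by (rule integral_dominated_convergence[OF gm fm int l b])
  qed
  have lint: "(LINT p|lborel. g (fst p) (snd p)) = \<theta> 0 * heat_ker (x - y) (t + \<epsilon>)"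
    using dct(2) id by (simp add: LIMSEQ_const_iff)
  have g0: "0 \<le> g z s" for z s
  proof (cases "0 < s")
    case True
    have "\<theta>' s * heat_ker (x - z) (\<sigma> s) \<le> 0"
      using theta_dec[OF True] by (intro mult_nonpos_nonneg) auto
    moreover have "0 \<le> W z s * A z s" using W[of z s] A0[of z s] by simp
    ultimately show ?thesis using u0[of z s] by (simp add: g_def)
  qed (simp add: g_def u_early)
  have "(\<integral>\<^sup>+s. \<integral>\<^sup>+z. ennreal (on_Q T w z s * heat_ker (x - z) (\<sigma> s)) * ennreal (- \<theta>' s + W z s * \<theta> s) \<partial>lborel \<partial>lborel)
     = (\<integral>\<^sup>+s. \<integral>\<^sup>+z. ennreal (g z s) \<partial>lborel \<partial>lborel)"
  proof (intro nn_integral_cong)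
    fix s z
    have "g z s = (u z s * heat_ker (x - z) (\<sigma> s)) * (- \<theta>' s + W z s * \<theta> s)"
      by (simp add: g_def A_def algebra_simps)
    then show "ennreal (on_Q T w z s * heat_ker (x - z) (\<sigma> s)) * ennreal (- \<theta>' s + W z s * \<theta> s) = ennreal (g z s)"
      using u0[of z s] by (simp add: u_def ennreal_mult')
  qed
  also have "\<dots> = (\<integral>\<^sup>+p. ennreal (g (fst p) (snd p)) \<partial>lborel)"
    by (subst nn_integral_space_time) (simp_all add: g_def A_def)
  also have "\<dots> = ennreal (LINT p|lborel. g (fst p) (snd p))"
    using dct(1) g0 by (intro nn_integral_eq_integral) auto
  finally show ?thesis unfolding lint .
qed

lemma heat_ker_compare:
  fixes x :: "'a::euclidean_space"
  assumes "0 < s" "s \<le> t" "t \<le> 2 * s"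
  shows "heat_ker x s \<le> 2 powr (real DIM('a) / 2) * heat_ker x t"
proof -
  define p where "p = - (real DIM('a) / 2)"
  have "(4 * pi * s) powr p \<le> (4 * pi * (t / 2)) powr p"
    using assms by (intro powr_mono2') (auto simp: p_def)
  also have "\<dots> = (4 * pi * t * (1 / 2)) powr p" by simp
  also have "\<dots> = (4 * pi * t) powr p * (1 / 2) powr p" by (rule powr_mult)
  also have "(1 / 2) powr p = 2 powr (real DIM('a) / 2)" by (simp add: p_def powr_minus powr_divide)
  finally have 1: "(4 * pi * s) powr p \<le> (4 * pi * t) powr p * 2 powr (real DIM('a) / 2)" .
  have 2: "exp (- (norm x)\<^sup>2 / (4 * s)) \<le> exp (- (norm x)\<^sup>2 / (4 * t))"
    using assms by (auto intro!: divide_left_mono)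
  show ?thesis
    using assms mult_mono[OF 1 2] by (simp add: heat_ker_eq p_def mult_ac)
qed

text \<open>
  The time cut-offs drop from 1 to 0 on shrinking intervals that end at \<open>t\<close>. Their derivatives
  concentrate at \<open>t\<close> and produce the first term. The delay \<open>\<epsilon>\<close> keeps the kernel away from its singularity.
\<close>

lemma duhamel_delayed:
  fixes w W :: "'a::euclidean_space \<Rightarrow> real \<Rightarrow> real"
  assumes Wm: "(\<lambda>(x, t). W x t) \<in> borel_measurable borel"
    and W: "\<And>x t. 0 \<le> W x t \<and> W x t \<le> M"
    and sol: "dirac_solution T W y w"
    and t: "0 < t" "t < T" and e: "0 < \<epsilon>"
  shows "(\<integral>\<^sup>+z. ennreal (w z t * heat_ker (x - z) \<epsilon>) \<partial>lborel)
      + heat_potential 0 (\<lambda>z s. ennreal (W z s * on_Q T w z s) * indicator {..<t} s) x (t + \<epsilon>)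
    = ennreal (heat_ker (x - y) (t + \<epsilon>))"
proof -
  define u where "u = on_Q T w"
  have cont: "continuous_on (Q_dom T) (\<lambda>(x, t). w x t)"
    and w: "\<And>x t. 0 < t \<Longrightarrow> t \<le> T \<Longrightarrow> 0 \<le> w x t \<and> w x t \<le> gauss_kernel (x - y) t"
    using sol unfolding dirac_solution_def by auto
  have um: "(\<lambda>(x, t). u x t) \<in> borel_measurable borel"
    unfolding u_def by (rule on_Q_measurable[OF cont])
  note [measurable (raw)] = measurable_curried[OF Wm] measurable_curried[OF um]
  have u0: "0 \<le> u z s" for z s using w[of s z] by (simp add: u_def on_Q_def)
  have u_le: "u z s \<le> heat_ker (z - y) s * indicator {..T} s" for z s
    using w[of s z] by (auto simp: u_def on_Q_def heat_ker_def indicator_def)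
  have u_le': "u z s \<le> heat_ker (z - y) s" for z s
    using u_le[of z s] heat_ker_nonneg[of "z - y" s] by (cases "s \<le> T") (simp_all del: heat_ker_nonneg)
  have u_early: "u z s = 0" if "s \<le> 0" for z s using that by (simp add: u_def on_Q_def)
  have M0: "0 \<le> M" using W[of 0 0] by linarith
  define \<sigma> where "\<sigma> = (\<lambda>s. max (t + \<epsilon> - s) (\<epsilon> / 2))"
  have sp: "\<epsilon> / 2 \<le> \<sigma> s" "0 < \<sigma> s" for s using e by (auto simp: \<sigma>_def)
  have s_eq: "\<sigma> s = t + \<epsilon> - s" if "s \<le> t" for s using that e by (simp add: \<sigma>_def)
  define \<kappa> where "\<kappa> = (4 * pi * (\<epsilon> / 2)) powr (- (real DIM('a) / 2))"
  have \<kappa>: "heat_ker (x - z) (\<sigma> s) \<le> \<kappa>" for z s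
    unfolding \<kappa>_def using sp[of s] e by (intro heat_ker_le_of_time_ge) auto
  have \<kappa>0: "0 \<le> \<kappa>" by (simp add: \<kappa>_def)
  have [measurable]: "\<sigma> \<in> borel_measurable borel" unfolding \<sigma>_def by measurable
  have [measurable]: "step_fun \<in> borel_measurable borel" "hat_fun \<in> borel_measurable borel"
    unfolding step_fun_def hat_fun_def by measurable
  \<comment> \<open>The offset 2 keeps the cut-off interval inside the second half of \<open>(0, t]\<close>, where the Gaussians are comparable.\<close>
  define h where "h = (\<lambda>k. t / real (k + 2))"
  have h: "0 < h k" "h k \<le> t / 2" for k using t by (auto simp: h_def divide_simps)
  have h_lim: "h \<longlonglongrightarrow> 0"
    unfolding h_def using LIMSEQ_ignore_initial_segment[OF lim_const_over_n[of t], of 2] .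
  \<comment> \<open>The second factor is 1 for \<open>s \<ge> 0\<close>; it bounds the support from below.\<close>
  define \<theta> where "\<theta> = (\<lambda>k s. step_fun ((t - s) / h k) * step_fun (s + 1))"
  define \<theta>' where "\<theta>' = (\<lambda>k s. - hat_fun ((t - s) / h k) / h k * step_fun (s + 1) + step_fun ((t - s) / h k) * hat_fun (s + 1))"
  define E where "E = (\<lambda>s. \<integral>\<^sup>+z. ennreal (u z s * heat_ker (x - z) (\<sigma> s)) \<partial>lborel)"
  have [measurable]: "E \<in> borel_measurable borel" unfolding E_def by measurable
  have E_le: "E s \<le> ennreal \<kappa>" for s
  proof (cases "0 < s")
    case True
    have "E s \<le> (\<integral>\<^sup>+z. ennreal \<kappa> * ennreal (heat_ker (z - y) s) \<partial>lborel)"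
      unfolding E_def
    proof (rule nn_integral_mono)
      fix z
      have "u z s * heat_ker (x - z) (\<sigma> s) \<le> heat_ker (z - y) s * \<kappa>"
        using u0[of z s] u_le'[of z s] \<kappa>[of z s] by (intro mult_mono) auto
      then show "ennreal (u z s * heat_ker (x - z) (\<sigma> s)) \<le> ennreal \<kappa> * ennreal (heat_ker (z - y) s)"
        using \<kappa>0 by (simp add: mult.commute ennreal_leI flip: ennreal_mult)
    qed
    then show ?thesis using True by (simp add: nn_integral_cmult nn_integral_heat_ker_shift)
  qed (simp add: E_def u_early)
  have E_lim: "(\<lambda>k. E (s k)) \<longlonglongrightarrow> E t" if s: "s \<longlonglongrightarrow> t" "\<And>k. t / 2 \<le> s k" "\<And>k. s k \<le> t" for s
    unfolding E_def
  proof (rule nn_integral_dominated_convergence[where w = "\<lambda>z. ennreal (\<kappa> * 2 powr (real DIM('a) / 2)) * ennreal (heat_ker (z - y) t)"])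
    show "(\<integral>\<^sup>+ z. ennreal (\<kappa> * 2 powr (real DIM('a) / 2)) * ennreal (heat_ker (z - y) t) \<partial>lborel) < \<infinity>"
      using t by (simp add: nn_integral_cmult nn_integral_heat_ker_shift)
    show "AE z in lborel. ennreal (u z (s k) * heat_ker (x - z) (\<sigma> (s k)))
        \<le> ennreal (\<kappa> * 2 powr (real DIM('a) / 2)) * ennreal (heat_ker (z - y) t)" for k
    proof (rule AE_I2)
      fix z
      have sk: "0 < s k" using s(2)[of k] t by linarith
      have "u z (s k) \<le> heat_ker (z - y) (s k)" by (rule u_le')
      also have "\<dots> \<le> 2 powr (real DIM('a) / 2) * heat_ker (z - y) t"
        using s(2,3)[of k] sk by (intro heat_ker_compare) auto
      finally have "u z (s k) * heat_ker (x - z) (\<sigma> (s k)) \<le> (2 powr (real DIM('a) / 2) * heat_ker (z - y) t) * \<kappa>"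
        using \<kappa> \<kappa>0 by (intro mult_mono) auto
      then show "ennreal (u z (s k) * heat_ker (x - z) (\<sigma> (s k)))
        \<le> ennreal (\<kappa> * 2 powr (real DIM('a) / 2)) * ennreal (heat_ker (z - y) t)"
        using \<kappa>0 by (simp add: mult_ac ennreal_leI flip: ennreal_mult)
    qed
    show "AE z in lborel. (\<lambda>k. ennreal (u z (s k) * heat_ker (x - z) (\<sigma> (s k)))) \<longlonglongrightarrow> ennreal (u z t * heat_ker (x - z) (\<sigma> t))"
    proof (rule AE_I2)
      fix z :: 'a
      have in_Q: "(z, s k) \<in> Q_dom T" for k using s(2,3)[of k] t by (auto simp: Q_dom_def)
      have "(\<lambda>k. (\<lambda>(x, t). w x t) (z, s k)) \<longlonglongrightarrow> (\<lambda>(x, t). w x t) (z, t)"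
        by (rule continuous_on_tendsto_compose[OF cont])
           (use in_Q t in \<open>auto intro!: tendsto_intros s(1) simp: Q_dom_def\<close>)
      moreover have "u z (s k) = w z (s k)" for k using in_Q[of k] by (auto simp: u_def on_Q_def Q_dom_def)
      moreover have "u z t = w z t" using t by (auto simp: u_def on_Q_def)
      ultimately have 1: "(\<lambda>k. u z (s k)) \<longlonglongrightarrow> u z t" by simp
      have 2: "(\<lambda>k. heat_ker (x - z) (\<sigma> (s k))) \<longlonglongrightarrow> heat_ker (x - z) (\<sigma> t)"
        by (rule tendsto_heat_ker[OF tendsto_const _ sp(2)]) (unfold \<sigma>_def, intro tendsto_intros s(1))
      show "(\<lambda>k. ennreal (u z (s k) * heat_ker (x - z) (\<sigma> (s k)))) \<longlonglongrightarrow> ennreal (u z t * heat_ker (x - z) (\<sigma> t))"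
        by (intro tendsto_ennrealI tendsto_mult 1 2)
    qed
  qed measurable
  define I where "I = (\<lambda>k. \<integral>\<^sup>+v. ennreal (hat_fun v) * E (t + - h k * v) \<partial>lborel)"
  define J where "J = (\<lambda>k. \<integral>\<^sup>+s. \<integral>\<^sup>+z. ennreal (u z s * heat_ker (x - z) (\<sigma> s) * (W z s * \<theta> k s)) \<partial>lborel \<partial>lborel)"
  have th01: "0 \<le> \<theta> k s" "\<theta> k s \<le> 1" for k s
    using step_fun_bounds mult_le_one[OF step_fun_bounds(2) step_fun_bounds(1) step_fun_bounds(2)]
    by (auto simp: \<theta>_def)
  have IJ: "I k + J k = ennreal (heat_ker (x - y) (t + \<epsilon>))" for k
  proof -
    have hk: "0 < h k" "h k \<le> t" using h[of k] t by auto
    have d: "(\<theta> k has_real_derivative \<theta>' k s) (at s)" for s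
    proof -
      have "((\<lambda>s. (t - s) / h k) has_real_derivative - 1 / h k) (at s)"
        by (rule DERIV_cdivide) (auto intro!: derivative_eq_intros)
      from DERIV_chain2[where f = step_fun and g = "\<lambda>s. (t - s) / h k", OF DERIV_step_fun this]
      have 1: "((\<lambda>s. step_fun ((t - s) / h k)) has_real_derivative hat_fun ((t - s) / h k) * (- 1 / h k)) (at s)" .
      have "((\<lambda>s. s + 1) has_real_derivative 1) (at s)" by (auto intro!: derivative_eq_intros)
      from DERIV_chain2[where f = step_fun and g = "\<lambda>s. s + 1", OF DERIV_step_fun this]
      have 2: "((\<lambda>s. step_fun (s + 1)) has_real_derivative hat_fun (s + 1) * 1) (at s)" .
      show ?thesis using DERIV_mult[OF 1 2] unfolding \<theta>_def \<theta>'_def by (simp add: mult_ac)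
    qed
    have dc: "continuous_on UNIV (\<theta>' k)"
      unfolding \<theta>'_def using hk by (intro continuous_intros) auto
    have late: "\<theta> k s = 0" if "t \<le> s" for s using that hk by (simp add: \<theta>_def step_fun_simps divide_nonpos_pos)
    have early: "\<theta> k s = 0" if "s \<le> - 1" for s using that by (simp add: \<theta>_def step_fun_simps)
    have db: "\<bar>\<theta>' k s\<bar> \<le> 2 / h k * 1 + 1 * 2" for s
    proof -
      have "\<bar>- hat_fun ((t - s) / h k) / h k * step_fun (s + 1)\<bar> = hat_fun ((t - s) / h k) / h k * step_fun (s + 1)"
        using hk hat_fun_bounds(1) step_fun_bounds(1) by (simp add: abs_mult)
      also have "\<dots> \<le> 2 / h k * 1"
        using hk hat_fun_bounds step_fun_bounds by (intro mult_mono divide_right_mono) auto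
      finally have 1: "\<bar>- hat_fun ((t - s) / h k) / h k * step_fun (s + 1)\<bar> \<le> 2 / h k * 1" .
      have "\<bar>step_fun ((t - s) / h k) * hat_fun (s + 1)\<bar> = step_fun ((t - s) / h k) * hat_fun (s + 1)"
        using hat_fun_bounds(1) step_fun_bounds(1) by (simp add: abs_mult)
      also have "\<dots> \<le> 1 * 2"
        using hat_fun_bounds step_fun_bounds by (intro mult_mono) auto
      finally have 2: "\<bar>step_fun ((t - s) / h k) * hat_fun (s + 1)\<bar> \<le> 1 * 2" .
      show ?thesis unfolding \<theta>'_def using 1 2 by linarith
    qed
    have pos: "- \<theta>' k s = hat_fun ((t - s) / h k) / h k" if "0 < s" for s
      using that by (simp add: \<theta>'_def step_fun_simps)
    have dec: "\<theta>' k s \<le> 0" if "0 < s" for s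
      using pos[OF that] hk hat_fun_bounds(1)[of "(t - s) / h k"] divide_nonneg_pos[of "hat_fun ((t - s) / h k)" "h k"] by linarith
    have "ennreal (\<theta> k 0 * heat_ker (x - y) (t + \<epsilon>))
      = (\<integral>\<^sup>+s. \<integral>\<^sup>+z. ennreal (on_Q T w z s * heat_ker (x - z) (\<sigma> s)) * ennreal (- \<theta>' k s + W z s * \<theta> k s) \<partial>lborel \<partial>lborel)"
      by (rule weak_identity_without_space_cutoff[OF Wm W sol t e d dc late early th01 db dec \<sigma>_def, symmetric])
    also have "\<dots> = (\<integral>\<^sup>+s. \<integral>\<^sup>+z. (ennreal (u z s * heat_ker (x - z) (\<sigma> s)) * ennreal (hat_fun ((t - s) / h k) / h k)
        + ennreal (u z s * heat_ker (x - z) (\<sigma> s) * (W z s * \<theta> k s))) \<partial>lborel \<partial>lborel)"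
    proof (intro nn_integral_cong)
      fix s z
      show "ennreal (on_Q T w z s * heat_ker (x - z) (\<sigma> s)) * ennreal (- \<theta>' k s + W z s * \<theta> k s)
        = ennreal (u z s * heat_ker (x - z) (\<sigma> s)) * ennreal (hat_fun ((t - s) / h k) / h k)
        + ennreal (u z s * heat_ker (x - z) (\<sigma> s) * (W z s * \<theta> k s))"
      proof (cases "0 < s")
        case True
        have "0 \<le> hat_fun ((t - s) / h k) / h k" using hk hat_fun_bounds(1) by simp
        then show ?thesis
          unfolding pos[OF True] u_def[symmetric] using u0[of z s] W[of z s] th01(1)[of k s]
          by (simp add: ennreal_plus ennreal_mult distrib_left)
      qed (simp add: u_early u_def[symmetric])
    qed
    also have "\<dots> = (\<integral>\<^sup>+s. (E s * ennreal (hat_fun ((t - s) / h k) / h k)) \<partial>lborel) + J k"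
      unfolding E_def J_def \<theta>_def by (simp add: nn_integral_add nn_integral_multc)
    also have "(\<integral>\<^sup>+s. (E s * ennreal (hat_fun ((t - s) / h k) / h k)) \<partial>lborel)
       = ennreal \<bar>- h k\<bar> * (\<integral>\<^sup>+v. E (t + - h k * v) * ennreal (hat_fun ((t - (t + - h k * v)) / h k) / h k) \<partial>lborel)"
      using hk by (intro nn_integral_real_affine) auto
    also have "\<dots> = (\<integral>\<^sup>+v. ennreal (h k) * (E (t + - h k * v) * ennreal (hat_fun v / h k)) \<partial>lborel)"
      using hk by (simp add: nn_integral_cmult)
    also have "\<dots> = I k"
      unfolding I_def
    proof (intro nn_integral_cong)
      fix v
      have "ennreal (h k) * ennreal (hat_fun v / h k) = ennreal (hat_fun v)"
        using hk hat_fun_bounds(1)[of v] by (simp flip: ennreal_mult)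
      then show "ennreal (h k) * (E (t + - h k * v) * ennreal (hat_fun v / h k)) = ennreal (hat_fun v) * E (t + - h k * v)"
        by (metis (no_types, opaque_lifting) mult.commute mult.left_commute)
    qed
    also have "\<theta> k 0 = 1" using hk by (simp add: \<theta>_def step_fun_simps)
    finally show ?thesis by simp
  qed
  have I_lim: "I \<longlonglongrightarrow> E t"
  proof -
    have "I \<longlonglongrightarrow> (\<integral>\<^sup>+v. ennreal (hat_fun v) * E t \<partial>lborel)"
      unfolding I_def
    proof (rule nn_integral_dominated_convergence[where w = "\<lambda>v. ennreal \<kappa> * ennreal (hat_fun v)"])
      have hat: "(\<integral>\<^sup>+v. ennreal (hat_fun v) \<partial>lborel) = 1"
        using hat_fun_integral hat_fun_bounds(1)
        by (subst nn_integral_eq_integral) (auto simp: has_bochner_integral_iff)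
      then show "(\<integral>\<^sup>+ v. ennreal \<kappa> * ennreal (hat_fun v) \<partial>lborel) < \<infinity>"
        by (simp add: nn_integral_cmult)
      show "AE v in lborel. ennreal (hat_fun v) * E (t + - h k * v) \<le> ennreal \<kappa> * ennreal (hat_fun v)" for k
        using E_le by (auto intro!: mult_right_mono simp: mult.commute[of "ennreal (hat_fun _)"])
      show "AE v in lborel. (\<lambda>k. ennreal (hat_fun v) * E (t + - h k * v)) \<longlonglongrightarrow> ennreal (hat_fun v) * E t"
      proof (rule AE_I2)
        fix v
        show "(\<lambda>k. ennreal (hat_fun v) * E (t + - h k * v)) \<longlonglongrightarrow> ennreal (hat_fun v) * E t"
        proof (cases "0 \<le> v \<and> v \<le> 1")
          case True
          have "(\<lambda>k. t + - h k * v) \<longlonglongrightarrow> t + - 0 * v" by (intro tendsto_intros h_lim)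
          moreover have "t / 2 \<le> t + - h k * v" for k
            using h[of k] True mult_mono[of "h k" "t / 2" v 1] t by simp
          moreover have "t + - h k * v \<le> t" for k using h(1)[of k] True by simp
          ultimately have "(\<lambda>k. E (t + - h k * v)) \<longlonglongrightarrow> E t" by (intro E_lim) auto
          then show ?thesis by (intro ennreal_tendsto_cmult) auto
        next
          case False
          then have "hat_fun v = 0" using step_fun_simps(3,4)[of v] by linarith
          then show ?thesis by simp
        qed
      qed
    qed measurable
    also have "(\<integral>\<^sup>+v. ennreal (hat_fun v) * E t \<partial>lborel) = E t"
    proof -
      have "(\<integral>\<^sup>+v. ennreal (hat_fun v) \<partial>lborel) = 1"
        using hat_fun_integral hat_fun_bounds(1)
        by (subst nn_integral_eq_integral) (auto simp: has_bochner_integral_iff)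
      then show ?thesis by (simp add: nn_integral_multc)
    qed
    finally show ?thesis .
  qed
  define P where "P = (\<integral>\<^sup>+s. \<integral>\<^sup>+z. ennreal (u z s * heat_ker (x - z) (\<sigma> s) * (W z s * indicator {..<t} s)) \<partial>lborel \<partial>lborel)"
  have J_lim: "J \<longlonglongrightarrow> P"
  proof -
    have J': "J k = (\<integral>\<^sup>+p. ennreal (u (fst p) (snd p) * heat_ker (x - fst p) (\<sigma> (snd p)) * (W (fst p) (snd p) * \<theta> k (snd p))) \<partial>lborel)" for k
      unfolding J_def \<theta>_def by (subst nn_integral_space_time) simp_all
    have P': "P = (\<integral>\<^sup>+p. ennreal (u (fst p) (snd p) * heat_ker (x - fst p) (\<sigma> (snd p)) * (W (fst p) (snd p) * indicator {..<t} (snd p))) \<partial>lborel)"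
      unfolding P_def by (subst nn_integral_space_time) simp_all
    show ?thesis
      unfolding J' P'
    proof (rule nn_integral_dominated_convergence[where w = "\<lambda>p. ennreal (\<kappa> * M) * ennreal (heat_ker (fst p - y) (snd p) * indicator {..T} (snd p))"])
      have "(\<integral>\<^sup>+p. ennreal (heat_ker (fst p - y) (snd p) * indicator {..T} (snd p)) \<partial>lborel) < \<infinity>"
        using integrable_heat_ker_until[of y 0 T] by (simp add: integrable_iff_bounded)
      then show "(\<integral>\<^sup>+p. ennreal (\<kappa> * M) * ennreal (heat_ker (fst p - y) (snd p) * indicator {..T} (snd p)) \<partial>lborel) < \<infinity>"
        by (simp add: nn_integral_cmult ennreal_mult_less_top)
      show "AE p in lborel. ennreal (u (fst p) (snd p) * heat_ker (x - fst p) (\<sigma> (snd p)) * (W (fst p) (snd p) * \<theta> k (snd p)))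
         \<le> ennreal (\<kappa> * M) * ennreal (heat_ker (fst p - y) (snd p) * indicator {..T} (snd p))" for k
      proof (rule AE_I2)
        fix p :: "'a \<times> real"
        have "u (fst p) (snd p) * heat_ker (x - fst p) (\<sigma> (snd p)) * (W (fst p) (snd p) * \<theta> k (snd p))
          \<le> heat_ker (fst p - y) (snd p) * indicator {..T} (snd p) * \<kappa> * (M * 1)"
          using u0 u_le \<kappa> W th01 \<kappa>0 M0 by (intro mult_mono) (auto intro!: mult_nonneg_nonneg)
        then show "ennreal (u (fst p) (snd p) * heat_ker (x - fst p) (\<sigma> (snd p)) * (W (fst p) (snd p) * \<theta> k (snd p)))
         \<le> ennreal (\<kappa> * M) * ennreal (heat_ker (fst p - y) (snd p) * indicator {..T} (snd p))"
          using \<kappa>0 M0 by (simp add: mult_ac ennreal_leI flip: ennreal_mult)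
      qed
      show "AE p in lborel. (\<lambda>k. ennreal (u (fst p) (snd p) * heat_ker (x - fst p) (\<sigma> (snd p)) * (W (fst p) (snd p) * \<theta> k (snd p))))
        \<longlonglongrightarrow> ennreal (u (fst p) (snd p) * heat_ker (x - fst p) (\<sigma> (snd p)) * (W (fst p) (snd p) * indicator {..<t} (snd p)))"
      proof (rule AE_I2)
        fix p :: "'a \<times> real"
        obtain z s where p: "p = (z, s)" by (cases p)
        consider "s \<le> 0" | "0 < s" "s < t" | "t \<le> s" by linarith
        then show "(\<lambda>k. ennreal (u (fst p) (snd p) * heat_ker (x - fst p) (\<sigma> (snd p)) * (W (fst p) (snd p) * \<theta> k (snd p))))
          \<longlonglongrightarrow> ennreal (u (fst p) (snd p) * heat_ker (x - fst p) (\<sigma> (snd p)) * (W (fst p) (snd p) * indicator {..<t} (snd p)))"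
        proof cases
          case 1
          then show ?thesis by (simp add: p u_early)
        next
          case 2
          have "eventually (\<lambda>k. h k < t - s) sequentially"
            by (rule order_tendstoD(2)[OF h_lim]) (use 2 in simp)
          then have "eventually (\<lambda>k. \<theta> k s = 1) sequentially"
          proof eventually_elim
            case (elim k)
            then have "1 \<le> (t - s) / h k" using h(1)[of k] by simp
            then show ?case using 2 by (simp add: \<theta>_def step_fun_simps)
          qed
          then have "(\<lambda>k. \<theta> k s) \<longlonglongrightarrow> 1" by (rule tendsto_eventually)
          then show ?thesis using 2 by (simp add: p) (intro tendsto_intros tendsto_ennrealI, auto intro!: tendsto_eq_intros)
        next
          case 3
          then have "\<theta> k s = 0" for k using h(1)[of k] by (simp add: \<theta>_def step_fun_simps divide_nonpos_pos)
          then show ?thesis using 3 by (simp add: p)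
        qed
      qed
    qed (simp_all add: \<theta>_def)
  qed
  have "E t + P = ennreal (heat_ker (x - y) (t + \<epsilon>))"
    using LIMSEQ_unique[OF tendsto_add[OF I_lim J_lim]] by (simp add: IJ)
  moreover have "E t = (\<integral>\<^sup>+z. ennreal (w z t * heat_ker (x - z) \<epsilon>) \<partial>lborel)"
    unfolding E_def using t by (simp add: s_eq u_def on_Q_def)
  moreover have "P = heat_potential 0 (\<lambda>z s. ennreal (W z s * on_Q T w z s) * indicator {..<t} s) x (t + \<epsilon>)"
    unfolding P_def heat_potential_def damped_ker_zero
  proof (intro nn_integral_cong)
    fix s z
    show "ennreal (u z s * heat_ker (x - z) (\<sigma> s) * (W z s * indicator {..<t} s))
      = ennreal (heat_ker (x - z) (t + \<epsilon> - s)) * (ennreal (W z s * on_Q T w z s) * indicator {..<t} s)"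
      using u0[of z s] W[of z s] by (cases "s < t") (auto simp: s_eq u_def[symmetric] mult_ac simp flip: ennreal_mult)
  qed
  ultimately show ?thesis by simp
qed

text \<open>
  Letting the delay tend to 0 in \<open>duhamel_delayed\<close>. The final time \<open>T\<close> is reached by continuity only, since test
  functions vanish near it.
\<close>

theorem dirac_solution_duhamel:
  fixes w W :: "'a::euclidean_space \<Rightarrow> real \<Rightarrow> real"
  assumes Wm: "(\<lambda>(x, t). W x t) \<in> borel_measurable borel"
    and W: "\<And>x t. 0 \<le> W x t \<and> W x t \<le> M"
    and sol: "dirac_solution T W y w"
    and t: "0 < t" "t \<le> T"
  shows "ennreal (w x t) + heat_potential 0 (\<lambda>z s. ennreal (W z s * on_Q T w z s)) x t = ennreal (heat_ker (x - y) t)"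
proof -
  define q where "q = (\<lambda>z s. ennreal (W z s * on_Q T w z s))"
  have cont: "continuous_on (Q_dom T) (\<lambda>(x, t). w x t)"
    and w: "\<And>x t. 0 < t \<Longrightarrow> t \<le> T \<Longrightarrow> 0 \<le> w x t \<and> w x t \<le> gauss_kernel (x - y) t"
    using sol unfolding dirac_solution_def by auto
  note [measurable (raw)] = measurable_curried[OF Wm] measurable_curried[OF on_Q_measurable[OF cont]]
  have M0: "0 \<le> M" using W[of 0 0] by linarith
  have q_le: "q z s \<le> ennreal (M * heat_ker (z - y) s)" for z s
    unfolding q_def on_Q_def using w[of s z] W[of z s] M0
    by (auto simp: heat_ker_def intro!: ennreal_leI mult_mono)
  have w_seq: "(\<lambda>k. w (X k) (R k)) \<longlonglongrightarrow> w x r"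
    if "X \<longlonglongrightarrow> x" "R \<longlonglongrightarrow> r" "\<And>k. 0 < R k" "\<And>k. R k \<le> T" "0 < r" "r \<le> T" for X R x r
  proof -
    have "(\<lambda>k. (\<lambda>(x, t). w x t) (X k, R k)) \<longlonglongrightarrow> (\<lambda>(x, t). w x t) (x, r)"
      by (rule continuous_on_tendsto_compose[OF cont])
         (use that in \<open>auto intro!: tendsto_intros simp: Q_dom_def\<close>)
    then show ?thesis by simp
  qed
  have less: "ennreal (w x t) + heat_potential 0 q x t = ennreal (heat_ker (x - y) t)" if t: "0 < t" "t < T" for t
  proof -
    define e where "e = (\<lambda>k. inverse (real (Suc k)))"
    have e: "0 < e k" for k by (simp add: e_def)
    have e_lim: "e \<longlonglongrightarrow> 0" unfolding e_def by (rule LIMSEQ_inverse_real_of_nat)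
    define qt where "qt = (\<lambda>z s. q z s * indicator {..<t} s)"
    define B where "B = (4 * pi * t) powr (- (real DIM('a) / 2))"
    have wB: "0 \<le> w z t" "w z t \<le> B" for z
      using w[of t z] t heat_ker_le[of t "z - y"] by (auto simp: B_def heat_ker_def)
    have "(\<lambda>z. on_Q T w z t) \<in> borel_measurable borel" by measurable
    then have [measurable]: "(\<lambda>z. w z t) \<in> borel_measurable borel" using t by (simp add: on_Q_def)
    have B0: "0 \<le> B" by (simp add: B_def)
    have int: "integrable lborel (\<lambda>z. heat_ker (z - x) (e k) * w z t)" for k
    proof (rule Bochner_Integration.integrable_bound[where f = "\<lambda>z. B * heat_ker (z - x) (e k)"])
      have "integrable lborel (\<lambda>z. heat_ker (z - x) (e k))"
        using e by (intro integrableI_nonneg) (auto simp: nn_integral_heat_ker_shift)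
      then show "integrable lborel (\<lambda>z. B * heat_ker (z - x) (e k))" by (rule integrable_mult_right)
      show "AE z in lborel. norm (heat_ker (z - x) (e k) * w z t) \<le> norm (B * heat_ker (z - x) (e k))"
      proof (rule AE_I2)
        fix z
        have "heat_ker (z - x) (e k) * w z t \<le> heat_ker (z - x) (e k) * B"
          using wB by (intro mult_left_mono) auto
        then show "norm (heat_ker (z - x) (e k) * w z t) \<le> norm (B * heat_ker (z - x) (e k))"
          using wB B0 by (simp add: abs_mult mult.commute)
      qed
    qed measurable
    have "(\<lambda>k. LINT z|lborel. heat_ker (z - x) (e k) * w z t) \<longlonglongrightarrow> w x t"
    proof (rule heat_ker_approximate_identity[where B = B])
      fix u
      have "(\<lambda>k. x + sqrt (e k) *\<^sub>R u) \<longlonglongrightarrow> x + sqrt 0 *\<^sub>R u"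
        by (intro tendsto_intros e_lim)
      then show "(\<lambda>k. w (x + sqrt (e k) *\<^sub>R u) t) \<longlonglongrightarrow> w x t"
        using t by (intro w_seq) auto
    qed (use wB e in \<open>auto simp: abs_of_nonneg\<close>)
    moreover have "(\<integral>\<^sup>+z. ennreal (w z t * heat_ker (x - z) (e k)) \<partial>lborel) = ennreal (LINT z|lborel. heat_ker (z - x) (e k) * w z t)" for k
      using int[of k] wB by (subst nn_integral_eq_integral[symmetric]) (auto simp: heat_ker_minus[of x] mult.commute)
    ultimately have 1: "(\<lambda>k. \<integral>\<^sup>+z. ennreal (w z t * heat_ker (x - z) (e k)) \<partial>lborel) \<longlonglongrightarrow> ennreal (w x t)"
      by (simp add: tendsto_ennrealI)
    have te: "(\<lambda>k. t + e k) \<longlonglongrightarrow> t" using tendsto_add[OF tendsto_const e_lim] by simp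
    have 2: "(\<lambda>k. heat_potential 0 qt x (t + e k)) \<longlonglongrightarrow> heat_potential 0 qt x t"
    proof (rule heat_potential_tendsto[OF _ _ M0 order_refl t(1) tendsto_const te])
      show "(\<lambda>(z, s). qt z s) \<in> borel_measurable borel" unfolding qt_def q_def split_beta by measurable
      show "qt z s \<le> ennreal (M * heat_ker (z - y) s)" for z s
        using q_le[of z s] by (cases "s < t") (auto simp: qt_def)
    qed
    have 3: "(\<lambda>k. ennreal (heat_ker (x - y) (t + e k))) \<longlonglongrightarrow> ennreal (heat_ker (x - y) t)"
      by (intro tendsto_ennrealI tendsto_heat_ker tendsto_const te t)
    have "(\<integral>\<^sup>+z. ennreal (w z t * heat_ker (x - z) (e k)) \<partial>lborel) + heat_potential 0 qt x (t + e k) = ennreal (heat_ker (x - y) (t + e k))" for k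
      unfolding qt_def q_def by (rule duhamel_delayed[OF Wm W sol t e])
    then have "ennreal (w x t) + heat_potential 0 qt x t = ennreal (heat_ker (x - y) t)"
      using LIMSEQ_unique[OF tendsto_add[OF 1 2]] 3 by simp
    also have "heat_potential 0 qt x t = heat_potential 0 q x t"
      unfolding heat_potential_def qt_def by (intro nn_integral_cong) (auto simp: indicator_def)
    finally show ?thesis .
  qed
  show ?thesis
  proof (cases "t < T")
    case True
    then show ?thesis using less[OF t(1)] by (simp add: q_def)
  next
    case False
    with t have tT: "t = T" by simp
    define r where "r = (\<lambda>k. T - T / real (k + 2))"
    have r: "0 < r k" "r k < T" for k using t by (auto simp: r_def field_simps intro!: add_pos_nonneg)
    have "(\<lambda>k. T - T / real (k + 2)) \<longlonglongrightarrow> T - 0"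
      by (intro tendsto_diff tendsto_const LIMSEQ_ignore_initial_segment[OF lim_const_over_n])
    then have r_lim: "r \<longlonglongrightarrow> T" by (simp add: r_def)
    have T: "0 < T" using t by simp
    have 1: "(\<lambda>k. ennreal (w x (r k))) \<longlonglongrightarrow> ennreal (w x T)"
      using r T by (intro tendsto_ennrealI w_seq tendsto_const r_lim) (auto intro: less_imp_le)
    have 2: "(\<lambda>k. heat_potential 0 q x (r k)) \<longlonglongrightarrow> heat_potential 0 q x T"
    proof (rule heat_potential_tendsto[OF _ q_le M0 order_refl T tendsto_const r_lim])
      show "(\<lambda>(z, s). q z s) \<in> borel_measurable borel" unfolding q_def split_beta by measurable
    qed
    have 3: "(\<lambda>k. ennreal (heat_ker (x - y) (r k))) \<longlonglongrightarrow> ennreal (heat_ker (x - y) T)"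
      by (intro tendsto_ennrealI tendsto_heat_ker tendsto_const r_lim T)
    have "ennreal (w x T) + heat_potential 0 q x T = ennreal (heat_ker (x - y) T)"
      using LIMSEQ_unique[OF tendsto_add[OF 1 2]] 3 by (simp add: less[OF r])
    then show ?thesis unfolding tT q_def .
  qed
qed

section \<open>The heat kernel as fundamental solution\<close>

lemma deriv_eq_0_along_curve:
  fixes c :: "real \<Rightarrow> 'b::topological_space"
  assumes "open U" "c r \<in> U" "continuous_on UNIV c" "\<And>p. p \<in> U \<Longrightarrow> f p = (0::real)"
  shows "deriv (\<lambda>r. f (c r)) r = 0"
proof (rule DERIV_imp_deriv)
  have "open (c -` U)" using open_vimage[OF assms(1) assms(3)] .
  then show "((\<lambda>r. f (c r)) has_real_derivative 0) (at r)"
    by (rule has_field_derivative_transform_within_open[OF DERIV_const[of 0]]) (use assms in auto)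
qed

lemma test_function_support:
  fixes \<phi> :: "'a::euclidean_space \<Rightarrow> real \<Rightarrow> real"
  assumes K: "closed K" "\<And>x t. (x, t) \<notin> K \<Longrightarrow> \<phi> x t = 0" and xt: "(x, t) \<notin> K"
  shows "d_time \<phi> x t = 0" "d_space b \<phi> x t = 0"
proof -
  have U: "open (- K)" using K(1) by (simp add: open_Compl)
  have "deriv (\<lambda>r. (\<lambda>p. \<phi> (fst p) (snd p)) (x, r)) t = 0"
    by (rule deriv_eq_0_along_curve[OF U]) (use K(2) xt in \<open>auto intro!: continuous_intros\<close>)
  then show "d_time \<phi> x t = 0" by (simp add: d_time_def)
  have "deriv (\<lambda>r. (\<lambda>p. \<phi> (fst p) (snd p)) (x + r *\<^sub>R b, t)) 0 = 0"
    by (rule deriv_eq_0_along_curve[OF U]) (use K(2) xt in \<open>auto intro!: continuous_intros\<close>)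
  then show "d_space b \<phi> x t = 0" by (simp add: d_space_def)
qed

lemma test_functionE:
  fixes \<phi> :: "'a::euclidean_space \<Rightarrow> real \<Rightarrow> real"
  assumes "test_function T \<phi>"
  obtains K where "compact K" "K \<subseteq> UNIV \<times> {..<T}"
    "\<And>x t. (x, t) \<notin> K \<Longrightarrow> \<phi> x t = 0"
    "\<And>x t. (x, t) \<notin> K \<Longrightarrow> d_time \<phi> x t = 0"
    "\<And>x t b. (x, t) \<notin> K \<Longrightarrow> d_space b \<phi> x t = 0"
    "\<And>x t b. (x, t) \<notin> K \<Longrightarrow> d_space b (d_space b \<phi>) x t = 0"
    "continuous_on UNIV (\<lambda>p. \<phi> (fst p) (snd p))"
    "continuous_on UNIV (\<lambda>p. d_time \<phi> (fst p) (snd p))"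
    "\<And>b. b \<in> Basis \<Longrightarrow> continuous_on UNIV (\<lambda>p. d_space b \<phi> (fst p) (snd p))"
    "\<And>b. b \<in> Basis \<Longrightarrow> continuous_on UNIV (\<lambda>p. d_space b (d_space b \<phi>) (fst p) (snd p))"
    "\<And>x t. (\<phi> x has_real_derivative d_time \<phi> x t) (at t)"
    "\<And>b x t. b \<in> Basis \<Longrightarrow> ((\<lambda>r. \<phi> (x + r *\<^sub>R b) t) has_real_derivative d_space b \<phi> x t) (at 0)"
    "\<And>b x t. b \<in> Basis \<Longrightarrow> ((\<lambda>r. d_space b \<phi> (x + r *\<^sub>R b) t) has_real_derivative d_space b (d_space b \<phi>) x t) (at 0)"
proof -
  have *: "(f has_real_derivative deriv f x) (at x)" if "f differentiable (at x)" for f :: "real \<Rightarrow> real" and x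
    using that DERIV_deriv_iff_real_differentiable by blast
  from assms obtain K where K: "compact K" "K \<subseteq> UNIV \<times> {..<T}" "\<And>x t. (x, t) \<notin> K \<Longrightarrow> \<phi> x t = 0"
    and c: "continuous_on UNIV (\<lambda>(x, t). \<phi> x t)" and t: "C1_time \<phi>" and s: "C1_space \<phi>"
    and ss: "\<And>b. b \<in> Basis \<Longrightarrow> C1_space (d_space b \<phi>)"
    unfolding test_function_def by auto
  have cl: "closed K" using K(1) by (rule compact_imp_closed)
  have z1: "d_time \<phi> x t = 0" "d_space b \<phi> x t = 0" if "(x, t) \<notin> K" for x t b
    using test_function_support[OF cl K(3) that] by auto
  have z2: "d_space b (d_space b \<phi>) x t = 0" if "(x, t) \<notin> K" for x t b
    by (rule test_function_support(2)[OF cl z1(2) that])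
  have C1: "continuous_on UNIV (\<lambda>p. d_space b \<psi> (fst p) (snd p))"
    "((\<lambda>r. \<psi> (x + r *\<^sub>R b) t) has_real_derivative d_space b \<psi> x t) (at 0)"
    if "C1_space \<psi>" "b \<in> Basis" for \<psi> :: "'a \<Rightarrow> real \<Rightarrow> real" and b x t
    using that *[of "\<lambda>r. \<psi> (x + r *\<^sub>R b) t" 0] by (auto simp: C1_space_def split_beta d_space_def)
  have Ct: "continuous_on UNIV (\<lambda>p. d_time \<phi> (fst p) (snd p))"
    "(\<phi> x has_real_derivative d_time \<phi> x t) (at t)" for x t
    using t *[of "\<phi> x" t] by (auto simp: C1_time_def split_beta d_time_def)
  have c': "continuous_on UNIV (\<lambda>p. \<phi> (fst p) (snd p))" using c by (simp add: split_beta)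
  show thesis
    by (rule that[OF K z1 z2 c' Ct(1) C1(1)[OF s] C1(1)[OF ss] Ct(2) C1(2)[OF s] C1(2)[OF ss]])
qed

lemma integrable_continuous_compact_support:
  fixes f :: "'a::euclidean_space \<Rightarrow> real"
  assumes "compact S" "continuous_on S f" "\<And>x. x \<notin> S \<Longrightarrow> f x = 0"
  shows "integrable lborel f"
proof -
  have "integrable lborel (\<lambda>x. indicator S x *\<^sub>R f x)" by (rule borel_integrable_compact[OF assms(1,2)])
  also have "(\<lambda>x. indicator S x *\<^sub>R f x) = f" using assms(3) by (auto simp: fun_eq_iff indicator_def)
  finally show ?thesis .
qed

text \<open>
  Integration by parts in one direction, from translation invariance: \<open>f (x + b) - f x\<close> has integral 0, and
  it is the integral of \<open>g (x + u b)\<close> over \<open>u\<close> in the unit interval, while all translates of \<open>g\<close> have the same integral.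
\<close>

lemma integral_directional_derivative_eq_0:
  fixes f g :: "'a::euclidean_space \<Rightarrow> real"
  assumes S: "compact S" "\<And>x. x \<notin> S \<Longrightarrow> f x = 0" "\<And>x. x \<notin> S \<Longrightarrow> g x = 0"
    and c: "continuous_on UNIV f" "continuous_on UNIV g"
    and d: "\<And>x. ((\<lambda>r. f (x + r *\<^sub>R b)) has_real_derivative g x) (at 0)"
  shows "(LINT x|lborel. g x) = 0"
proof -
  have trans: "(LINT x|lborel. h (x + v)) = (LINT x|lborel. h x)" if "h \<in> borel_measurable borel" for h :: "'a \<Rightarrow> real" and v
  proof -
    have "(LINT x|lborel. h x) = (LINT x|distr lborel borel ((+) v). h x)" by (simp add: lborel_distr_plus)
    also have "\<dots> = (LINT x|lborel. h (v + x))" by (rule integral_distr) (use that in auto)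
    finally show ?thesis by (simp add: add.commute)
  qed
  have fm: "f \<in> borel_measurable borel" "g \<in> borel_measurable borel"
    using c by (auto intro: borel_measurable_continuous_onI)
  have intf: "integrable lborel f"
    by (rule integrable_continuous_compact_support[OF S(1) continuous_on_subset[OF c(1)] S(2)]) auto
  have intfb: "integrable lborel (\<lambda>x. f (x + b))"
  proof (rule integrable_continuous_compact_support[of "(\<lambda>x. x - b) ` S"])
    show "compact ((\<lambda>x. x - b) ` S)" by (intro compact_continuous_image S continuous_intros)
    show "continuous_on ((\<lambda>x. x - b) ` S) (\<lambda>x. f (x + b))"
      by (rule continuous_on_compose2[OF c(1)]) (auto intro!: continuous_intros)
    show "f (x + b) = 0" if "x \<notin> (\<lambda>x. x - b) ` S" for x
      using that by (intro S(2)) (auto simp: image_iff dest: bspec[of _ _ "x + b"])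
  qed
  have ftc: "(LINT u|lborel. indicator {0..1} u * g (x + u *\<^sub>R b)) = f (x + b) - f x" for x
  proof -
    have "((\<lambda>u. f (x + u *\<^sub>R b)) has_real_derivative g (x + u *\<^sub>R b)) (at u)" for u
    proof -
      have "((\<lambda>r. f ((x + u *\<^sub>R b) + r *\<^sub>R b)) has_real_derivative g (x + u *\<^sub>R b)) (at 0)" by (rule d)
      then have "((\<lambda>r. f (x + (r + u) *\<^sub>R b)) has_real_derivative g (x + u *\<^sub>R b)) (at 0)"
        by (simp add: algebra_simps)
      then show ?thesis using DERIV_at_within_shift[of "\<lambda>u. f (x + u *\<^sub>R b)" "g (x + u *\<^sub>R b)" u 0 UNIV]
        by (simp add: add.commute)
    qed
    moreover have "isCont (\<lambda>u. g (x + u *\<^sub>R b)) u" for u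
    proof -
      have "continuous_on UNIV (\<lambda>u::real. g (x + u *\<^sub>R b))"
        by (rule continuous_on_compose2[OF c(2)]) (auto intro!: continuous_intros)
      then show ?thesis by (simp add: continuous_on_eq_continuous_at)
    qed
    ultimately have "(LINT u|lborel. g (x + u *\<^sub>R b) * indicator {0..1} u) = f (x + 1 *\<^sub>R b) - f (x + 0 *\<^sub>R b)"
      by (intro integral_FTC_Icc_real) auto
    then show ?thesis by (simp add: mult.commute)
  qed
  have int2: "integrable (lborel \<Otimes>\<^sub>M lborel) (\<lambda>(u, x). indicator {0..1} u * g (x + u *\<^sub>R b))"
    unfolding lborel_prod
  proof -
    let ?S = "(\<lambda>(u::real, x). (u, x - u *\<^sub>R b)) ` ({0..1} \<times> S)"
    have "compact ?S" unfolding split_beta by (intro compact_continuous_image compact_Times S continuous_intros) auto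
    moreover have "continuous_on ?S (\<lambda>p. g (snd p + fst p *\<^sub>R b))"
      by (rule continuous_on_compose2[OF c(2)]) (auto intro!: continuous_intros)
    ultimately have "integrable lborel (\<lambda>p. indicator ?S p *\<^sub>R g (snd p + fst p *\<^sub>R b))"
      by (rule borel_integrable_compact)
    also have "(\<lambda>p. indicator ?S p *\<^sub>R g (snd p + fst p *\<^sub>R b)) = (\<lambda>(u, x). indicator {0..1} u * g (x + u *\<^sub>R b))"
    proof (rule ext, clarify)
      fix u :: real and x :: 'a
      have "(u, x) \<in> ?S \<longleftrightarrow> u \<in> {0..1} \<and> x + u *\<^sub>R b \<in> S"
        by (auto simp: image_iff) (metis add_diff_cancel_right')
      then show "indicator ?S (u, x) *\<^sub>R g (snd (u, x) + fst (u, x) *\<^sub>R b) = indicator {0..1} u * g (x + u *\<^sub>R b)"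
        using S(3)[of "x + u *\<^sub>R b"] by (auto simp: indicator_def)
    qed
    finally show "integrable lborel (\<lambda>(u, x). indicator {0..1} u * g (x + u *\<^sub>R b))" .
  qed
  have "(LINT u|lborel. indicator {0..1::real} u * (LINT x|lborel. g x)) = (LINT u|lborel. LINT x|lborel. indicator {0..1} u * g (x + u *\<^sub>R b))"
    by (simp add: trans fm)
  also have "\<dots> = (LINT x|lborel. LINT u|lborel. indicator {0..1} u * g (x + u *\<^sub>R b))"
    by (rule lborel_pair.Fubini_integral[symmetric]) (rule int2)
  also have "\<dots> = (LINT x|lborel. f (x + b) - f x)" by (simp add: ftc)
  also have "\<dots> = 0" using intf intfb by (simp add: trans fm)
  finally show ?thesis by simp
qed

lemma DERIV_damped_ker_time:
  fixes v :: "'a::euclidean_space"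
  assumes "0 < s"
  shows "((\<lambda>s. damped_ker M v s) has_real_derivative
     damped_ker M v s * ((norm v)\<^sup>2 / (4 * s\<^sup>2) - real DIM('a) / (2 * s) - M)) (at s)"
proof -
  have "((\<lambda>s. exp (- M * s)) has_real_derivative exp (- M * s) * (- M)) (at s)"
    by (auto intro!: derivative_eq_intros)
  from DERIV_mult[OF this DERIV_heat_ker_time[OF assms, of v]]
  show ?thesis unfolding damped_ker_def by (simp add: algebra_simps)
qed

lemma DERIV_damped_ker_space:
  fixes v b :: "'a::euclidean_space"
  assumes "0 < s"
  shows "((\<lambda>r. damped_ker M (v + r *\<^sub>R b) s) has_real_derivative - damped_ker M v s * (v \<bullet> b) / (2 * s)) (at 0)"
  using DERIV_cmult[OF DERIV_heat_ker_space[OF assms, of v b], of "exp (- M * s)"]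
  unfolding damped_ker_def by (simp add: mult.assoc)

lemma continuous_on_damped_ker [continuous_intros]:
  fixes f :: "'b::topological_space \<Rightarrow> 'a::euclidean_space"
  assumes "continuous_on S f" "continuous_on S g" "\<And>p. p \<in> S \<Longrightarrow> 0 < g p"
  shows "continuous_on S (\<lambda>p. damped_ker M (f p) (g p))"
  unfolding damped_ker_def by (intro continuous_intros assms)

text \<open>
  Green's identity between a test function and the kernel at a fixed time: the integrand is the sum over the
  basis of directional derivatives of \<open>\<phi> \<partial>\<^sub>b D - D \<partial>\<^sub>b \<phi>\<close>, where \<open>D\<close> is the damped kernel.
\<close>

lemma integral_damped_ker_laplace:
  fixes \<phi> :: "'a::euclidean_space \<Rightarrow> real \<Rightarrow> real"
  assumes tf: "test_function T \<phi>" and s: "0 < s"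
  shows "(LINT x|lborel. damped_ker M (x - y) s * ((norm (x - y))\<^sup>2 / (4 * s\<^sup>2) - real DIM('a) / (2 * s)) * \<phi> x t
      - damped_ker M (x - y) s * laplace \<phi> x t) = 0"
proof -
  from tf obtain K where K: "compact K"
    and K0: "\<And>x t. (x, t) \<notin> K \<Longrightarrow> \<phi> x t = 0" "\<And>x t b. (x, t) \<notin> K \<Longrightarrow> d_space b \<phi> x t = 0"
      "\<And>x t b. (x, t) \<notin> K \<Longrightarrow> d_space b (d_space b \<phi>) x t = 0"
    and c: "continuous_on UNIV (\<lambda>p. \<phi> (fst p) (snd p))"
      "\<And>b. b \<in> Basis \<Longrightarrow> continuous_on UNIV (\<lambda>p. d_space b \<phi> (fst p) (snd p))"
      "\<And>b. b \<in> Basis \<Longrightarrow> continuous_on UNIV (\<lambda>p. d_space b (d_space b \<phi>) (fst p) (snd p))"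
    and d: "\<And>b x t. b \<in> Basis \<Longrightarrow> ((\<lambda>r. \<phi> (x + r *\<^sub>R b) t) has_real_derivative d_space b \<phi> x t) (at 0)"
      "\<And>b x t. b \<in> Basis \<Longrightarrow> ((\<lambda>r. d_space b \<phi> (x + r *\<^sub>R b) t) has_real_derivative d_space b (d_space b \<phi>) x t) (at 0)"
    by (rule test_functionE) blast
  define D where "D = (\<lambda>x. damped_ker M (x - y) s)"
  define g where "g = (\<lambda>b x. \<phi> x t * (D x * (((x - y) \<bullet> b)\<^sup>2 / (4 * s\<^sup>2) - 1 / (2 * s))) - D x * d_space b (d_space b \<phi>) x t)"
  \<comment> \<open>The derivative of \<open>f b\<close> in the direction \<open>b\<close> is \<open>g b\<close>: the products of first derivatives cancel.\<close>
  define f where "f = (\<lambda>b x. \<phi> x t * (- D x * ((x - y) \<bullet> b) / (2 * s)) - D x * d_space b \<phi> x t)"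
  have S: "compact (fst ` K)" by (intro compact_continuous_image K continuous_intros)
  have out: "(x, t) \<notin> K" if "x \<notin> fst ` K" for x using that by (force simp: image_iff)
  have cD: "continuous_on UNIV D" unfolding D_def by (intro continuous_intros) (use s in auto)
  have cx: "continuous_on UNIV (\<lambda>x. h x t)" if "continuous_on UNIV (\<lambda>p. h (fst p) (snd p))" for h :: "'a \<Rightarrow> real \<Rightarrow> real"
  proof -
    have "continuous_on UNIV (\<lambda>x. h (fst (x, t)) (snd (x, t)))"
      by (rule continuous_on_compose2[OF that]) (auto intro!: continuous_intros)
    then show ?thesis by simp
  qed
  have cf: "continuous_on UNIV (f b)" and cg: "continuous_on UNIV (g b)" if b: "b \<in> Basis" for b
    unfolding f_def g_def using s
    by (auto intro!: continuous_intros cD cx[OF c(1)] cx[OF c(2)[OF b]] cx[OF c(3)[OF b]])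
  have g0: "g b x = 0" and f0: "f b x = 0" if "x \<notin> fst ` K" for b x
    using K0 out[OF that] by (auto simp: f_def g_def)
  have z: "(LINT x|lborel. g b x) = 0" if b: "b \<in> Basis" for b
  proof (rule integral_directional_derivative_eq_0[OF S f0 g0 cf[OF b] cg[OF b]])
    fix x
    have Dd: "((\<lambda>r. D (x + r *\<^sub>R b)) has_real_derivative - D x * ((x - y) \<bullet> b) / (2 * s)) (at 0)"
      using DERIV_damped_ker_space[OF s, of M "x - y" b] by (simp add: D_def algebra_simps)
    have l: "((\<lambda>r. (x + r *\<^sub>R b - y) \<bullet> b) has_real_derivative 1) (at 0)"
      using b by (simp add: inner_diff_left inner_add_left) (auto intro!: derivative_eq_intros)
    have D2: "((\<lambda>r. - D (x + r *\<^sub>R b) * ((x + r *\<^sub>R b - y) \<bullet> b) / (2 * s)) has_real_derivative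
       D x * (((x - y) \<bullet> b)\<^sup>2 / (4 * s\<^sup>2) - 1 / (2 * s))) (at 0)"
    proof -
      have "((\<lambda>r. - D (x + r *\<^sub>R b) * ((x + r *\<^sub>R b - y) \<bullet> b) / (2 * s)) has_real_derivative
        (- (- D x * ((x - y) \<bullet> b) / (2 * s)) * ((x - y) \<bullet> b) + 1 * (- D x)) / (2 * s)) (at 0)"
        using DERIV_mult[OF DERIV_minus[OF Dd] l] by (intro DERIV_cdivide) simp
      moreover have e: "(- (- D x * ((x - y) \<bullet> b) / (2 * s)) * ((x - y) \<bullet> b) + 1 * (- D x)) / (2 * s)
         = D x * (((x - y) \<bullet> b)\<^sup>2 / (4 * s\<^sup>2) - 1 / (2 * s))"
        using s by (simp add: power2_eq_square divide_simps) (simp add: algebra_simps)?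
      ultimately show ?thesis unfolding e by blast
    qed
    have "((\<lambda>r. f b (x + r *\<^sub>R b)) has_real_derivative
       (d_space b \<phi> x t * (- D x * ((x - y) \<bullet> b) / (2 * s)) + D x * (((x - y) \<bullet> b)\<^sup>2 / (4 * s\<^sup>2) - 1 / (2 * s)) * \<phi> x t)
       - (- D x * ((x - y) \<bullet> b) / (2 * s) * d_space b \<phi> x t + d_space b (d_space b \<phi>) x t * D x)) (at 0)"
      using DERIV_diff[OF DERIV_mult[OF d(1)[OF b, of x t] D2] DERIV_mult[OF Dd d(2)[OF b, of x t]]]
      unfolding f_def by simp
    then show "((\<lambda>r. f b (x + r *\<^sub>R b)) has_real_derivative g b x) (at 0)"
      by (simp add: g_def algebra_simps)
  qed
  have "(LINT x|lborel. (\<Sum>b\<in>Basis. g b x)) = (\<Sum>b\<in>Basis. LINT x|lborel. g b x)"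
    using g0 by (intro Bochner_Integration.integral_sum integrable_continuous_compact_support[OF S continuous_on_subset[OF cg]]) auto
  also have "\<dots> = 0" by (simp add: z)
  also have "(\<lambda>x. \<Sum>b\<in>Basis. g b x) = (\<lambda>x. damped_ker M (x - y) s * ((norm (x - y))\<^sup>2 / (4 * s\<^sup>2) - real DIM('a) / (2 * s)) * \<phi> x t
      - damped_ker M (x - y) s * laplace \<phi> x t)"
  proof
    fix x
    have n: "(norm (x - y))\<^sup>2 = (\<Sum>b\<in>Basis. ((x - y) \<bullet> b)\<^sup>2)"
      unfolding power2_norm_eq_inner by (subst euclidean_inner) (simp add: power2_eq_square)
    have "(\<Sum>b\<in>Basis. g b x) = \<phi> x t * D x * (\<Sum>b\<in>(Basis::'a set). ((x - y) \<bullet> b)\<^sup>2 / (4 * s\<^sup>2) - 1 / (2 * s)) - D x * laplace \<phi> x t"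
      unfolding g_def laplace_def sum_distrib_left sum_subtractf[symmetric] by (simp add: mult.assoc)
    also have "(\<Sum>b\<in>(Basis::'a set). ((x - y) \<bullet> b)\<^sup>2 / (4 * s\<^sup>2) - 1 / (2 * s)) = (norm (x - y))\<^sup>2 / (4 * s\<^sup>2) - real DIM('a) / (2 * s)"
      unfolding n by (simp add: sum_subtractf sum_divide_distrib)
    finally show "(\<Sum>b\<in>Basis. g b x) = damped_ker M (x - y) s * ((norm (x - y))\<^sup>2 / (4 * s\<^sup>2) - real DIM('a) / (2 * s)) * \<phi> x t
      - damped_ker M (x - y) s * laplace \<phi> x t"
      by (simp add: D_def mult_ac)
  qed
  finally show ?thesis .
qed

lemma test_function_bounds:
  fixes \<phi> :: "'a::euclidean_space \<Rightarrow> real \<Rightarrow> real"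
  assumes tf: "test_function T \<phi>"
    and \<psi>_def: "\<psi> = (\<lambda>x t. - d_time \<phi> x t - laplace \<phi> x t + M * \<phi> x t)"
  obtains B where "continuous_on UNIV (\<lambda>p. \<psi> (fst p) (snd p))" "continuous_on UNIV (\<lambda>p. \<phi> (fst p) (snd p))"
    "\<And>x t. \<bar>\<phi> x t\<bar> \<le> B * indicator {..T} t" "\<And>x t. \<bar>\<psi> x t\<bar> \<le> B * indicator {..T} t" "0 \<le> B"
proof -
  from tf obtain K where K: "compact K" "K \<subseteq> UNIV \<times> {..<T}"
    and K0: "\<And>x t. (x, t) \<notin> K \<Longrightarrow> \<phi> x t = 0" "\<And>x t. (x, t) \<notin> K \<Longrightarrow> d_time \<phi> x t = 0"
      "\<And>x t b. (x, t) \<notin> K \<Longrightarrow> d_space b (d_space b \<phi>) x t = 0"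
    and c: "continuous_on UNIV (\<lambda>p. \<phi> (fst p) (snd p))" "continuous_on UNIV (\<lambda>p. d_time \<phi> (fst p) (snd p))"
      "\<And>b. b \<in> Basis \<Longrightarrow> continuous_on UNIV (\<lambda>p. d_space b (d_space b \<phi>) (fst p) (snd p))"
    by (rule test_functionE) blast
  have c\<psi>: "continuous_on UNIV (\<lambda>p. \<psi> (fst p) (snd p))"
    unfolding \<psi>_def laplace_def by (intro continuous_intros c)
  have bd: "\<exists>B. \<forall>x t. \<bar>h x t\<bar> \<le> B * indicator {..T} t \<and> 0 \<le> B"
    if h: "continuous_on UNIV (\<lambda>p. h (fst p) (snd p))" "\<And>x t. (x, t) \<notin> K \<Longrightarrow> h x t = 0" for h :: "'a \<Rightarrow> real \<Rightarrow> real"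
  proof -
    have "compact ((\<lambda>p. h (fst p) (snd p)) ` K)"
      by (intro compact_continuous_image K continuous_on_subset[OF h(1)]) auto
    from compact_imp_bounded[OF this] obtain B where "\<forall>p\<in>K. norm (h (fst p) (snd p)) \<le> B"
      unfolding bounded_iff by blast
    then have B: "\<bar>h (fst p) (snd p)\<bar> \<le> B" if "p \<in> K" for p using that by simp
    have "\<bar>h x t\<bar> \<le> max 0 B * indicator {..T} t \<and> 0 \<le> max 0 B" for x t
    proof (cases "(x, t) \<in> K")
      case True
      then have "t < T" using K(2) by auto
      then show ?thesis using B[OF True] by simp
    next
      case False
      then show ?thesis using h(2) by simp
    qed
    then show ?thesis by blast
  qed
  obtain B1 where B1: "\<And>x t. \<bar>\<phi> x t\<bar> \<le> B1 * indicator {..T} t" "0 \<le> B1"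
    using bd[OF c(1) K0(1)] by blast
  have "\<psi> x t = 0" if "(x, t) \<notin> K" for x t
    using K0 that by (simp add: \<psi>_def laplace_def)
  then obtain B2 where B2: "\<And>x t. \<bar>\<psi> x t\<bar> \<le> B2 * indicator {..T} t" "0 \<le> B2"
    using bd[OF c\<psi>] by blast
  show thesis
  proof (rule that[OF c\<psi> c(1)])
    show "\<bar>\<phi> x t\<bar> \<le> max B1 B2 * indicator {..T} t" "\<bar>\<psi> x t\<bar> \<le> max B1 B2 * indicator {..T} t" for x t
      using B1(1)[of x t] B2(1)[of x t] by (auto simp: indicator_def split: if_splits)
    show "0 \<le> max B1 B2" using B1(2) by simp
  qed
qed

text \<open>
  Let \<open>D\<close> be the damped kernel with pole \<open>(y, s)\<close>. The integrand is the sum of \<open>- \<partial>\<^sub>t (D \<phi>)\<close> and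
  \<open>\<phi> \<Delta>D - D \<Delta>\<phi>\<close>. The second part vanishes at each time by Green's identity, the first one is integrated in
  time. Starting at \<open>s + e\<close> avoids the singularity of \<open>D\<close>.
\<close>

lemma damped_ker_representation_delayed:
  fixes \<phi> :: "'a::euclidean_space \<Rightarrow> real \<Rightarrow> real"
  assumes tf: "test_function T \<phi>" and e: "0 < e"
  shows "(LINT p|lborel. indicator {s + e..} (snd p) * (damped_ker M (fst p - y) (snd p - s)
        * (- d_time \<phi> (fst p) (snd p) - laplace \<phi> (fst p) (snd p) + M * \<phi> (fst p) (snd p))))
    = (LINT x|lborel. damped_ker M (x - y) e * \<phi> x (s + e))"
proof -
  define a where "a = s + e"
  from tf obtain K where K: "compact K" "K \<subseteq> UNIV \<times> {..<T}"
    and K0: "\<And>x t. (x, t) \<notin> K \<Longrightarrow> \<phi> x t = 0" "\<And>x t. (x, t) \<notin> K \<Longrightarrow> d_time \<phi> x t = 0"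
      "\<And>x t b. (x, t) \<notin> K \<Longrightarrow> d_space b (d_space b \<phi>) x t = 0"
    and c: "continuous_on UNIV (\<lambda>p. \<phi> (fst p) (snd p))" "continuous_on UNIV (\<lambda>p. d_time \<phi> (fst p) (snd p))"
      "\<And>b. b \<in> Basis \<Longrightarrow> continuous_on UNIV (\<lambda>p. d_space b (d_space b \<phi>) (fst p) (snd p))"
    and d: "\<And>x t. (\<phi> x has_real_derivative d_time \<phi> x t) (at t)"
    by (rule test_functionE) blast
  define D where "D = (\<lambda>x t. damped_ker M (x - y) (t - s))"
  define \<kappa> where "\<kappa> = (\<lambda>x t. (norm (x - y))\<^sup>2 / (4 * (t - s)\<^sup>2) - real DIM('a) / (2 * (t - s)))"
  define h where "h = (\<lambda>x t. D x t * (- d_time \<phi> x t - laplace \<phi> x t + M * \<phi> x t))"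
  define k where "k = (\<lambda>x t. D x t * (\<kappa> x t - M) * \<phi> x t + d_time \<phi> x t * D x t)"
  let ?S = "K \<inter> (UNIV \<times> {a..})"
  have S: "compact ?S" by (intro compact_Int_closed K closed_Times) auto
  have pos: "0 < snd p - s" "snd p - s \<noteq> 0" if "p \<in> UNIV \<times> {s<..}" for p :: "'a \<times> real" using that by auto
  have sub: "?S \<subseteq> UNIV \<times> {s<..}" using e by (auto simp: a_def)
  have cD: "continuous_on (UNIV \<times> {s<..}) (\<lambda>p. D (fst p) (snd p))"
    unfolding D_def by (intro continuous_intros pos)
  have c\<kappa>: "continuous_on (UNIV \<times> {s<..}) (\<lambda>p. \<kappa> (fst p) (snd p))"
    unfolding \<kappa>_def by (intro continuous_intros) auto
  have ch: "continuous_on (UNIV \<times> {s<..}) (\<lambda>p. h (fst p) (snd p))"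
    unfolding h_def laplace_def by (intro continuous_intros cD continuous_on_subset[OF c(1)] continuous_on_subset[OF c(2)] continuous_on_subset[OF c(3)]) auto
  have ck: "continuous_on (UNIV \<times> {s<..}) (\<lambda>p. k (fst p) (snd p))"
    unfolding k_def by (intro continuous_intros cD c\<kappa> continuous_on_subset[OF c(1)] continuous_on_subset[OF c(2)]) auto
  have int: "integrable (lborel \<Otimes>\<^sub>M lborel) (\<lambda>(x, t). indicator {a..} t * g x t)"
    if g: "continuous_on (UNIV \<times> {s<..}) (\<lambda>p. g (fst p) (snd p))" "\<And>x t. (x, t) \<notin> K \<Longrightarrow> g x t = 0" for g :: "'a \<Rightarrow> real \<Rightarrow> real"
  proof -
    have "integrable lborel (\<lambda>p. indicator ?S p *\<^sub>R g (fst p) (snd p))"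
      by (rule borel_integrable_compact[OF S continuous_on_subset[OF g(1) sub]])
    also have "(\<lambda>p. indicator ?S p *\<^sub>R g (fst p) (snd p)) = (\<lambda>(x, t). indicator {a..} t * g x t)"
    proof (rule ext, clarify)
      fix x :: 'a and t :: real
      show "indicator ?S (x, t) *\<^sub>R g (fst (x, t)) (snd (x, t)) = indicator {a..} t * g x t"
        using g(2)[of x t] by (auto simp: indicator_def)
    qed
    finally show ?thesis by (simp add: lborel_prod)
  qed
  have h0: "h x t = 0" and k0: "k x t = 0" if "(x, t) \<notin> K" for x t
    using K0 that by (simp_all add: h_def k_def laplace_def)
  have ih: "integrable (lborel \<Otimes>\<^sub>M lborel) (\<lambda>(x, t). indicator {a..} t * h x t)"
    by (rule int[OF ch]) (rule h0)
  have ik: "integrable (lborel \<Otimes>\<^sub>M lborel) (\<lambda>(x, t). indicator {a..} t * k x t)"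
    by (rule int[OF ck]) (rule k0)
  have ix: "(LINT x|lborel. h x t + k x t) = 0" if "a \<le> t" for t
  proof -
    have "0 < t - s" using that e by (simp add: a_def)
    from integral_damped_ker_laplace[OF tf this, of M y t]
    show ?thesis by (simp add: h_def k_def D_def \<kappa>_def algebra_simps)
  qed
  have plus: "(\<lambda>(x, t). indicator {a..} t * (h x t + k x t)) = (\<lambda>p. (\<lambda>(x, t). indicator {a..} t * h x t) p + (\<lambda>(x, t). indicator {a..} t * k x t) p)"
    by (rule ext) (simp add: split_beta distrib_left)
  have "(LINT p|lborel. (\<lambda>(x, t). indicator {a..} t * h x t) p) + (LINT p|lborel. (\<lambda>(x, t). indicator {a..} t * k x t) p)
     = (LINT p|lborel. (\<lambda>(x, t). indicator {a..} t * (h x t + k x t)) p)"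
    unfolding plus by (rule Bochner_Integration.integral_add[symmetric]) (use ih ik in \<open>simp_all only: lborel_prod\<close>)
  also have "\<dots> = (LINT t|lborel. LINT x|lborel. indicator {a..} t * (h x t + k x t))"
  proof -
    have "integrable (lborel \<Otimes>\<^sub>M lborel) (\<lambda>(x, t). indicator {a..} t * (h x t + k x t))"
      unfolding plus by (rule Bochner_Integration.integrable_add[OF ih ik])
    from lborel_pair.integral_snd[OF this] show ?thesis by (simp add: lborel_prod)
  qed
  also have "\<dots> = 0"
  proof -
    have z: "(LINT x|lborel. indicator {a..} t * (h x t + k x t)) = 0" for t
      using ix[of t] by (cases "a \<le> t") auto
    show ?thesis unfolding z by simp
  qed
  finally have sum0: "(LINT p|lborel. (\<lambda>(x, t). indicator {a..} t * h x t) p) + (LINT p|lborel. (\<lambda>(x, t). indicator {a..} t * k x t) p) = 0" .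
  have "(LINT p|lborel. (\<lambda>(x, t). indicator {a..} t * k x t) p) = (LINT x|lborel. LINT t|lborel. indicator {a..} t * k x t)"
    using lborel_pair.integral_fst[OF ik] by (simp add: lborel_prod)
  also have "\<dots> = (LINT x|lborel. - (damped_ker M (x - y) e * \<phi> x (s + e)))"
  proof (rule Bochner_Integration.integral_cong[OF refl])
    fix x
    \<comment> \<open>Beyond \<open>b\<close> the test function vanishes, so the time integral extends over a compact interval.\<close>
    define b where "b = max a T"
    have out: "(x, t) \<notin> K" if "T \<le> t" for t using K(2) that by auto
    have "(LINT t|lborel. indicator {a..} t * k x t) = (LINT t|lborel. k x t * indicator {a..b} t)"
      using k0 out by (intro Bochner_Integration.integral_cong) (auto simp: indicator_def b_def)
    also have "\<dots> = D x b * \<phi> x b - D x a * \<phi> x a"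
    proof (rule integral_FTC_Icc_real)
      fix t assume t: "a \<le> t"
      then have ts: "0 < t - s" using e by (simp add: a_def)
      have "((\<lambda>t. damped_ker M (x - y) (t - s)) has_real_derivative D x t * (\<kappa> x t - M) * 1) (at t)"
        unfolding D_def \<kappa>_def
        by (rule DERIV_chain2[where f = "damped_ker M (x - y)" and g = "\<lambda>t. t - s", OF DERIV_damped_ker_time[OF ts]])
           (auto intro!: derivative_eq_intros)
      then have "((\<lambda>t. D x t) has_real_derivative D x t * (\<kappa> x t - M)) (at t)" by (simp add: D_def)
      from DERIV_mult[OF this d[of x t]]
      show "((\<lambda>t. D x t * \<phi> x t) has_real_derivative k x t) (at t)" by (simp add: k_def)
      have "continuous_on {s<..} (\<lambda>t. k (fst (x, t)) (snd (x, t)))"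
        by (rule continuous_on_compose2[OF ck]) (auto intro!: continuous_intros)
      then show "isCont (\<lambda>t. k x t) t" using ts by (simp add: continuous_on_eq_continuous_at)
    qed (simp add: b_def)
    also have "\<phi> x b = 0" using K0(1) out by (simp add: b_def)
    finally show "(LINT t|lborel. indicator {a..} t * k x t) = - (damped_ker M (x - y) e * \<phi> x (s + e))"
      by (simp add: D_def a_def)
  qed
  finally show ?thesis using sum0 by (simp add: h_def D_def a_def split_beta)
qed

text \<open>
  The damped kernel is a fundamental solution; this is the limit \<open>e \<rightarrow> 0\<close> of the preceding lemma.
\<close>

lemma damped_ker_representation:
  fixes \<phi> :: "'a::euclidean_space \<Rightarrow> real \<Rightarrow> real"
  assumes tf: "test_function T \<phi>" and M: "0 \<le> M"
    and \<psi>: "\<psi> = (\<lambda>x t. - d_time \<phi> x t - laplace \<phi> x t + M * \<phi> x t)"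
  shows "integrable lborel (\<lambda>p. damped_ker M (fst p - y) (snd p - s) * \<psi> (fst p) (snd p))"
    and "(LINT p|lborel. damped_ker M (fst p - y) (snd p - s) * \<psi> (fst p) (snd p)) = \<phi> y s"
proof -
  obtain B where c\<psi>: "continuous_on UNIV (\<lambda>p. \<psi> (fst p) (snd p))" and c\<phi>: "continuous_on UNIV (\<lambda>p. \<phi> (fst p) (snd p))"
    and B: "\<And>x t. \<bar>\<phi> x t\<bar> \<le> B * indicator {..T} t" "\<And>x t. \<bar>\<psi> x t\<bar> \<le> B * indicator {..T} t" "0 \<le> B"
    using test_function_bounds[OF tf \<psi>] by blast
  have [measurable]: "(\<lambda>p. \<psi> (fst p) (snd p)) \<in> borel_measurable borel" "(\<lambda>p. \<phi> (fst p) (snd p)) \<in> borel_measurable borel"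
    using c\<psi> c\<phi> by (auto intro: borel_measurable_continuous_onI)
  define e where "e = (\<lambda>k. inverse (real (Suc k)))"
  have e: "0 < e k" for k by (simp add: e_def)
  have e_lim: "e \<longlonglongrightarrow> 0" unfolding e_def by (rule LIMSEQ_inverse_real_of_nat)
  let ?f = "\<lambda>p. damped_ker M (fst p - y) (snd p - s) * \<psi> (fst p) (snd p)"
  let ?w = "\<lambda>p. B * (heat_ker (fst p - y) (snd p - s) * indicator {..T} (snd p))"
  have fm: "?f \<in> borel_measurable lborel" by measurable
  have fkm: "(\<lambda>p. indicator {s + e k..} (snd p) * ?f p) \<in> borel_measurable lborel" for k by measurable
  have wi: "integrable lborel ?w" by (intro integrable_mult_right integrable_heat_ker_until)
  have bd: "\<bar>?f p\<bar> \<le> ?w p" for p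
  proof -
    have "\<bar>?f p\<bar> \<le> heat_ker (fst p - y) (snd p - s) * (B * indicator {..T} (snd p))"
      unfolding abs_mult using damped_ker_le[OF M] B(2) by (intro mult_mono) auto
    then show ?thesis by (simp add: mult_ac)
  qed
  have lim: "AE p in lborel. (\<lambda>k. indicator {s + e k..} (snd p) * ?f p) \<longlonglongrightarrow> ?f p"
  proof (rule AE_I2)
    fix p :: "'a \<times> real"
    show "(\<lambda>k. indicator {s + e k..} (snd p) * ?f p) \<longlonglongrightarrow> ?f p"
    proof (cases "s < snd p")
      case True
      have "eventually (\<lambda>k. e k < snd p - s) sequentially"
        by (rule order_tendstoD(2)[OF e_lim]) (use True in simp)
      then have "eventually (\<lambda>k. indicator {s + e k..} (snd p) * ?f p = ?f p) sequentially"
        by eventually_elim auto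
      then show ?thesis by (rule tendsto_eventually)
    qed (simp add: damped_ker_def)
  qed
  have bdk: "AE p in lborel. norm (indicator {s + e k..} (snd p) * ?f p) \<le> ?w p" for k
  proof (rule AE_I2)
    fix p :: "'a \<times> real"
    have "norm (indicator {s + e k..} (snd p) * ?f p) \<le> \<bar>?f p\<bar>"
      by (simp add: indicator_def)
    also have "\<dots> \<le> ?w p" by (rule bd)
    finally show "norm (indicator {s + e k..} (snd p) * ?f p) \<le> ?w p" .
  qed
  show "integrable lborel ?f"
    by (rule integrable_dominated_convergence[OF fm fkm wi lim bdk])
  have 1: "(\<lambda>k. LINT p|lborel. indicator {s + e k..} (snd p) * ?f p) \<longlonglongrightarrow> (LINT p|lborel. ?f p)"
    by (rule integral_dominated_convergence[OF fm fkm wi lim bdk])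
  have eq: "(LINT p|lborel. indicator {s + e k..} (snd p) * ?f p)
     = (LINT x|lborel. heat_ker (x - y) (e k) * (exp (- M * e k) * \<phi> x (s + e k)))" for k
    using damped_ker_representation_delayed[OF tf e[of k], of s M y] by (simp add: \<psi> damped_ker_def mult_ac)
  have 2: "(\<lambda>k. LINT x|lborel. heat_ker (x - y) (e k) * (exp (- M * e k) * \<phi> x (s + e k))) \<longlonglongrightarrow> \<phi> y s"
  proof (rule heat_ker_approximate_identity[where B = B])
    have "(\<lambda>x. \<phi> (fst (x, s + e k)) (snd (x, s + e k))) \<in> borel_measurable borel" for k
      by (intro borel_measurable_continuous_onI continuous_on_compose2[OF c\<phi>]) (auto intro!: continuous_intros)
    then show "(\<lambda>x. exp (- M * e k) * \<phi> x (s + e k)) \<in> borel_measurable borel" for k by simp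
    show "\<bar>exp (- M * e k) * \<phi> z (s + e k)\<bar> \<le> B" for k z
    proof -
      have "\<bar>\<phi> z (s + e k)\<bar> \<le> B"
        using B(1)[of z "s + e k"] B(3) by (cases "s + e k \<le> T") auto
      then have "\<bar>exp (- M * e k) * \<phi> z (s + e k)\<bar> \<le> 1 * B"
        unfolding abs_mult using M e[of k] by (intro mult_mono) auto
      then show ?thesis by simp
    qed
    fix u
    have "(\<lambda>k. exp (- M * e k) * \<phi> (fst (y + sqrt (e k) *\<^sub>R u, s + e k)) (snd (y + sqrt (e k) *\<^sub>R u, s + e k)))
      \<longlonglongrightarrow> exp (- M * 0) * \<phi> (fst (y + sqrt 0 *\<^sub>R u, s + 0)) (snd (y + sqrt 0 *\<^sub>R u, s + 0))"
      by (intro tendsto_mult tendsto_exp tendsto_intros e_lim continuous_on_tendsto_compose[OF c\<phi>]) auto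
    then show "(\<lambda>k. exp (- M * e k) * \<phi> (y + sqrt (e k) *\<^sub>R u) (s + e k)) \<longlonglongrightarrow> \<phi> y s" by simp
  qed (rule e)
  show "(LINT p|lborel. ?f p) = \<phi> y s"
    using LIMSEQ_unique[OF 1] 2 unfolding eq by blast
qed

section \<open>Existence of weak solutions\<close>

text \<open>
  Picard iteration for the equation with potential \<open>W = M - (M - W)\<close>, perturbed from the constant potential \<open>M\<close>.
  As \<open>M - W \<ge> 0\<close> enters with a positive sign, the iterates are nonnegative and increasing, so that monotone
  convergence replaces any contraction estimate.
\<close>

fun heat_iterate :: "real \<Rightarrow> ('a::euclidean_space \<Rightarrow> real \<Rightarrow> real) \<Rightarrow> 'a \<Rightarrow> nat \<Rightarrow> 'a \<Rightarrow> real \<Rightarrow> ennreal" where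
  "heat_iterate M W y 0 x t = 0"
| "heat_iterate M W y (Suc n) x t = ennreal (damped_ker M (x - y) t)
     + heat_potential M (\<lambda>z s. ennreal (M - W z s) * heat_iterate M W y n z s) x t"

lemma heat_iterate_measurable:
  fixes W :: "'a::euclidean_space \<Rightarrow> real \<Rightarrow> real"
  assumes Wm: "(\<lambda>(x, t). W x t) \<in> borel_measurable borel"
  shows "(\<lambda>(x, t). heat_iterate M W y n x t) \<in> borel_measurable borel"
proof (induction n)
  case (Suc n)
  note [measurable (raw)] = measurable_curried[OF Wm] measurable_curried[OF Suc]
  show ?case unfolding heat_iterate.simps heat_potential_def split_beta by measurable
qed simp

lemma heat_potential_mono:
  assumes "\<And>z s. q z s \<le> q' z s"
  shows "heat_potential M q x t \<le> heat_potential M q' x t"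
  unfolding heat_potential_def by (intro nn_integral_mono mult_left_mono assms) simp

lemma heat_iterate_incseq: "incseq (\<lambda>n. heat_iterate M W y n x t)"
proof (rule incseq_SucI)
  fix n
  show "heat_iterate M W y n x t \<le> heat_iterate M W y (Suc n) x t"
  proof (induction n arbitrary: x t)
    case (Suc n)
    show ?case
      unfolding heat_iterate.simps(2)[of _ _ _ n] heat_iterate.simps(2)[of _ _ _ "Suc n"]
      by (intro add_left_mono heat_potential_mono mult_left_mono Suc[unfolded heat_iterate.simps(2)]) simp
  qed simp
qed

text \<open>
  The free heat kernel solves the equation with potential \<open>M\<close> and source \<open>M K\<close>; the factor \<open>1 - exp (- M t)\<close> comes
  from the time integral of \<open>M exp (- M (t - s))\<close>. It is therefore a barrier for the iteration, where \<open>M - W \<le> M\<close>.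
\<close>

lemma damped_supersolution:
  fixes y :: "'a::euclidean_space"
  assumes M: "0 \<le> M"
  shows "ennreal (damped_ker M (x - y) t) + heat_potential M (\<lambda>z s. ennreal (M * heat_ker (z - y) s)) x t
    \<le> ennreal (heat_ker (x - y) t)"
proof (cases "0 < t")
  case True
  have "heat_potential M (\<lambda>z s. ennreal (M * heat_ker (z - y) s)) x t
      = (\<integral>\<^sup>+s. ennreal (M * exp (- M * (t - s))) * indicator {0..t} s * ennreal (heat_ker (x - y) t) \<partial>lborel)"
    unfolding heat_potential_def
  proof (rule nn_integral_cong_AE)
    have "AE s in lborel. s \<noteq> 0 \<and> s \<noteq> t"
      using AE_lborel_singleton[of 0] AE_lborel_singleton[of t] by eventually_elim auto
    then show "AE s in lborel. (\<integral>\<^sup>+z. ennreal (damped_ker M (x - z) (t - s)) * ennreal (M * heat_ker (z - y) s) \<partial>lborel)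
      = ennreal (M * exp (- M * (t - s))) * indicator {0..t} s * ennreal (heat_ker (x - y) t)"
    proof eventually_elim
      case (elim s)
      show ?case
      proof (cases "0 < s \<and> s < t")
        case True
        have "(\<integral>\<^sup>+z. ennreal (damped_ker M (x - z) (t - s)) * ennreal (M * heat_ker (z - y) s) \<partial>lborel)
          = (\<integral>\<^sup>+z. ennreal (M * exp (- M * (t - s))) * (ennreal (heat_ker (x - z) (t - s)) * ennreal (heat_ker (z - y) s)) \<partial>lborel)"
          using M by (intro nn_integral_cong) (simp add: damped_ker_def mult_ac flip: ennreal_mult)
        also have "\<dots> = ennreal (M * exp (- M * (t - s))) * ennreal (heat_ker (x - y) (t - s + s))"
          using True by (simp add: nn_integral_cmult heat_ker_semigroup)
        finally show ?thesis using True by simp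
      next
        case False
        with elim consider "s < 0" | "t < s" by linarith
        then show ?thesis by cases (auto simp: damped_ker_def)
      qed
    qed
  qed
  also have "\<dots> = (\<integral>\<^sup>+s. ennreal (M * exp (- M * (t - s))) * indicator {0..t} s \<partial>lborel) * ennreal (heat_ker (x - y) t)"
    by (rule nn_integral_multc) measurable
  also have "(\<integral>\<^sup>+s. ennreal (M * exp (- M * (t - s))) * indicator {0..t} s \<partial>lborel)
     = ennreal (exp (- M * (t - t)) - exp (- M * (t - 0)))"
    using True M by (intro nn_integral_FTC_Icc) (auto intro!: derivative_eq_intros)
  finally have "ennreal (damped_ker M (x - y) t) + heat_potential M (\<lambda>z s. ennreal (M * heat_ker (z - y) s)) x t
     = ennreal (exp (- M * t)) * ennreal (heat_ker (x - y) t) + ennreal (1 - exp (- M * t)) * ennreal (heat_ker (x - y) t)"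
    using M by (simp add: damped_ker_def ennreal_mult)
  also have "\<dots> = ennreal (heat_ker (x - y) t)"
    using True M by (simp flip: ennreal_mult ennreal_plus distrib_right)
  finally show ?thesis by simp
next
  case False
  have "heat_potential M (\<lambda>z s. ennreal (M * heat_ker (z - y) s)) x t = (\<integral>\<^sup>+s. \<integral>\<^sup>+z. 0 \<partial>(lborel :: 'a measure) \<partial>(lborel :: real measure))"
    unfolding heat_potential_def
  proof (intro nn_integral_cong)
    fix s :: real and z :: 'a
    have "damped_ker M (x - z) (t - s) = 0 \<or> heat_ker (z - y) s = 0"
      using False by (cases "0 < s") (auto simp: damped_ker_def)
    then show "ennreal (damped_ker M (x - z) (t - s)) * ennreal (M * heat_ker (z - y) s) = 0" by auto
  qed
  then show ?thesis using False by (simp add: damped_ker_def)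
qed

lemma heat_iterate_le:
  assumes M: "0 \<le> M" and W: "\<And>x t. 0 \<le> W x t \<and> W x t \<le> M"
  shows "heat_iterate M W y n x t \<le> ennreal (heat_ker (x - y) t)"
proof (induction n arbitrary: x t)
  case (Suc n)
  have "heat_iterate M W y (Suc n) x t
      \<le> ennreal (damped_ker M (x - y) t) + heat_potential M (\<lambda>z s. ennreal (M * heat_ker (z - y) s)) x t"
    unfolding heat_iterate.simps
  proof (intro add_left_mono heat_potential_mono)
    fix z s
    have "ennreal (M - W z s) * heat_iterate M W y n z s \<le> ennreal M * ennreal (heat_ker (z - y) s)"
      using W[of z s] by (intro mult_mono Suc ennreal_leI) auto
    then show "ennreal (M - W z s) * heat_iterate M W y n z s \<le> ennreal (M * heat_ker (z - y) s)"
      using M by (simp add: ennreal_mult)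
  qed
  also have "\<dots> \<le> ennreal (heat_ker (x - y) t)" by (rule damped_supersolution[OF M])
  finally show ?case .
qed simp

lemma mild_solution_exists:
  fixes W :: "'a::euclidean_space \<Rightarrow> real \<Rightarrow> real"
  assumes Wm: "(\<lambda>(x, t). W x t) \<in> borel_measurable borel"
    and M: "0 \<le> M" and W: "\<And>x t. 0 \<le> W x t \<and> W x t \<le> M"
  obtains w :: "'a \<Rightarrow> real \<Rightarrow> real" where
    "(\<lambda>(x, t). w x t) \<in> borel_measurable borel" "\<And>x t. 0 \<le> w x t" "\<And>x t. w x t \<le> heat_ker (x - y) t"
    "\<And>x t. ennreal (w x t) = ennreal (damped_ker M (x - y) t) + heat_potential M (\<lambda>z s. ennreal ((M - W z s) * w z s)) x t"
proof -
  define v where "v = (\<lambda>x t. SUP n. heat_iterate M W y n x t)"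
  note im = heat_iterate_measurable[OF Wm, of M y]
  note [measurable (raw)] = measurable_curried[OF Wm] measurable_curried[OF im]
  have vm: "(\<lambda>(x, t). v x t) \<in> borel_measurable borel"
    unfolding v_def split_beta by measurable
  have v_le: "v x t \<le> ennreal (heat_ker (x - y) t)" for x t
    unfolding v_def by (intro SUP_least heat_iterate_le M W)
  have eq: "v x t = ennreal (damped_ker M (x - y) t) + heat_potential M (\<lambda>z s. ennreal (M - W z s) * v z s) x t" for x t
  proof -
    let ?g = "\<lambda>n z s. ennreal (damped_ker M (x - z) (t - s)) * (ennreal (M - W z s) * heat_iterate M W y n z s)"
    have inc: "incseq (\<lambda>n. ?g n z s)" for z s
      using heat_iterate_incseq[of M W y z s] by (auto simp: incseq_def intro!: mult_left_mono)
    have "heat_potential M (\<lambda>z s. ennreal (M - W z s) * v z s) x t = (\<integral>\<^sup>+s. \<integral>\<^sup>+z. (SUP n. ?g n z s) \<partial>lborel \<partial>lborel)"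
      unfolding heat_potential_def v_def by (simp add: SUP_mult_left_ennreal)
    also have "\<dots> = (\<integral>\<^sup>+s. (SUP n. \<integral>\<^sup>+z. ?g n z s \<partial>lborel) \<partial>lborel)"
      by (intro nn_integral_cong nn_integral_monotone_convergence_SUP)
         (use inc in \<open>auto simp: incseq_def le_fun_def\<close>)
    also have "\<dots> = (SUP n. \<integral>\<^sup>+s. \<integral>\<^sup>+z. ?g n z s \<partial>lborel \<partial>lborel)"
      by (intro nn_integral_monotone_convergence_SUP)
         (use inc in \<open>auto simp: incseq_def le_fun_def intro!: nn_integral_mono\<close>)
    finally have "heat_potential M (\<lambda>z s. ennreal (M - W z s) * v z s) x t
      = (SUP n. heat_potential M (\<lambda>z s. ennreal (M - W z s) * heat_iterate M W y n z s) x t)"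
      by (simp add: heat_potential_def)
    then have "ennreal (damped_ker M (x - y) t) + heat_potential M (\<lambda>z s. ennreal (M - W z s) * v z s) x t
       = (SUP n. heat_iterate M W y (Suc n) x t)"
      by (simp add: ennreal_SUP_add_right)
    also have "\<dots> = v x t"
    proof (rule LIMSEQ_unique)
      have "incseq (\<lambda>n. heat_iterate M W y (Suc n) x t)"
        using heat_iterate_incseq[of M W y x t] unfolding incseq_def by blast
      then show "(\<lambda>n. heat_iterate M W y (Suc n) x t) \<longlonglongrightarrow> (SUP n. heat_iterate M W y (Suc n) x t)"
        by (rule LIMSEQ_SUP)
      show "(\<lambda>n. heat_iterate M W y (Suc n) x t) \<longlonglongrightarrow> v x t"
        unfolding v_def by (intro LIMSEQ_Suc LIMSEQ_SUP heat_iterate_incseq)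
    qed
    finally show ?thesis by simp
  qed
  define w where "w = (\<lambda>x t. enn2real (v x t))"
  have vw: "ennreal (w x t) = v x t" for x t
    unfolding w_def by (rule ennreal_enn2real[OF order_le_less_trans[OF v_le ennreal_less_top]])
  show thesis
  proof (rule that[of w])
    show "(\<lambda>(x, t). w x t) \<in> borel_measurable borel"
      unfolding w_def using borel_measurable_enn2real[OF vm] by (simp add: split_beta)
    show "0 \<le> w x t" for x t by (simp add: w_def)
    show "w x t \<le> heat_ker (x - y) t" for x t
      using v_le[of x t] unfolding vw[symmetric] by (simp add: ennreal_le_iff)
    show "ennreal (w x t) = ennreal (damped_ker M (x - y) t) + heat_potential M (\<lambda>z s. ennreal ((M - W z s) * w z s)) x t" for x t
    proof -
      have "ennreal ((M - W z s) * w z s) = ennreal (M - W z s) * v z s" for z s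
        unfolding vw[symmetric] using W[of z s] by (intro ennreal_mult) (auto simp: w_def)
      then show ?thesis unfolding vw by (simp add: eq[of x t])
    qed
  qed
qed

text \<open>
  The fixed point of the iteration is a weak solution: Fubini's theorem moves the test function onto
  the kernel, where \<open>damped_ker_representation\<close> evaluates it.
\<close>

theorem dirac_solution_exists:
  fixes W :: "'a::euclidean_space \<Rightarrow> real \<Rightarrow> real"
  assumes Wm: "(\<lambda>(x, t). W x t) \<in> borel_measurable borel"
    and M: "0 \<le> M" and W: "\<And>x t. 0 \<le> W x t \<and> W x t \<le> M"
  shows "\<exists>w. dirac_solution T W y w"
proof -
  obtain w :: "'a \<Rightarrow> real \<Rightarrow> real" where wm: "(\<lambda>(x, t). w x t) \<in> borel_measurable borel"
    and w0: "\<And>x t. 0 \<le> w x t" and w_le: "\<And>x t. w x t \<le> heat_ker (x - y) t"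
    and mild: "\<And>x t. ennreal (w x t) = ennreal (damped_ker M (x - y) t) + heat_potential M (\<lambda>z s. ennreal ((M - W z s) * w z s)) x t"
    using mild_solution_exists[OF Wm M W, of y] by blast
  note [measurable (raw)] = measurable_curried[OF Wm] measurable_curried[OF wm]
  define q where "q = (\<lambda>z s. (M - W z s) * w z s)"
  have qm: "(\<lambda>(z, s). q z s) \<in> borel_measurable borel" unfolding q_def split_beta by measurable
  note [measurable (raw)] = measurable_curried[OF qm]
  have q0: "0 \<le> q z s" for z s using W[of z s] w0[of z s] by (simp add: q_def)
  have q_le: "q z s \<le> M * heat_ker (z - y) s" for z s
    unfolding q_def using W[of z s] w0[of z s] w_le[of z s] M by (intro mult_mono) auto
  have w_early: "w x t = 0" if "t \<le> 0" for x t using w_le[of x t] w0[of x t] that by simp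
  have cont: "continuous_on (Q_dom T) (\<lambda>(x, t). w x t)"
    unfolding continuous_on_sequentially
  proof (intro allI ballI impI)
    fix X :: "nat \<Rightarrow> 'a \<times> real" and p
    assume p: "p \<in> Q_dom T" and "(\<forall>n. X n \<in> Q_dom T) \<and> X \<longlonglongrightarrow> p"
    then have X: "X \<longlonglongrightarrow> p" by simp
    obtain x t where xt: "p = (x, t)" "0 < t" using p by (auto simp: Q_dom_def)
    have X1: "(\<lambda>n. fst (X n)) \<longlonglongrightarrow> x" and X2: "(\<lambda>n. snd (X n)) \<longlonglongrightarrow> t"
      using tendsto_fst[OF X] tendsto_snd[OF X] by (auto simp: xt)
    have "(\<lambda>n. heat_potential M (\<lambda>z s. ennreal (q z s)) (fst (X n)) (snd (X n))) \<longlonglongrightarrow> heat_potential M (\<lambda>z s. ennreal (q z s)) x t"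
    proof (rule heat_potential_tendsto[OF _ _ M M xt(2) X1 X2])
      show "(\<lambda>(z, s). ennreal (q z s)) \<in> borel_measurable borel" unfolding q_def split_beta by measurable
      show "ennreal (q z s) \<le> ennreal (M * heat_ker (z - y) s)" for z s by (intro ennreal_leI q_le)
    qed
    moreover have "(\<lambda>n. ennreal (damped_ker M (fst (X n) - y) (snd (X n)))) \<longlonglongrightarrow> ennreal (damped_ker M (x - y) t)"
      by (intro tendsto_ennrealI tendsto_damped_ker tendsto_intros X1 X2 xt(2))
    ultimately have "(\<lambda>n. ennreal (w (fst (X n)) (snd (X n)))) \<longlonglongrightarrow> ennreal (w x t)"
      unfolding mild[of "fst (X _)" "snd (X _)"] mild[of x t] q_def by (intro tendsto_add)
    then have "(\<lambda>n. w (fst (X n)) (snd (X n))) \<longlonglongrightarrow> w x t"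
      using w0 by (simp add: tendsto_ennreal_iff)
    then show "((\<lambda>(x, t). w x t) \<circ> X) \<longlonglongrightarrow> (\<lambda>(x, t). w x t) p"
      by (simp add: xt o_def split_beta)
  qed
  have weak: "(LINT (x, t) | lebesgue_on (Q_dom T).
           w x t * (- d_time \<phi> x t - laplace \<phi> x t + W x t * \<phi> x t)) = \<phi> y 0" if tf: "test_function T \<phi>" for \<phi>
  proof -
    define \<psi> where "\<psi> = (\<lambda>x t. - d_time \<phi> x t - laplace \<phi> x t + M * \<phi> x t)"
    obtain B where c\<psi>: "continuous_on UNIV (\<lambda>p. \<psi> (fst p) (snd p))" and c\<phi>: "continuous_on UNIV (\<lambda>p. \<phi> (fst p) (snd p))"
      and B: "\<And>x t. \<bar>\<phi> x t\<bar> \<le> B * indicator {..T} t" "\<And>x t. \<bar>\<psi> x t\<bar> \<le> B * indicator {..T} t" "0 \<le> B"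
      using test_function_bounds[OF tf \<psi>_def] by blast
    have [measurable]: "(\<lambda>p. \<psi> (fst p) (snd p)) \<in> borel_measurable borel" "(\<lambda>p. \<phi> (fst p) (snd p)) \<in> borel_measurable borel"
      using c\<psi> c\<phi> by (auto intro: borel_measurable_continuous_onI)
    note \<psi>m = this
    note rep = damped_ker_representation[OF tf M \<psi>_def]
    have strip: "integrable lborel (\<lambda>p. c * (heat_ker (fst p - y) (snd p) * indicator {..T} (snd p)))" for c
      using integrable_heat_ker_until[of y 0 T] by (intro integrable_mult_right) simp
    have int_bd: "integrable lborel f" if "f \<in> borel_measurable lborel"
      "\<And>p. \<bar>f p\<bar> \<le> c * (heat_ker (fst p - y) (snd p) * indicator {..T} (snd p))" for f c
      by (rule Bochner_Integration.integrable_bound[OF strip[of c] that(1)]) (use that(2) in \<open>force intro!: AE_I2 order_trans[OF _ abs_ge_self]\<close>)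
    define F where "F = (\<lambda>(p::'a \<times> real) (r::'a \<times> real). damped_ker M (fst p - fst r) (snd p - snd r) * q (fst r) (snd r) * \<psi> (fst p) (snd p))"
    have Fm: "case_prod F \<in> borel_measurable (lborel \<Otimes>\<^sub>M lborel)"
      unfolding F_def q_def split_beta by measurable
    have pot: "(\<integral>\<^sup>+r. ennreal (damped_ker M (x - fst r) (t - snd r) * q (fst r) (snd r)) \<partial>lborel)
       = heat_potential M (\<lambda>z s. ennreal (q z s)) x t" for x t
      unfolding heat_potential_def q_def
      by (subst nn_integral_space_time) (simp_all add: ennreal_mult' split_beta)
    have pot_le: "heat_potential M (\<lambda>z s. ennreal (q z s)) x t \<le> ennreal (heat_ker (x - y) t)" for x t
    proof -
      have "heat_potential M (\<lambda>z s. ennreal (q z s)) x t \<le> ennreal (w x t)"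
        unfolding mild[of x t] q_def by simp
      also have "\<dots> \<le> ennreal (heat_ker (x - y) t)" by (intro ennreal_leI w_le)
      finally show ?thesis .
    qed
    have iF: "integrable (lborel \<Otimes>\<^sub>M lborel) (case_prod F)"
    proof (rule integrableI_bounded[OF Fm])
      have "(\<integral>\<^sup>+z. ennreal (norm (case_prod F z)) \<partial>(lborel \<Otimes>\<^sub>M lborel)) = (\<integral>\<^sup>+p. \<integral>\<^sup>+r. ennreal (norm (F p r)) \<partial>lborel \<partial>lborel)"
        using Fm by (subst lborel.nn_integral_fst[symmetric]) auto
      also have "\<dots> \<le> (\<integral>\<^sup>+p. ennreal (B * (heat_ker (fst p - y) (snd p) * indicator {..T} (snd p))) \<partial>lborel)"
      proof (rule nn_integral_mono)
        fix p :: "'a \<times> real"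
        have "(\<integral>\<^sup>+r. ennreal (norm (F p r)) \<partial>lborel)
           = (\<integral>\<^sup>+r. ennreal \<bar>\<psi> (fst p) (snd p)\<bar> * ennreal (damped_ker M (fst p - fst r) (snd p - snd r) * q (fst r) (snd r)) \<partial>lborel)"
          using q0 by (intro nn_integral_cong) (simp add: F_def abs_mult mult_ac flip: ennreal_mult)
        also have "\<dots> = ennreal \<bar>\<psi> (fst p) (snd p)\<bar> * heat_potential M (\<lambda>z s. ennreal (q z s)) (fst p) (snd p)"
          unfolding pot[symmetric] by (rule nn_integral_cmult) measurable
        also have "\<dots> \<le> ennreal (B * indicator {..T} (snd p)) * ennreal (heat_ker (fst p - y) (snd p))"
          by (intro mult_mono ennreal_leI B pot_le) auto
        finally show "(\<integral>\<^sup>+r. ennreal (norm (F p r)) \<partial>lborel) \<le> ennreal (B * (heat_ker (fst p - y) (snd p) * indicator {..T} (snd p)))"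
          using B(3) by (simp add: mult_ac flip: ennreal_mult)
      qed
      also have "\<dots> < \<infinity>"
        using B(3) by (subst nn_integral_eq_integral[OF strip]) auto
      finally show "(\<integral>\<^sup>+z. ennreal (norm (case_prod F z)) \<partial>(lborel \<Otimes>\<^sub>M lborel)) < \<infinity>" .
    qed
    have w_eq: "w (fst p) (snd p) * \<psi> (fst p) (snd p) = damped_ker M (fst p - y) (snd p - 0) * \<psi> (fst p) (snd p) + (LINT r|lborel. F p r)" for p
    proof -
      have "(LINT r|lborel. damped_ker M (fst p - fst r) (snd p - snd r) * q (fst r) (snd r))
         = enn2real (heat_potential M (\<lambda>z s. ennreal (q z s)) (fst p) (snd p))"
        unfolding pot[symmetric]
        by (rule integral_eq_nn_integral) (use q0 in auto)
      moreover have "w (fst p) (snd p) = damped_ker M (fst p - y) (snd p) + enn2real (heat_potential M (\<lambda>z s. ennreal (q z s)) (fst p) (snd p))"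
      proof -
        have "heat_potential M (\<lambda>z s. ennreal (q z s)) (fst p) (snd p) < top"
          using pot_le[of "fst p" "snd p"] by (rule order_le_less_trans) simp
        then have "enn2real (ennreal (w (fst p) (snd p))) = enn2real (ennreal (damped_ker M (fst p - y) (snd p))) + enn2real (heat_potential M (\<lambda>z s. ennreal (q z s)) (fst p) (snd p))"
          unfolding mild[of "fst p" "snd p"] q_def by (intro enn2real_plus) auto
        then show ?thesis using w0 by simp
      qed
      ultimately show ?thesis by (simp add: F_def distrib_right)
    qed
    have "(LINT p|lborel. w (fst p) (snd p) * \<psi> (fst p) (snd p)) = \<phi> y 0 + (LINT p|lborel. LINT r|lborel. F p r)"
      unfolding w_eq rep(2)[of y 0, symmetric]
      by (rule Bochner_Integration.integral_add[OF rep(1)[of y 0] lborel_pair.integrable_fst[OF iF]])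
    also have "(LINT p|lborel. LINT r|lborel. F p r) = (LINT r|lborel. LINT p|lborel. F p r)"
      by (rule lborel_pair.Fubini_integral[OF iF, symmetric])
    also have "\<dots> = (LINT r|lborel. q (fst r) (snd r) * \<phi> (fst r) (snd r))"
    proof (rule Bochner_Integration.integral_cong[OF refl])
      fix r :: "'a \<times> real"
      have "(LINT p|lborel. F p r) = (LINT p|lborel. q (fst r) (snd r) * (damped_ker M (fst p - fst r) (snd p - snd r) * \<psi> (fst p) (snd p)))"
        unfolding F_def by (simp add: mult_ac)
      also have "\<dots> = q (fst r) (snd r) * \<phi> (fst r) (snd r)"
        using rep(2)[of "fst r" "snd r"] by simp
      finally show "(LINT p|lborel. F p r) = q (fst r) (snd r) * \<phi> (fst r) (snd r)" .
    qed
    finally have w\<psi>: "(LINT p|lborel. w (fst p) (snd p) * \<psi> (fst p) (snd p)) = \<phi> y 0 + (LINT r|lborel. q (fst r) (snd r) * \<phi> (fst r) (snd r))" .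
    have i1: "integrable lborel (\<lambda>p. w (fst p) (snd p) * \<psi> (fst p) (snd p))"
    proof (rule int_bd)
      fix p :: "'a \<times> real"
      have "\<bar>w (fst p) (snd p) * \<psi> (fst p) (snd p)\<bar> \<le> heat_ker (fst p - y) (snd p) * (B * indicator {..T} (snd p))"
        unfolding abs_mult using w0 w_le B by (intro mult_mono) auto
      then show "\<bar>w (fst p) (snd p) * \<psi> (fst p) (snd p)\<bar> \<le> B * (heat_ker (fst p - y) (snd p) * indicator {..T} (snd p))"
        by (simp add: mult_ac)
    qed measurable
    have i2: "integrable lborel (\<lambda>p. q (fst p) (snd p) * \<phi> (fst p) (snd p))"
    proof (rule int_bd)
      fix p :: "'a \<times> real"
      have "\<bar>q (fst p) (snd p) * \<phi> (fst p) (snd p)\<bar> \<le> M * heat_ker (fst p - y) (snd p) * (B * indicator {..T} (snd p))"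
        unfolding abs_mult using q0 q_le B M by (intro mult_mono) auto
      then show "\<bar>q (fst p) (snd p) * \<phi> (fst p) (snd p)\<bar> \<le> M * B * (heat_ker (fst p - y) (snd p) * indicator {..T} (snd p))"
        by (simp add: mult_ac)
    qed (unfold q_def, measurable)
    have ind: "indicator (Q_dom T) p * (case p of (x, t) \<Rightarrow> w x t * (- d_time \<phi> x t - laplace \<phi> x t + W x t * \<phi> x t))
      = w (fst p) (snd p) * \<psi> (fst p) (snd p) - q (fst p) (snd p) * \<phi> (fst p) (snd p)" for p
    proof -
      obtain x t where p: "p = (x, t)" by (cases p)
      consider "t \<le> 0" | "0 < t" "t \<le> T" | "T < t" by linarith
      then show ?thesis
      proof cases
        case 1
        then show ?thesis by (simp add: p w_early q_def Q_dom_def)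
      next
        case 2
        then show ?thesis by (simp add: p q_def \<psi>_def Q_dom_def algebra_simps)
      next
        case 3
        then have "\<psi> x t = 0" "\<phi> x t = 0" using B(1)[of x t] B(2)[of x t] by auto
        then show ?thesis using 3 by (simp add: p Q_dom_def)
      qed
    qed
    have "(LINT (x, t) | lebesgue_on (Q_dom T). w x t * (- d_time \<phi> x t - laplace \<phi> x t + W x t * \<phi> x t))
      = (LINT p|lborel. w (fst p) (snd p) * \<psi> (fst p) (snd p) - q (fst p) (snd p) * \<phi> (fst p) (snd p))"
    proof -
      have "(\<lambda>p. w (fst p) (snd p) * \<psi> (fst p) (snd p) - q (fst p) (snd p) * \<phi> (fst p) (snd p)) \<in> borel_measurable borel"
        unfolding q_def by measurable
      then show ?thesis by (subst integral_lebesgue_on_Q_dom) (simp_all only: ind)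
    qed
    also have "\<dots> = \<phi> y 0"
      using w\<psi> by (simp add: Bochner_Integration.integral_diff[OF i1 i2])
    finally show ?thesis .
  qed
  have "dirac_solution T W y w"
    unfolding dirac_solution_def
    using cont weak w0 w_le by (auto simp: heat_ker_def split: if_splits) (metis heat_ker_def w_le)
  then show ?thesis by blast
qed

section \<open>Vanishing of the singular heat kernel\<close>

lemma AE_space_time_slices:
  fixes P :: "'a::euclidean_space \<times> real \<Rightarrow> bool"
  assumes "AE p in lborel. P p"
  shows "AE s in lborel. AE z in lborel. P (z, s)"
proof -
  obtain N where N: "\<And>p. p \<notin> N \<Longrightarrow> P p" "N \<in> null_sets lborel"
    using AE_E3[OF assms] by auto
  have N': "N \<in> sets (lborel \<Otimes>\<^sub>M lborel)" using N(2) by (simp only: lborel_prod null_setsD2)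
  have "AE p in lborel \<Otimes>\<^sub>M lborel. p \<notin> N" unfolding lborel_prod by (rule AE_not_in[OF N(2)])
  then have "AE z in lborel. AE s in lborel. (z, s) \<notin> N" by (rule lborel_pair.AE_pair)
  moreover have "{p \<in> space (lborel \<Otimes>\<^sub>M lborel). (fst p, snd p) \<notin> N} \<in> sets (lborel \<Otimes>\<^sub>M lborel)"
  proof -
    have "{p \<in> space (lborel \<Otimes>\<^sub>M lborel). (fst p, snd p) \<notin> N} = space (lborel \<Otimes>\<^sub>M lborel) - N" by auto
    then show ?thesis using sets.compl_sets[OF N'] by (simp only:)
  qed
  from lborel_pair.AE_commute[OF this] have "(AE z in lborel. AE s in lborel. (z, s) \<notin> N) \<longleftrightarrow> (AE s in lborel. AE z in lborel. (z, s) \<notin> N)" .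
  ultimately have "AE s in lborel. AE z in lborel. (z, s) \<notin> N" by simp
  then show ?thesis using N(1) by (auto elim!: eventually_mono)
qed

text \<open>
  A Borel modification of \<open>V\<close>, clipped so that the bounds hold everywhere. It makes Tonelli's theorem available.
\<close>

lemma borel_representative_of_potential:
  fixes V :: "'a::euclidean_space \<Rightarrow> real \<Rightarrow> real"
  assumes Vm: "(\<lambda>(x, t). V x t) \<in> borel_measurable (lebesgue_on (Q_dom T))"
    and V: "AE (x, t) in lebesgue_on (Q_dom T). 0 \<le> V x t \<and> V x t \<le> C / t" and C: "0 < C"
  obtains U :: "'a \<Rightarrow> real \<Rightarrow> real" where "(\<lambda>(x, t). U x t) \<in> borel_measurable borel"
    "\<And>x t. 0 \<le> U x t" "\<And>x t. 0 < t \<Longrightarrow> U x t \<le> C / t" "\<And>x t. t \<le> 0 \<or> T < t \<Longrightarrow> U x t = 0"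
    "AE p in lborel. p \<in> Q_dom T \<longrightarrow> V (fst p) (snd p) = U (fst p) (snd p)"
proof -
  have Q: "Q_dom T \<inter> space lebesgue \<in> sets lebesgue" by simp
  have "(\<lambda>p. indicator (Q_dom T) p *\<^sub>R (\<lambda>(x, t). V x t) p) \<in> borel_measurable lebesgue"
    using Vm borel_measurable_restrict_space_iff[OF Q] by blast
  then obtain g where gm: "g \<in> borel_measurable lborel"
    and g: "AE p in lborel. indicator (Q_dom T) p *\<^sub>R (\<lambda>(x, t). V x t) p = g p"
    using completion_ex_borel_measurable_real by blast
  have [measurable]: "g \<in> borel_measurable borel" using gm by simp
  define U where "U = (\<lambda>x t. if 0 < t \<and> t \<le> T then max 0 (min (g (x, t)) (C / t)) else 0)"
  have V': "AE p in lborel. p \<in> Q_dom T \<longrightarrow> (0 \<le> V (fst p) (snd p) \<and> V (fst p) (snd p) \<le> C / snd p)"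
    using V unfolding split_beta AE_restrict_space_iff[OF Q] AE_completion_iff .
  show thesis
  proof (rule that[of U])
    show "(\<lambda>(x, t). U x t) \<in> borel_measurable borel" unfolding U_def split_beta prod.collapse by measurable
    show "0 \<le> U x t" for x t by (simp add: U_def)
    show "U x t \<le> C / t" if "0 < t" for x t using that C by (simp add: U_def)
    show "U x t = 0" if "t \<le> 0 \<or> T < t" for x t using that by (auto simp: U_def)
    show "AE p in lborel. p \<in> Q_dom T \<longrightarrow> V (fst p) (snd p) = U (fst p) (snd p)"
      using V' g
    proof eventually_elim
      case (elim p)
      then show ?case by (auto simp: U_def Q_dom_def)
    qed
  qed
qed

lemma continuous_Q_dom_lebesgue:
  assumes "continuous_on UNIV (\<lambda>p. f (fst p) (snd p))"
  shows "(\<lambda>p. f (fst p) (snd p)) \<in> borel_measurable (lebesgue_on (Q_dom T))"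
  by (rule continuous_imp_measurable_on_sets_lebesgue[OF continuous_on_subset[OF assms]]) auto

lemma dirac_solution_cong_AE:
  fixes V U :: "'a::euclidean_space \<Rightarrow> real \<Rightarrow> real"
  assumes Vm: "(\<lambda>p. V (fst p) (snd p)) \<in> borel_measurable (lebesgue_on (Q_dom T))"
    and Um: "(\<lambda>p. U (fst p) (snd p)) \<in> borel_measurable (lebesgue_on (Q_dom T))"
    and eq: "AE p in lebesgue_on (Q_dom T). V (fst p) (snd p) = U (fst p) (snd p)"
  shows "dirac_solution T V y w \<longleftrightarrow> dirac_solution T U y w"
proof -
  have "(LINT (x, t) | lebesgue_on (Q_dom T). w x t * (- d_time \<phi> x t - laplace \<phi> x t + V x t * \<phi> x t))
     = (LINT (x, t) | lebesgue_on (Q_dom T). w x t * (- d_time \<phi> x t - laplace \<phi> x t + U x t * \<phi> x t))"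
    if cont: "continuous_on (Q_dom T) (\<lambda>(x, t). w x t)" and tf: "test_function T \<phi>" for \<phi>
  proof -
    from tf obtain K where c: "continuous_on UNIV (\<lambda>p. \<phi> (fst p) (snd p))" "continuous_on UNIV (\<lambda>p. d_time \<phi> (fst p) (snd p))"
      "\<And>b. b \<in> Basis \<Longrightarrow> continuous_on UNIV (\<lambda>p. d_space b (d_space b \<phi>) (fst p) (snd p))"
      by (rule test_functionE) blast
    have l: "continuous_on UNIV (\<lambda>p. laplace \<phi> (fst p) (snd p))"
      unfolding laplace_def by (intro continuous_intros c)
    have [measurable]: "(\<lambda>p. w (fst p) (snd p)) \<in> borel_measurable (lebesgue_on (Q_dom T))"
      using continuous_imp_measurable_on_sets_lebesgue[OF cont] unfolding split_beta by auto
    note [measurable] = Vm Um continuous_Q_dom_lebesgue[OF c(1)] continuous_Q_dom_lebesgue[OF c(2)] continuous_Q_dom_lebesgue[OF l]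
    show ?thesis
      unfolding split_beta
    proof (rule integral_cong_AE)
      show "AE p in lebesgue_on (Q_dom T). w (fst p) (snd p) * (- d_time \<phi> (fst p) (snd p) - laplace \<phi> (fst p) (snd p) + V (fst p) (snd p) * \<phi> (fst p) (snd p))
        = w (fst p) (snd p) * (- d_time \<phi> (fst p) (snd p) - laplace \<phi> (fst p) (snd p) + U (fst p) (snd p) * \<phi> (fst p) (snd p))"
        using eq by eventually_elim simp
    qed measurable
  qed
  then show ?thesis unfolding dirac_solution_def by auto
qed

text \<open>
  The Gaussian of the hypothesis starts at time \<open>t\<close>, the one needed here starts at time 0. For \<open>s \<ge> 2 t\<close> the
  two are comparable, up to the factor \<open>2 powr (n/2)\<close>, and the times between \<open>t\<close> and \<open>2 t\<close> contribute at most \<open>C\<close>.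
\<close>

lemma gaussian_potential_integral_infinite:
  fixes V U :: "'a::euclidean_space \<Rightarrow> real \<Rightarrow> real"
  assumes Um: "(\<lambda>(x, t). U x t) \<in> borel_measurable borel"
    and U: "\<And>x t. 0 \<le> U x t" "\<And>x t. 0 < t \<Longrightarrow> U x t \<le> C / t"
    and C: "0 < C" and T: "0 < T"
    and VU: "AE p in lborel. p \<in> Q_dom T \<longrightarrow> V (fst p) (snd p) = U (fst p) (snd p)"
    and inf: "Limsup (at_right 0) (\<lambda>t. \<integral>\<^sup>+ s. (\<integral>\<^sup>+ y.
            ennreal ((1 / (4 * pi * (s - t))) powr (real DIM('a) / 2)
              * exp (- (norm (\<xi> - y))\<^sup>2 / (4 * (s - t))) * V y s)
          \<partial>lebesgue) \<partial>lebesgue_on {t..T}) = \<infinity>"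
  shows "(\<integral>\<^sup>+s. \<integral>\<^sup>+z. ennreal (U z s * heat_ker (z - \<xi>) s) \<partial>lborel \<partial>lborel) = \<infinity>"
proof (rule ccontr)
  note [measurable (raw)] = measurable_curried[OF Um]
  define Z where "Z = (\<integral>\<^sup>+s. \<integral>\<^sup>+z. ennreal (U z s * heat_ker (z - \<xi>) s) \<partial>lborel \<partial>lborel)"
  define c where "c = 2 powr (real DIM('a) / 2)"
  assume "(\<integral>\<^sup>+s. \<integral>\<^sup>+z. ennreal (U z s * heat_ker (z - \<xi>) s) \<partial>lborel \<partial>lborel) \<noteq> \<infinity>"
  then have fin: "ennreal C + ennreal c * Z < \<infinity>"
    by (auto simp: Z_def less_top[symmetric] ennreal_mult_eq_top_iff)
  have slices: "AE s in lborel. AE z in lborel. (z, s) \<in> Q_dom T \<longrightarrow> V z s = U z s"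
    using AE_space_time_slices[OF VU] by simp
  have bound: "(\<integral>\<^sup>+ s. (\<integral>\<^sup>+ y. ennreal ((1 / (4 * pi * (s - t))) powr (real DIM('a) / 2)
              * exp (- (norm (\<xi> - y))\<^sup>2 / (4 * (s - t))) * V y s) \<partial>lebesgue) \<partial>lebesgue_on {t..T})
     \<le> ennreal C + ennreal c * Z" if t: "0 < t" for t
  proof -
    have "(\<integral>\<^sup>+ s. (\<integral>\<^sup>+ y. ennreal ((1 / (4 * pi * (s - t))) powr (real DIM('a) / 2)
              * exp (- (norm (\<xi> - y))\<^sup>2 / (4 * (s - t))) * V y s) \<partial>lebesgue) \<partial>lebesgue_on {t..T})
      = (\<integral>\<^sup>+ s. (\<integral>\<^sup>+ y. ennreal (gauss_kernel (\<xi> - y) (s - t) * V y s) \<partial>lborel) * indicator {t..T} s \<partial>lborel)"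
      by (simp add: nn_integral_restrict_space nn_integral_completion gauss_kernel_def)
    also have "\<dots> \<le> (\<integral>\<^sup>+ s. ennreal (C / t) * indicator {t..2 * t} s
         + ennreal c * (\<integral>\<^sup>+z. ennreal (U z s * heat_ker (z - \<xi>) s) \<partial>lborel) \<partial>lborel)"
    proof (rule nn_integral_mono_AE)
      show "AE s in lborel. (\<integral>\<^sup>+ y. ennreal (gauss_kernel (\<xi> - y) (s - t) * V y s) \<partial>lborel) * indicator {t..T} s
        \<le> ennreal (C / t) * indicator {t..2 * t} s + ennreal c * (\<integral>\<^sup>+z. ennreal (U z s * heat_ker (z - \<xi>) s) \<partial>lborel)"
        using slices AE_lborel_singleton[of t]
      proof eventually_elim
        case (elim s)
        show ?case
        proof (cases "t \<le> s \<and> s \<le> T")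
          case True
          then have s: "0 < s" "t < s" "s \<le> T" using t elim(2) by auto
          have "(\<integral>\<^sup>+ y. ennreal (gauss_kernel (\<xi> - y) (s - t) * V y s) \<partial>lborel) = (\<integral>\<^sup>+ y. ennreal (heat_ker (\<xi> - y) (s - t) * U y s) \<partial>lborel)"
          proof (rule nn_integral_cong_AE)
            show "AE y in lborel. ennreal (gauss_kernel (\<xi> - y) (s - t) * V y s) = ennreal (heat_ker (\<xi> - y) (s - t) * U y s)"
              using elim(1) by eventually_elim (use s in \<open>simp add: Q_dom_def heat_ker_def\<close>)
          qed
          also have "\<dots> \<le> ennreal (C / t) * indicator {t..2 * t} s + ennreal c * (\<integral>\<^sup>+z. ennreal (U z s * heat_ker (z - \<xi>) s) \<partial>lborel)"
          proof (cases "s \<le> 2 * t")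
            case True
            have "(\<integral>\<^sup>+ y. ennreal (heat_ker (\<xi> - y) (s - t) * U y s) \<partial>lborel) \<le> (\<integral>\<^sup>+ y. ennreal (C / t) * ennreal (heat_ker (\<xi> - y) (s - t)) \<partial>lborel)"
            proof (rule nn_integral_mono)
              fix y
              have "U y s \<le> C / s" using U(2) s by auto
              also have "\<dots> \<le> C / t" using s t C by (intro divide_left_mono) auto
              finally have "heat_ker (\<xi> - y) (s - t) * U y s \<le> heat_ker (\<xi> - y) (s - t) * (C / t)"
                by (intro mult_left_mono) auto
              then show "ennreal (heat_ker (\<xi> - y) (s - t) * U y s) \<le> ennreal (C / t) * ennreal (heat_ker (\<xi> - y) (s - t))"
                using C t by (simp add: mult.commute ennreal_leI flip: ennreal_mult)
            qed
            also have "\<dots> = ennreal (C / t)" using s by (simp add: nn_integral_cmult nn_integral_heat_ker_shift)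
            finally show ?thesis using True s by (simp add: add_increasing2)
          next
            case False
            have "(\<integral>\<^sup>+ y. ennreal (heat_ker (\<xi> - y) (s - t) * U y s) \<partial>lborel) \<le> (\<integral>\<^sup>+ y. ennreal c * ennreal (U y s * heat_ker (y - \<xi>) s) \<partial>lborel)"
            proof (rule nn_integral_mono)
              fix y
              have "heat_ker (\<xi> - y) (s - t) * U y s \<le> (c * heat_ker (\<xi> - y) s) * U y s"
                unfolding c_def using s t False U(1) by (intro mult_right_mono heat_ker_compare) auto
              then show "ennreal (heat_ker (\<xi> - y) (s - t) * U y s) \<le> ennreal c * ennreal (U y s * heat_ker (y - \<xi>) s)"
                using U(1)[of y s] by (simp add: c_def mult_ac heat_ker_minus[of y] ennreal_leI flip: ennreal_mult)
            qed
            also have "\<dots> = ennreal c * (\<integral>\<^sup>+z. ennreal (U z s * heat_ker (z - \<xi>) s) \<partial>lborel)"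
              by (rule nn_integral_cmult) measurable
            finally show ?thesis by (simp add: add_increasing)
          qed
          finally show ?thesis using True by simp
        qed auto
      qed
    qed
    also have "\<dots> = ennreal C + ennreal c * Z"
      using t C by (simp add: nn_integral_add nn_integral_cmult Z_def flip: ennreal_mult)
    finally show ?thesis .
  qed
  have "Limsup (at_right 0) (\<lambda>t. \<integral>\<^sup>+ s. (\<integral>\<^sup>+ y.
            ennreal ((1 / (4 * pi * (s - t))) powr (real DIM('a) / 2)
              * exp (- (norm (\<xi> - y))\<^sup>2 / (4 * (s - t))) * V y s)
          \<partial>lebesgue) \<partial>lebesgue_on {t..T}) \<le> ennreal C + ennreal c * Z"
    by (rule Limsup_bounded) (use bound in \<open>auto simp: eventually_at_right_less eventually_at_filter\<close>)
  then show False using inf fin by (simp add: top_unique)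
qed

text \<open>
  The mass estimate is applied up to time \<open>t/2\<close>, and the heat flow from \<open>t/2\<close> to \<open>t\<close> turns the bound on the
  mass into a pointwise one.
\<close>

lemma heat_kernel_decay_bound:
  fixes U w :: "'a::euclidean_space \<Rightarrow> real \<Rightarrow> real"
  assumes Um: "(\<lambda>(x, t). U x t) \<in> borel_measurable borel"
    and U: "\<And>x t. 0 \<le> U x t" "\<And>x t. 0 < t \<Longrightarrow> U x t \<le> C / t"
    and C: "0 < C" and \<delta>: "0 < \<delta>" and t: "0 < t" "t \<le> T" and \<epsilon>: "0 < \<epsilon>"
    and sol: "dirac_solution T (cut_potential U \<delta>) \<xi> w"
    and L: "L = C * sqrt (2 ^ (DIM('a) + 1))"
    and I: "I = (\<integral>\<^sup>+s. \<integral>\<^sup>+z. ennreal (U z s * heat_ker (z - \<xi>) s) * indicator {\<delta><..<t / 2} s \<partial>lborel \<partial>lborel)"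
  shows "I < \<infinity>"
    and "ennreal (w x t) * I \<le> ennreal ((2 * pi * t) powr (- (real DIM('a) / 2))) * (ennreal (1 + C + 2 * L / \<epsilon>) + ennreal (2 * L * \<epsilon>) * I)"
proof -
  note [measurable (raw)] = measurable_curried[OF Um]
  define r where "r = t / 2"
  have r: "0 < r" "r < t" "r \<le> T" using t by (auto simp: r_def)
  define W where "W = cut_potential U \<delta>"
  define W' where "W' = (\<lambda>x s. if s < r then W x s else 0)"
  have Wm: "(\<lambda>(x, t). W x t) \<in> borel_measurable borel"
    unfolding W_def cut_potential_def split_beta by measurable
  have W'm: "(\<lambda>(x, t). W' x t) \<in> borel_measurable borel"
    unfolding W'_def W_def cut_potential_def split_beta by measurable
  have W_le: "0 \<le> W x s \<and> W x s \<le> C / \<delta>" for x s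
  proof (cases "\<delta> < s")
    case True
    then have "U x s \<le> C / s" using U(2)[of s x] \<delta> by simp
    also have "\<dots> \<le> C / \<delta>" using True \<delta> C by (intro divide_left_mono) auto
    finally show ?thesis using U(1)[of x s] True by (simp add: W_def cut_potential_def)
  qed (use \<delta> C in \<open>simp add: W_def cut_potential_def\<close>)
  have W'_le: "0 \<le> W' x s \<and> W' x s \<le> C / s" if "0 < s" for x s
    using U(1)[of x s] U(2)[OF that, of x] that C by (simp add: W'_def W_def cut_potential_def)
  define u where "u = on_Q T w"
  have cont: "continuous_on (Q_dom T) (\<lambda>(x, t). w x t)"
    and w: "\<And>x t. 0 < t \<Longrightarrow> t \<le> T \<Longrightarrow> 0 \<le> w x t \<and> w x t \<le> gauss_kernel (x - \<xi>) t"
    using sol unfolding dirac_solution_def by auto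
  have um: "(\<lambda>(x, t). u x t) \<in> borel_measurable borel"
    unfolding u_def by (rule on_Q_measurable[OF cont])
  have u: "0 \<le> u x s \<and> u x s \<le> heat_ker (x - \<xi>) s" for x s
    using w[of s x] by (auto simp: u_def on_Q_def heat_ker_def gauss_kernel_def)
  note [measurable (raw)] = measurable_curried[OF Wm] measurable_curried[OF um]
  have duh: "ennreal (u x s) + heat_potential 0 (\<lambda>z s. ennreal (W z s * u z s)) x s = ennreal (heat_ker (x - \<xi>) s)"
    if "0 < s" "s \<le> T" for x s
    using dirac_solution_duhamel[OF Wm W_le sol[folded W_def] that, of x] that by (simp add: u_def on_Q_def)
  have duh': "ennreal (u x s) + (\<integral>\<^sup>+s'. \<integral>\<^sup>+z. ennreal (heat_ker (x - z) (s - s')) * ennreal (W' z s' * u z s') \<partial>lborel \<partial>lborel)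
     = ennreal (heat_ker (x - \<xi>) s)" if "0 < s" "s \<le> r" for x s
  proof -
    have "(\<integral>\<^sup>+s'. \<integral>\<^sup>+z. ennreal (heat_ker (x - z) (s - s')) * ennreal (W' z s' * u z s') \<partial>lborel \<partial>lborel)
      = heat_potential 0 (\<lambda>z s. ennreal (W z s * u z s)) x s"
      unfolding heat_potential_def damped_ker_zero
    proof (intro nn_integral_cong)
      fix s' z
      show "ennreal (heat_ker (x - z) (s - s')) * ennreal (W' z s' * u z s') = ennreal (heat_ker (x - z) (s - s')) * ennreal (W z s' * u z s')"
        using that by (cases "s' < s") (auto simp: W'_def)
    qed
    then show ?thesis using duh[of s x] that r by simp
  qed
  have I': "I = (\<integral>\<^sup>+s. \<integral>\<^sup>+x. ennreal (W' x s * heat_ker (x - \<xi>) s) \<partial>lborel \<partial>lborel)"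
    unfolding I by (intro nn_integral_cong) (auto simp: W'_def W_def cut_potential_def indicator_def r_def)
  show I_fin: "I < \<infinity>"
  proof -
    have "I \<le> (\<integral>\<^sup>+s. ennreal (C / \<delta>) * indicator {0..r} s \<partial>lborel)"
      unfolding I'
    proof (rule nn_integral_mono)
      fix s
      show "(\<integral>\<^sup>+x. ennreal (W' x s * heat_ker (x - \<xi>) s) \<partial>lborel) \<le> ennreal (C / \<delta>) * indicator {0..r} s"
      proof (cases "0 < s \<and> s < r")
        case True
        have "(\<integral>\<^sup>+x. ennreal (W' x s * heat_ker (x - \<xi>) s) \<partial>lborel) \<le> (\<integral>\<^sup>+x. ennreal (C / \<delta>) * ennreal (heat_ker (x - \<xi>) s) \<partial>lborel)"
        proof (rule nn_integral_mono)
          fix x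
          have "W' x s * heat_ker (x - \<xi>) s \<le> C / \<delta> * heat_ker (x - \<xi>) s"
            using W_le[of x s] True by (intro mult_right_mono) (auto simp: W'_def)
          then show "ennreal (W' x s * heat_ker (x - \<xi>) s) \<le> ennreal (C / \<delta>) * ennreal (heat_ker (x - \<xi>) s)"
            using C \<delta> by (simp add: ennreal_leI flip: ennreal_mult)
        qed
        then show ?thesis using True by (simp add: nn_integral_cmult nn_integral_heat_ker_shift)
      next
        case False
        then have "s \<le> 0 \<or> r \<le> s" by auto
        then show ?thesis using \<delta> by (auto simp: W'_def W_def cut_potential_def)
      qed
    qed
    also have "\<dots> < \<infinity>" using r by (simp add: nn_integral_cmult_indicator ennreal_mult_less_top)
    finally show ?thesis .
  qed
  have mass: "(\<integral>\<^sup>+z. ennreal (u z r) \<partial>lborel) * I \<le> ennreal (1 + C + 2 * L / \<epsilon>) + ennreal (2 * L * \<epsilon>) * I"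
  proof (rule mass_times_potential_bound[OF W'm um _ r(1) \<epsilon> W'_le _ _ u duh' L I' I_fin])
    show "0 \<le> C" using C by simp
    show "W' x s = 0" if "r \<le> s" for x s using that by (simp add: W'_def)
    show "W' x s = 0" if "s \<le> 0" for x s using that \<delta> by (simp add: W'_def W_def cut_potential_def)
  qed
  define c where "c = (2 * pi * t) powr (- (real DIM('a) / 2))"
  have "ennreal (u x t) \<le> (\<integral>\<^sup>+z. ennreal (heat_ker (x - z) (t - r)) * ennreal (u z r) \<partial>lborel)"
  proof (rule duhamel_pointwise_le[OF _ um r(1,2) duh[OF t] duh[OF r(1,3)]])
    show "(\<lambda>(z, s). ennreal (W z s * u z s)) \<in> borel_measurable borel" unfolding split_beta by measurable
  qed
  also have "\<dots> \<le> (\<integral>\<^sup>+z. ennreal c * ennreal (u z r) \<partial>lborel)"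
  proof (intro nn_integral_mono mult_right_mono ennreal_leI)
    fix z
    have "heat_ker (x - z) (t - r) \<le> (4 * pi * (t - r)) powr (- (real DIM('a) / 2))"
      by (rule heat_ker_le) (use r in simp)
    also have "4 * pi * (t - r) = 2 * pi * t" by (simp add: r_def)
    finally show "heat_ker (x - z) (t - r) \<le> c" unfolding c_def .
  qed simp
  also have "\<dots> = ennreal c * (\<integral>\<^sup>+z. ennreal (u z r) \<partial>lborel)" by (rule nn_integral_cmult) measurable
  finally have "ennreal (w x t) \<le> ennreal c * (\<integral>\<^sup>+z. ennreal (u z r) \<partial>lborel)" using t by (simp add: u_def on_Q_def)
  then have "ennreal (w x t) * I \<le> ennreal c * (\<integral>\<^sup>+z. ennreal (u z r) \<partial>lborel) * I" by (rule mult_right_mono) simp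
  also have "\<dots> = ennreal c * ((\<integral>\<^sup>+z. ennreal (u z r) \<partial>lborel) * I)" by (simp add: mult.assoc)
  also have "\<dots> \<le> ennreal c * (ennreal (1 + C + 2 * L / \<epsilon>) + ennreal (2 * L * \<epsilon>) * I)"
    by (rule mult_left_mono[OF mass]) simp
  finally show "ennreal (w x t) * I \<le> ennreal ((2 * pi * t) powr (- (real DIM('a) / 2))) * (ennreal (1 + C + 2 * L / \<epsilon>) + ennreal (2 * L * \<epsilon>) * I)"
    unfolding c_def .
qed

text \<open>
  The times after \<open>r\<close> contribute a finite amount because of \<open>U \<le> C/t\<close>, so the divergence comes from the times near
  0; monotone convergence as \<open>\<delta>\<close> decreases.
\<close>

lemma truncated_potential_integral_unbounded:
  fixes U :: "'a::euclidean_space \<Rightarrow> real \<Rightarrow> real"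
  assumes Um: "(\<lambda>(x, t). U x t) \<in> borel_measurable borel"
    and U: "\<And>x t. 0 \<le> U x t" "\<And>x t. 0 < t \<Longrightarrow> U x t \<le> C / t" "\<And>x t. T < t \<Longrightarrow> U x t = 0"
    and C: "0 < C" and r: "0 < r"
    and inf: "(\<integral>\<^sup>+s. \<integral>\<^sup>+z. ennreal (U z s * heat_ker (z - \<xi>) s) \<partial>lborel \<partial>lborel) = \<infinity>"
    and N: "N < \<infinity>"
  shows "eventually (\<lambda>\<delta>. N < (\<integral>\<^sup>+s. \<integral>\<^sup>+z. ennreal (U z s * heat_ker (z - \<xi>) s) * indicator {\<delta><..<r} s \<partial>lborel \<partial>lborel)) (at_right 0)"
proof -
  note [measurable (raw)] = measurable_curried[OF Um]
  define F where "F = (\<lambda>s. \<integral>\<^sup>+z. ennreal (U z s * heat_ker (z - \<xi>) s) \<partial>lborel)"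
  have [measurable]: "F \<in> borel_measurable borel" unfolding F_def by measurable
  define J where "J = (\<lambda>\<delta>. \<integral>\<^sup>+s. F s * indicator {\<delta><..<r} s \<partial>lborel)"
  have J: "(\<integral>\<^sup>+s. \<integral>\<^sup>+z. ennreal (U z s * heat_ker (z - \<xi>) s) * indicator {\<delta><..<r} s \<partial>lborel \<partial>lborel) = J \<delta>" for \<delta>
    unfolding J_def F_def by (simp add: nn_integral_multc)
  have F_early: "F s = 0" if "s \<le> 0" for s using that by (simp add: F_def)
  have F_late: "F s \<le> ennreal (C / r) * indicator {r..T} s" if "r \<le> s" for s
  proof (cases "s \<le> T")
    case True
    have "F s \<le> (\<integral>\<^sup>+z. ennreal (C / r) * ennreal (heat_ker (z - \<xi>) s) \<partial>lborel)"
      unfolding F_def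
    proof (rule nn_integral_mono)
      fix z
      have "U z s \<le> C / s" using U(2)[of s z] that r by simp
      also have "\<dots> \<le> C / r" using that r C by (intro divide_left_mono) auto
      finally have "U z s * heat_ker (z - \<xi>) s \<le> C / r * heat_ker (z - \<xi>) s" by (rule mult_right_mono) simp
      then show "ennreal (U z s * heat_ker (z - \<xi>) s) \<le> ennreal (C / r) * ennreal (heat_ker (z - \<xi>) s)"
        using C r by (simp add: ennreal_leI flip: ennreal_mult)
    qed
    then show ?thesis using that r True by (simp add: nn_integral_cmult nn_integral_heat_ker_shift)
  next
    case False
    then show ?thesis using U(3)[of s] by (simp add: F_def)
  qed
  have J0: "J 0 = \<infinity>"
  proof (rule ccontr)
    assume "J 0 \<noteq> \<infinity>"
    have "(\<integral>\<^sup>+s. F s \<partial>lborel) \<le> (\<integral>\<^sup>+s. F s * indicator {0<..<r} s + ennreal (C / r) * indicator {r..T} s \<partial>lborel)"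
    proof (rule nn_integral_mono)
      fix s
      consider "s \<le> 0" | "0 < s" "s < r" | "r \<le> s" by linarith
      then show "F s \<le> F s * indicator {0<..<r} s + ennreal (C / r) * indicator {r..T} s"
      proof cases
        case 3
        then show ?thesis using F_late[OF 3] by (simp add: add_increasing)
      qed (simp_all add: F_early)
    qed
    also have "\<dots> = J 0 + ennreal (C / r) * emeasure lborel {r..T}"
      unfolding J_def by (simp add: nn_integral_add nn_integral_cmult_indicator)
    also have "\<dots> < \<infinity>"
    proof -
      have "emeasure lborel {r..T} < \<infinity>" by (cases "r \<le> T") auto
      then show ?thesis using \<open>J 0 \<noteq> \<infinity>\<close> by (auto simp: less_top[symmetric] ennreal_mult_eq_top_iff)
    qed
    finally show False using inf by (simp add: F_def)
  qed
  have sup: "(SUP n. J (inverse (real (Suc n)))) = J 0"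
  proof -
    have mono: "incseq (\<lambda>n s. F s * indicator {inverse (real (Suc n))<..<r} s)"
    proof (rule incseq_SucI, rule le_funI)
      fix n s
      have le: "inverse (real (Suc (Suc n))) \<le> inverse (real (Suc n))" by (intro le_imp_inverse_le) auto
      show "F s * indicator {inverse (real (Suc n))<..<r} s \<le> F s * indicator {inverse (real (Suc (Suc n)))<..<r} s"
        by (intro mult_left_mono) (auto simp: indicator_def simp del: of_nat_Suc intro: order_le_less_trans[OF le])
    qed
    have "(SUP n. J (inverse (real (Suc n)))) = (\<integral>\<^sup>+s. (SUP n. F s * indicator {inverse (real (Suc n))<..<r} s) \<partial>lborel)"
      unfolding J_def by (rule nn_integral_monotone_convergence_SUP[symmetric, OF mono]) measurable
    also have "\<dots> = J 0"
      unfolding J_def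
    proof (intro nn_integral_cong)
      fix s
      have inc: "incseq (\<lambda>n. F s * indicator {inverse (real (Suc n))<..<r} s)"
        using mono by (auto simp: incseq_def le_fun_def)
      have "(\<lambda>n. F s * indicator {inverse (real (Suc n))<..<r} s) \<longlonglongrightarrow> F s * indicator {0<..<r} s"
      proof (cases "0 < s")
        case True
        have "eventually (\<lambda>n. inverse (real (Suc n)) < s) sequentially"
          by (rule order_tendstoD(2)[OF LIMSEQ_inverse_real_of_nat True])
        then have "eventually (\<lambda>n. F s * indicator {inverse (real (Suc n))<..<r} s = F s * indicator {0<..<r} s) sequentially"
          by eventually_elim (use True in \<open>auto simp: indicator_def\<close>)
        then show ?thesis by (rule tendsto_eventually)
      qed (simp add: F_early)
      from LIMSEQ_unique[OF LIMSEQ_SUP[OF inc] this]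
      show "(SUP n. F s * indicator {inverse (real (Suc n))<..<r} s) = F s * indicator {0<..<r} s" .
    qed
    finally show ?thesis .
  qed
  have "N < (SUP n. J (inverse (real (Suc n))))" unfolding sup using J0 N by simp
  then obtain n where n: "N < J (inverse (real (Suc n)))" by (auto simp: less_SUP_iff)
  have "eventually (\<lambda>\<delta>. \<delta> \<in> {0<..<inverse (real (Suc n))}) (at_right 0)"
    by (rule eventually_at_right_real) simp
  then have "eventually (\<lambda>\<delta>. N < J \<delta>) (at_right 0)"
  proof eventually_elim
    case (elim \<delta>)
    have "J (inverse (real (Suc n))) \<le> J \<delta>"
      unfolding J_def by (intro nn_integral_mono mult_left_mono) (use elim in \<open>auto simp: indicator_def\<close>)
    with n show ?case by (rule less_le_trans)
  qed
  then show ?thesis by (simp add: J)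
qed

theorem theoremF:
  fixes V :: "'a::euclidean_space \<Rightarrow> real \<Rightarrow> real" and \<xi> :: 'a and T C\<^sub>1 :: real
  assumes "T > 0"
    and "Linf_loc T V"
    and "C\<^sub>1 > 0"
    and "AE (x, t) in lebesgue_on (Q_dom T). 0 \<le> V x t \<and> V x t \<le> C\<^sub>1 / t"
    and "Limsup (at_right 0) (\<lambda>t. \<integral>\<^sup>+ s. (\<integral>\<^sup>+ y.
            ennreal ((1 / (4 * pi * (s - t))) powr (real DIM('a) / 2)
              * exp (- (norm (\<xi> - y))\<^sup>2 / (4 * (s - t))) * V y s)
          \<partial>lebesgue) \<partial>lebesgue_on {t..T}) = \<infinity>"
  shows "\<xi> \<in> Sing_set T V"
proof -
  have Vm: "(\<lambda>(x, t). V x t) \<in> borel_measurable (lebesgue_on (Q_dom T))"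
    using assms(2) by (simp add: Linf_loc_def)
  obtain U where Um: "(\<lambda>(x, t). U x t) \<in> borel_measurable borel"
    and U: "\<And>x t. 0 \<le> U x t" "\<And>x t. 0 < t \<Longrightarrow> U x t \<le> C\<^sub>1 / t" "\<And>x t. t \<le> 0 \<or> T < t \<Longrightarrow> U x t = 0"
    and VU: "AE p in lborel. p \<in> Q_dom T \<longrightarrow> V (fst p) (snd p) = U (fst p) (snd p)"
    by (rule borel_representative_of_potential[OF Vm assms(4,3)]) blast
  note inf = gaussian_potential_integral_infinite[OF Um U(1,2) assms(3,1) VU assms(5)]
  \<comment> \<open>The heat kernel is a chosen weak solution; existence makes the choice meaningful.\<close>
  have sol: "dirac_solution T (cut_potential U \<delta>) \<xi> (\<lambda>x t. heat_kernel T (cut_potential V \<delta>) x \<xi> t)" if \<delta>: "0 < \<delta>" for \<delta>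
  proof -
    have Q: "Q_dom T \<inter> space lebesgue \<in> sets lebesgue" by simp
    note [measurable (raw)] = measurable_curried[OF Um]
    have Ucm: "(\<lambda>p. cut_potential U \<delta> (fst p) (snd p)) \<in> borel_measurable borel"
      unfolding cut_potential_def by measurable
    have sndm: "(\<lambda>p. snd p) \<in> borel_measurable (lebesgue_on (Q_dom T))"
      by (rule continuous_Q_dom_lebesgue[of "\<lambda>x t. t"]) (intro continuous_intros)
    have "dirac_solution T (cut_potential V \<delta>) \<xi> w \<longleftrightarrow> dirac_solution T (cut_potential U \<delta>) \<xi> w" for w
    proof (rule dirac_solution_cong_AE)
      have [measurable]: "(\<lambda>p. V (fst p) (snd p)) \<in> borel_measurable (lebesgue_on (Q_dom T))"
        using Vm unfolding split_beta .
      note [measurable] = sndm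
      show "(\<lambda>p. cut_potential V \<delta> (fst p) (snd p)) \<in> borel_measurable (lebesgue_on (Q_dom T))"
        unfolding cut_potential_def by measurable
      show "(\<lambda>p. cut_potential U \<delta> (fst p) (snd p)) \<in> borel_measurable (lebesgue_on (Q_dom T))"
        by (rule measurable_restrict_space1[OF measurable_completion]) (simp add: Ucm)
      show "AE p in lebesgue_on (Q_dom T). cut_potential V \<delta> (fst p) (snd p) = cut_potential U \<delta> (fst p) (snd p)"
        unfolding AE_restrict_space_iff[OF Q] AE_completion_iff
        using VU by eventually_elim (simp add: cut_potential_def)
    qed
    moreover have "\<exists>w. dirac_solution T (cut_potential U \<delta>) \<xi> w"
    proof (rule dirac_solution_exists[where M = "C\<^sub>1 / \<delta>"])
      show "(\<lambda>(x, t). cut_potential U \<delta> x t) \<in> borel_measurable borel" using Ucm by (simp add: split_beta)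
      show "0 \<le> C\<^sub>1 / \<delta>" using assms(3) \<delta> by simp
      show "0 \<le> cut_potential U \<delta> x t \<and> cut_potential U \<delta> x t \<le> C\<^sub>1 / \<delta>" for x t
      proof (cases "\<delta> < t")
        case True
        then have "U x t \<le> C\<^sub>1 / t" using U(2)[of t x] \<delta> by simp
        also have "\<dots> \<le> C\<^sub>1 / \<delta>" using True \<delta> assms(3) by (intro divide_left_mono) auto
        finally show ?thesis using U(1)[of x t] True by (simp add: cut_potential_def)
      qed (use \<delta> assms(3) in \<open>simp add: cut_potential_def\<close>)
    qed
    ultimately have "dirac_solution T (cut_potential U \<delta>) \<xi> (SOME w. dirac_solution T (cut_potential V \<delta>) \<xi> w)"
      by (simp add: someI_ex)
    then show ?thesis unfolding heat_kernel_def by simp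
  qed
  have "sing_heat_kernel T V x \<xi> t = 0" if t: "0 < t" "t \<le> T" for x t
  proof -
    define w where "w = (\<lambda>\<delta>. heat_kernel T (cut_potential V \<delta>) x \<xi> t)"
    define L where "L = C\<^sub>1 * sqrt (2 ^ (DIM('a) + 1))"
    define c where "c = (2 * pi * t) powr (- (real DIM('a) / 2))"
    define I where "I = (\<lambda>\<delta>. \<integral>\<^sup>+s. \<integral>\<^sup>+z. ennreal (U z s * heat_ker (z - \<xi>) s) * indicator {\<delta><..<t / 2} s \<partial>lborel \<partial>lborel)"
    have L0: "0 < L" using assms(3) by (simp add: L_def)
    have c0: "0 < c" using t by (simp add: c_def)
    have small: "eventually (\<lambda>\<delta>. \<bar>w \<delta>\<bar> < \<eta>) (at_right 0)" if \<eta>: "0 < \<eta>" for \<eta>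
    proof -
      \<comment> \<open>With this choice \<open>2 c L \<epsilon> = \<eta>/2\<close>, and the remaining term \<open>c A / I \<delta>\<close> is below \<open>\<eta>/2\<close> once \<open>I \<delta>\<close> is large.\<close>
      define \<epsilon> where "\<epsilon> = \<eta> / (4 * c * L)"
      define A where "A = 1 + C\<^sub>1 + 2 * L / \<epsilon>"
      have \<epsilon>0: "0 < \<epsilon>" using \<eta> c0 L0 by (simp add: \<epsilon>_def)
      have A0: "0 < A" using assms(3) L0 \<epsilon>0 by (simp add: A_def add_pos_pos)
      have ev1: "eventually (\<lambda>\<delta>. ennreal (2 * c * A / \<eta>) < I \<delta>) (at_right 0)"
        unfolding I_def
        by (rule truncated_potential_integral_unbounded[OF Um U(1,2) _ assms(3) _ inf]) (use U(3) t in auto)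
      have ev2: "eventually (\<lambda>\<delta>::real. 0 < \<delta>) (at_right 0)" by (rule eventually_at_right_less)
      show ?thesis using ev1 ev2
      proof eventually_elim
        case (elim \<delta>)
        have b: "I \<delta> < \<infinity>" "ennreal (w \<delta>) * I \<delta> \<le> ennreal c * (ennreal A + ennreal (2 * L * \<epsilon>) * I \<delta>)"
          using heat_kernel_decay_bound[OF Um U(1,2) assms(3) elim(2) t \<epsilon>0 sol[OF elim(2)] L_def refl]
          unfolding I_def w_def c_def A_def by blast+
        obtain i where i: "I \<delta> = ennreal i" "0 \<le> i"
          using b(1) by (cases "I \<delta>" rule: ennreal_cases) auto
        have i_big: "2 * c * A / \<eta> < i"
          using elim(1) \<eta> c0 A0 unfolding i by (simp add: ennreal_less_iff)
        moreover have "0 < 2 * c * A / \<eta>" using \<eta> c0 A0 by simp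
        ultimately have i0: "0 < i" by linarith
        have w0: "0 \<le> w \<delta>" using sol[OF elim(2)] t unfolding dirac_solution_def w_def by auto
        have "ennreal (w \<delta>) * ennreal i \<le> ennreal c * (ennreal A + ennreal (2 * L * \<epsilon>) * ennreal i)"
          using b(2) unfolding i(1) .
        then have "ennreal (w \<delta> * i) \<le> ennreal (c * (A + 2 * L * \<epsilon> * i))"
          using w0 c0 A0 L0 \<epsilon>0 i(2) by (simp add: ennreal_mult ennreal_plus)
        then have "w \<delta> * i \<le> c * (A + 2 * L * \<epsilon> * i)"
          using c0 A0 L0 \<epsilon>0 i(2) by (simp add: ennreal_le_iff)
        also have "\<dots> = c * A + \<eta> / 2 * i"
          using c0 L0 by (simp add: \<epsilon>_def field_simps)
        also have "\<dots> < \<eta> / 2 * i + \<eta> / 2 * i"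
          using i_big \<eta> by (simp add: field_simps)
        finally have "w \<delta> * i < \<eta> * i" by simp
        then show ?case using i0 w0 by simp
      qed
    qed
    have "(w \<longlongrightarrow> 0) (at_right 0)"
      by (rule tendstoI) (use small in \<open>simp add: dist_real_def\<close>)
    then show ?thesis
      unfolding sing_heat_kernel_def w_def by (intro tendsto_Lim) simp_all
  qed
  then show ?thesis by (simp add: Sing_set_def)
qed

end
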